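(* For $j=1,2$, let $a_j\in W^{2,\infty}(\Omega)$ be real-valued and such that there exists a constant $a_0>0$ with $a_j(x)\geq a_0$ for all $x\in\Omega$, and assume that $$a_1(x)=a_2(x),\quad \nabla a_1(x)=\nabla a_2(x),\qquad x\in\partial\Omega.$$ Assume also that the following uniqueness result holds true: for all $q_1,q_2\in\mathcal Q$, $\Lambda_{q_1}^*=\Lambda_{q_2}^*$ implies $q_1=q_2$. Then $$\mathcal N^*_{a_1}=\mathcal N^*_{a_2}\ \Longrightarrow\ a_1=a_2 .$$
   Context: $\Omega$ is a bounded domain of $\mathbb{R}^n$, $n\geq 3$, with $C^2$ boundary $\partial\Omega$ and outward unit normal $\nu$. Fix $\eta\in\mathbb S^{n-1}$ and $\epsilon>0$, and let $V:=\{x\in\partial\Omega:\ \nu(x)\cdot\eta<2\epsilon\}$. For $a\in W^{2,\infty}(\Omega)$ bounded below by a positive constant and $\phi\in H^{3/2}(\partial\Omega)$, let $u_{a,\phi}\in H^2(\Omega)$ be the unique solution of $-\mathrm{div}(a\nabla u)=0$ in $\Omega$, $u=\phi$ on $\partial\Omega$, and define $$\mathcal N_a^*:H^{3/2}(\partial\Omega)\ni\phi\mapsto a\,\partial_\nu u_{a,\phi}|_V\in H^{1/2}(V).$$ $\mathcal Q$ is the set of all real-valued $q\in L^\infty(\Omega)$ such that, for all $w\in H^1_0(\Omega)\cap H^2(\Omega)$, $-\Delta w+qw=0$ in $\Omega$ implies $w=0$. For $q\in\mathcal Q$ and $\phi\in H^{3/2}(\partial\Omega)$, $v_{q,\phi}\in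 H^2(\Omega)$ denotes the unique solution of $-\Delta v+qv=0$ in $\Omega$, $v=\phi$ on $\partial\Omega$, and $$\Lambda_q^*:H^{3/2}(\partial\Omega)\ni\phi\mapsto\partial_\nu v_{q,\phi}|_V\in H^{1/2}(V).$$ *)

theory Defs
  imports "HOL-Analysis.Analysis"
begin

text \<open>
  Elements of function spaces are rendered by representatives: functions on the whole Euclidean
  space of which only the values on the domain (or on its boundary) matter, up to null sets.
  Solutions and boundary data are complex valued; the coefficients \<open>a\<close> and \<open>q\<close> are real valued.
\<close>

section \<open>Smooth functions and domains\<close>

text \<open>\<open>k\<close> times continuously differentiable on the open set \<open>S\<close>.\<close>

primrec Ck_on :: "nat \<Rightarrow> 'a::euclidean_space set \<Rightarrow> ('a \<Rightarrow> 'b::euclidean_space) \<Rightarrow> bool" where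
  "Ck_on 0 S f \<longleftrightarrow> continuous_on S f"
| "Ck_on (Suc k) S f \<longleftrightarrow>
     (\<exists>D. (\<forall>x\<in>S. (f has_derivative D x) (at x)) \<and> (\<forall>i\<in>Basis. Ck_on k S (\<lambda>x. D x i)))"

definition test_functions :: "'a::euclidean_space set \<Rightarrow> ('a \<Rightarrow> 'b::euclidean_space) set" where
  "test_functions \<Omega> =
     {\<psi>. (\<forall>k. Ck_on k UNIV \<psi>) \<and> (\<exists>K. compact K \<and> K \<subseteq> \<Omega> \<and> (\<forall>x. x \<notin> K \<longrightarrow> \<psi> x = 0))}"

text \<open>\<open>\<rho>\<close> is a \<open>C\<^sup>2\<close> function near \<open>x\<close> that is negative exactly on \<open>\<Omega>\<close>, with gradient \<open>g \<noteq> 0\<close> at \<open>x\<close>.\<close>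

definition local_defining_function ::
    "'a::euclidean_space set \<Rightarrow> 'a \<Rightarrow> ('a \<Rightarrow> real) \<Rightarrow> 'a \<Rightarrow> bool" where
  "local_defining_function \<Omega> x \<rho> g \<longleftrightarrow>
     (\<exists>r>0. Ck_on 2 (ball x r) \<rho> \<and> \<Omega> \<inter> ball x r = {y \<in> ball x r. \<rho> y < 0}) \<and>
     (\<rho> has_derivative (\<lambda>h. g \<bullet> h)) (at x) \<and> g \<noteq> 0"

definition C2_boundary :: "'a::euclidean_space set \<Rightarrow> bool" where
  "C2_boundary \<Omega> \<longleftrightarrow> (\<forall>x\<in>frontier \<Omega>. \<exists>\<rho> g. local_defining_function \<Omega> x \<rho> g)"

definition outer_normal :: "'a::euclidean_space set \<Rightarrow> 'a \<Rightarrow> 'a" where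
  "outer_normal \<Omega> x = (THE \<nu>. \<exists>\<rho> g. local_defining_function \<Omega> x \<rho> g \<and> \<nu> = g /\<^sub>R norm g)"

definition bdry_part :: "'a::euclidean_space set \<Rightarrow> 'a \<Rightarrow> real \<Rightarrow> 'a set" where
  "bdry_part \<Omega> \<eta> \<epsilon> = {x \<in> frontier \<Omega>. outer_normal \<Omega> x \<bullet> \<eta> < 2 * \<epsilon>}"

section \<open>Surface measure\<close>

definition hausdorff_premeasure :: "nat \<Rightarrow> real \<Rightarrow> 'a::euclidean_space set \<Rightarrow> ennreal" where
  "hausdorff_premeasure s \<delta> A =
     (INF C \<in> {C :: nat \<Rightarrow> 'a set. A \<subseteq> (\<Union>k. C k) \<and> (\<forall>k. bounded (C k) \<and> diameter (C k) \<le> \<delta>)}.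
        \<Sum>k. ennreal (unit_ball_vol (real s) * (diameter (C k) / 2) ^ s))"

text \<open>
  The set function below is countably additive on Borel sets (it is the \<open>s\<close>-dimensional Hausdorff
  measure, \<open>s \<ge> 1\<close>), so \<^const>\<open>measure_of\<close> does not fall back to the zero measure.
\<close>

definition hausdorff_measure :: "nat \<Rightarrow> 'a::euclidean_space measure" where
  "hausdorff_measure s =
     measure_of UNIV (sets borel) (\<lambda>A. SUP \<delta>\<in>{0<..}. hausdorff_premeasure s \<delta> A)"

definition surface_measure :: "'a::euclidean_space set \<Rightarrow> 'a measure" where
  "surface_measure \<Omega> = restrict_space (hausdorff_measure (DIM('a) - 1)) (frontier \<Omega>)"

section \<open>Sobolev spaces\<close>

definition L2_space :: "'a measure \<Rightarrow> ('a \<Rightarrow> 'b::euclidean_space) set" where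
  "L2_space M = {f \<in> borel_measurable M. integrable M (\<lambda>x. (norm (f x))\<^sup>2)}"

definition Linf_space :: "'a measure \<Rightarrow> ('a \<Rightarrow> 'b::euclidean_space) set" where
  "Linf_space M = {f \<in> borel_measurable M. \<exists>C. AE x in M. norm (f x) \<le> C}"

definition loc_integrable :: "'a::euclidean_space set \<Rightarrow> ('a \<Rightarrow> 'b::euclidean_space) \<Rightarrow> bool" where
  "loc_integrable \<Omega> f \<longleftrightarrow> (\<forall>K. compact K \<longrightarrow> K \<subseteq> \<Omega> \<longrightarrow> set_integrable lebesgue K f)"

definition has_weak_deriv ::
    "'a::euclidean_space set \<Rightarrow> 'a \<Rightarrow> ('a \<Rightarrow> 'b::euclidean_space) \<Rightarrow> ('a \<Rightarrow> 'b) \<Rightarrow> bool" where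
  "has_weak_deriv \<Omega> i f g \<longleftrightarrow> loc_integrable \<Omega> f \<and> loc_integrable \<Omega> g \<and>
     (\<forall>\<psi> \<in> (test_functions \<Omega> :: ('a \<Rightarrow> real) set).
        (LINT x|lebesgue_on \<Omega>. frechet_derivative \<psi> (at x) i *\<^sub>R f x)
          = - (LINT x|lebesgue_on \<Omega>. \<psi> x *\<^sub>R g x))"

text \<open>Weak derivatives are unique only almost everywhere; this is a choice of representative.\<close>

definition weak_deriv ::
    "'a::euclidean_space set \<Rightarrow> 'a \<Rightarrow> ('a \<Rightarrow> 'b::euclidean_space) \<Rightarrow> 'a \<Rightarrow> 'b" where
  "weak_deriv \<Omega> i f = (SOME g. has_weak_deriv \<Omega> i f g)"

text \<open>Functions in \<open>X\<close> all of whose weak derivatives of order up to \<open>k\<close> are in \<open>X\<close>.\<close>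

primrec sobolev ::
    "nat \<Rightarrow> 'a::euclidean_space set \<Rightarrow> ('a \<Rightarrow> 'b::euclidean_space) set \<Rightarrow> ('a \<Rightarrow> 'b) set" where
  "sobolev 0 \<Omega> X = X"
| "sobolev (Suc k) \<Omega> X = {f \<in> X. \<forall>i\<in>Basis. \<exists>g \<in> sobolev k \<Omega> X. has_weak_deriv \<Omega> i f g}"

abbreviation H_space :: "nat \<Rightarrow> 'a::euclidean_space set \<Rightarrow> ('a \<Rightarrow> 'b::euclidean_space) set" where
  "H_space k \<Omega> \<equiv> sobolev k \<Omega> (L2_space (lebesgue_on \<Omega>))"

abbreviation Winf_space :: "nat \<Rightarrow> 'a::euclidean_space set \<Rightarrow> ('a \<Rightarrow> real) set" where
  "Winf_space k \<Omega> \<equiv> sobolev k \<Omega> (Linf_space (lebesgue_on \<Omega>))"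

definition H1_norm :: "'a::euclidean_space set \<Rightarrow> ('a \<Rightarrow> 'b::euclidean_space) \<Rightarrow> real" where
  "H1_norm \<Omega> f = sqrt ((LINT x|lebesgue_on \<Omega>. (norm (f x))\<^sup>2)
      + (\<Sum>i\<in>Basis. LINT x|lebesgue_on \<Omega>. (norm (weak_deriv \<Omega> i f x))\<^sup>2))"

definition H10_space :: "'a::euclidean_space set \<Rightarrow> ('a \<Rightarrow> 'b::euclidean_space) set" where
  "H10_space \<Omega> = {f \<in> H_space 1 \<Omega>. \<exists>\<psi>. (\<forall>k. \<psi> k \<in> test_functions \<Omega>) \<and>
      (\<lambda>k::nat. H1_norm \<Omega> (\<lambda>x. \<psi> k x - f x)) \<longlonglongrightarrow> 0}"

section \<open>Boundary values\<close>

text \<open>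
  Trace in \<open>L\<^sup>2(\<partial>\<Omega>)\<close> of an \<open>H\<^sup>1(\<Omega>)\<close> function: the bounded extension of the restriction map
  \<open>u \<mapsto> u|\<^bsub>\<partial>\<Omega>\<^esub>\<close> from the \<open>H\<^sup>1(\<Omega>)\<close> functions that are continuous up to the boundary.
\<close>

definition has_trace ::
    "'a::euclidean_space set \<Rightarrow> ('a \<Rightarrow> 'b::euclidean_space) \<Rightarrow> ('a \<Rightarrow> 'b) \<Rightarrow> bool" where
  "has_trace \<Omega> u g \<longleftrightarrow> u \<in> H_space 1 \<Omega> \<and> g \<in> L2_space (surface_measure \<Omega>) \<and>
     (\<exists>U. (\<forall>k. U k \<in> H_space 1 \<Omega> \<and> continuous_on (closure \<Omega>) (U k)) \<and>
        (\<lambda>k::nat. H1_norm \<Omega> (\<lambda>x. U k x - u x)) \<longlonglongrightarrow> 0 \<and>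
        (\<lambda>k. \<integral>\<^sup>+ x. ennreal ((norm (U k x - g x))\<^sup>2) \<partial>surface_measure \<Omega>) \<longlonglongrightarrow> 0)"

text \<open>\<open>H\<^bsup>3/2\<^esup>(\<partial>\<Omega>)\<close> is the trace space of \<open>H\<^sup>2(\<Omega>)\<close>.\<close>

definition H32_bdry :: "'a::euclidean_space set \<Rightarrow> ('a \<Rightarrow> complex) set" where
  "H32_bdry \<Omega> = {\<phi>. \<exists>u \<in> H_space 2 \<Omega>. has_trace \<Omega> u \<phi>}"

definition has_normal_deriv ::
    "'a::euclidean_space set \<Rightarrow> ('a \<Rightarrow> complex) \<Rightarrow> ('a \<Rightarrow> complex) \<Rightarrow> bool" where
  "has_normal_deriv \<Omega> u g \<longleftrightarrow>
     (\<exists>G. (\<forall>i\<in>Basis. has_trace \<Omega> (weak_deriv \<Omega> i u) (G i)) \<and>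
        (AE x in surface_measure \<Omega>. g x = (\<Sum>i\<in>Basis. (outer_normal \<Omega> x \<bullet> i) *\<^sub>R G i x)))"

text \<open>
  Pointwise boundary value of (the continuous representative of) \<open>f\<close>. For \<open>f \<in> W\<^bsup>2,\<infinity>\<^esup>(\<Omega>)\<close>, both \<open>f\<close>
  and its first derivatives have exactly one such value at every boundary point.
\<close>

definition has_bdry_value :: "'a::euclidean_space set \<Rightarrow> ('a \<Rightarrow> real) \<Rightarrow> 'a \<Rightarrow> real \<Rightarrow> bool" where
  "has_bdry_value \<Omega> f x l \<longleftrightarrow>
     (\<exists>g. continuous_on (closure \<Omega>) g \<and> (AE y in lebesgue_on \<Omega>. g y = f y) \<and> g x = l)"

definition bdry_value :: "'a::euclidean_space set \<Rightarrow> ('a \<Rightarrow> real) \<Rightarrow> 'a \<Rightarrow> real" where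
  "bdry_value \<Omega> f x = (THE l. has_bdry_value \<Omega> f x l)"

section \<open>Boundary value problems and partial Dirichlet-to-Neumann maps\<close>

definition laplacian :: "'a::euclidean_space set \<Rightarrow> ('a \<Rightarrow> complex) \<Rightarrow> 'a \<Rightarrow> complex" where
  "laplacian \<Omega> u x = (\<Sum>i\<in>Basis. weak_deriv \<Omega> i (weak_deriv \<Omega> i u) x)"

definition div_a_grad ::
    "'a::euclidean_space set \<Rightarrow> ('a \<Rightarrow> real) \<Rightarrow> ('a \<Rightarrow> complex) \<Rightarrow> 'a \<Rightarrow> complex" where
  "div_a_grad \<Omega> a u x = (\<Sum>i\<in>Basis. weak_deriv \<Omega> i (\<lambda>y. a y *\<^sub>R weak_deriv \<Omega> i u y) x)"

text \<open>
  The solutions \<open>u\<^bsub>a,\<phi>\<^esub>\<close> and \<open>v\<^bsub>q,\<phi>\<^esub>\<close> are unique as elements of \<open>H\<^sup>2(\<Omega>)\<close>; each is given here as the set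
  of its representatives, and so are the values of the maps \<open>N\<^sub>a\<^sup>*\<close> and \<open>\<Lambda>\<^sub>q\<^sup>*\<close>, functions on \<open>V\<close>
  modulo equality almost everywhere.
\<close>

definition conductivity_solution ::
    "'a::euclidean_space set \<Rightarrow> ('a \<Rightarrow> real) \<Rightarrow> ('a \<Rightarrow> complex) \<Rightarrow> ('a \<Rightarrow> complex) set" where
  "conductivity_solution \<Omega> a \<phi> =
     {u \<in> H_space 2 \<Omega>. (AE x in lebesgue_on \<Omega>. - div_a_grad \<Omega> a u x = 0) \<and> has_trace \<Omega> u \<phi>}"

definition N_star ::
    "'a::euclidean_space set \<Rightarrow> 'a set \<Rightarrow> ('a \<Rightarrow> real) \<Rightarrow> ('a \<Rightarrow> complex) \<Rightarrow> ('a \<Rightarrow> complex) set" where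
  "N_star \<Omega> V a \<phi> =
     {\<psi>. \<exists>u \<in> conductivity_solution \<Omega> a \<phi>. \<exists>g. has_normal_deriv \<Omega> u g \<and>
        (AE x in surface_measure \<Omega>. x \<in> V \<longrightarrow> \<psi> x = bdry_value \<Omega> a x *\<^sub>R g x)}"

definition Q_class :: "'a::euclidean_space set \<Rightarrow> ('a \<Rightarrow> real) set" where
  "Q_class \<Omega> = {q \<in> Linf_space (lebesgue_on \<Omega>).
     \<forall>w \<in> H10_space \<Omega> \<inter> H_space 2 \<Omega>.
       (AE x in lebesgue_on \<Omega>. - laplacian \<Omega> w x + q x *\<^sub>R w x = 0) \<longrightarrow>
       (AE x in lebesgue_on \<Omega>. w x = 0)}"

definition schroedinger_solution ::
    "'a::euclidean_space set \<Rightarrow> ('a \<Rightarrow> real) \<Rightarrow> ('a \<Rightarrow> complex) \<Rightarrow> ('a \<Rightarrow> complex) set" where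
  "schroedinger_solution \<Omega> q \<phi> =
     {v \<in> H_space 2 \<Omega>. (AE x in lebesgue_on \<Omega>. - laplacian \<Omega> v x + q x *\<^sub>R v x = 0) \<and>
        has_trace \<Omega> v \<phi>}"

definition Lambda_star ::
    "'a::euclidean_space set \<Rightarrow> 'a set \<Rightarrow> ('a \<Rightarrow> real) \<Rightarrow> ('a \<Rightarrow> complex) \<Rightarrow> ('a \<Rightarrow> complex) set" where
  "Lambda_star \<Omega> V q \<phi> =
     {\<psi>. \<exists>v \<in> schroedinger_solution \<Omega> q \<phi>. \<exists>g. has_normal_deriv \<Omega> v g \<and>
        (AE x in surface_measure \<Omega>. x \<in> V \<longrightarrow> \<psi> x = g x)}"

end

theory Submission
  imports Defs
begin

text \<open>
  The Liouville transform \<open>v = b u\<close>, \<open>b = \<surd>a\<close>, turns \<open>- div (a \<nabla>u) = 0\<close> into \<open>- \<Delta>v + q v = 0\<close> with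
  \<open>q = \<Delta>b / b\<close>, and \<open>\<partial>\<^sub>\<nu> v = b \<partial>\<^sub>\<nu> u + u \<partial>\<^sub>\<nu> b\<close>. As the coefficients agree to first order on the
  boundary, equality of the \<open>N\<^sup>*\<close> maps gives equality of the \<open>\<Lambda>\<^sup>*\<close> maps, hence \<open>q\<^sub>1 = q\<^sub>2 = q\<close>.
  Every such \<open>q\<close> lies in \<open>Q\<close>, because \<open>\<integral> |\<nabla>\<psi>|\<^sup>2 + q \<psi>\<^sup>2 = \<integral> b\<^sup>2 |\<nabla>(\<psi> / b)|\<^sup>2\<close> for test functions.
  Finally \<open>w = b\<^sub>1 - b\<^sub>2\<close> solves \<open>- \<Delta>w + q w = 0\<close> and vanishes to first order on the boundary, so
  it is in \<open>H\<^sub>0\<^sup>1\<close> and therefore zero. The continuous boundary values assumed for \<open>a\<close> and \<open>\<nabla>a\<close> make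
  \<open>b\<close> and \<open>\<nabla>b\<close> continuous up to the boundary; products and compositions are differentiated weakly by
  mollification.
\<close>

section \<open>Smooth functions and mollifiers\<close>

text \<open>Two features of the setting shape the work. Functions are representatives and
  \<open>weak_deriv\<close> is an arbitrary choice, so derivatives are carried explicitly beside
  each function and meet \<open>weak_deriv\<close> only almost everywhere. Boundary values are
  pointwise for the coefficients but L2 limits for the solutions; the product of a coefficient and a
  solution gets its trace by multiplying an approximating sequence with a factor that is continuous
  up to the boundary. Hence b is built from continuous representatives of a and of its gradient. A
  nonnegative energy alone does not put q into Q. The integral of b^2 |\<nabla>(\<psi> / b)|^2 has
  to control \<psi> itself, which is a Poincare inequality for \<psi> / b, and a solution in the
  closure of the test functions is not a test function, so the energies of its approximants have to
  be shown to tend to zero. For b1 - b2 the cut-off near the boundary follows level sets of a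
  function of the difference itself and of its gradient, so that the size of the cut-off error is
  governed by the function being cut off.\<close>

lemma Ck_on_imp_continuous_on: "Ck_on k S f \<Longrightarrow> continuous_on S f"
  by (cases k) (auto intro!: continuous_at_imp_continuous_on intro: has_derivative_continuous)

lemma Ck_on_SucD: "Ck_on (Suc k) S f \<Longrightarrow> Ck_on k S f"
proof (induction k arbitrary: f)
  case 0
  then show ?case using Ck_on_imp_continuous_on[of "Suc 0" S f] by simp
next
  case (Suc k)
  then show ?case by (subst Ck_on.simps) (metis Ck_on.simps(2))
qed

lemma Ck_on_SucI:
  assumes "\<And>x. x \<in> S \<Longrightarrow> (f has_derivative D x) (at x)"
    and "\<And>i. i \<in> Basis \<Longrightarrow> Ck_on k S (\<lambda>x. D x i)"
  shows "Ck_on (Suc k) S f"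
  using assms by auto

lemma Ck_on_const: "Ck_on k S (\<lambda>x. c)"
proof (induction k arbitrary: c)
  case (Suc k)
  show ?case
    by (rule Ck_on_SucI[where D="\<lambda>x h. 0"]) (auto simp: Suc)
qed simp

lemma Ck_on_bounded_linear:
  assumes "bounded_linear T" "Ck_on k S f"
  shows "Ck_on k S (\<lambda>x. T (f x))"
  using assms(2)
proof (induction k arbitrary: f)
  case 0
  then show ?case by (simp add: bounded_linear.continuous_on[OF assms(1)])
next
  case (Suc k)
  then obtain D where D: "\<And>x. x \<in> S \<Longrightarrow> (f has_derivative D x) (at x)"
    "\<And>i. i \<in> Basis \<Longrightarrow> Ck_on k S (\<lambda>x. D x i)" by auto
  show ?case
    by (rule Ck_on_SucI[where D="\<lambda>x h. T (D x h)"])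
      (use D Suc.IH in \<open>auto intro!: bounded_linear.has_derivative[OF assms(1)]\<close>)
qed

lemma Ck_on_add:
  assumes "Ck_on k S f" "Ck_on k S g"
  shows "Ck_on k S (\<lambda>x. f x + g x)"
  using assms
proof (induction k arbitrary: f g)
  case 0
  then show ?case by (simp add: continuous_on_add)
next
  case (Suc k)
  then obtain D E where D: "\<And>x. x \<in> S \<Longrightarrow> (f has_derivative D x) (at x)"
    "\<And>i. i \<in> Basis \<Longrightarrow> Ck_on k S (\<lambda>x. D x i)"
    and E: "\<And>x. x \<in> S \<Longrightarrow> (g has_derivative E x) (at x)"
    "\<And>i. i \<in> Basis \<Longrightarrow> Ck_on k S (\<lambda>x. E x i)" by (auto simp: Ball_def)
  show ?case
    by (rule Ck_on_SucI[where D="\<lambda>x h. D x h + E x h"])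
      (use D E Suc.IH has_derivative_add in auto)
qed

lemma Ck_on_mult:
  fixes f g :: "'a::euclidean_space \<Rightarrow> real"
  assumes "Ck_on k S f" "Ck_on k S g"
  shows "Ck_on k S (\<lambda>x. f x * g x)"
  using assms
proof (induction k arbitrary: f g)
  case 0
  then show ?case by (simp add: continuous_on_mult)
next
  case (Suc k)
  then obtain D E where D: "\<And>x. x \<in> S \<Longrightarrow> (f has_derivative D x) (at x)"
    "\<And>i. i \<in> Basis \<Longrightarrow> Ck_on k S (\<lambda>x. D x i)"
    and E: "\<And>x. x \<in> S \<Longrightarrow> (g has_derivative E x) (at x)"
    "\<And>i. i \<in> Basis \<Longrightarrow> Ck_on k S (\<lambda>x. E x i)" by (auto simp: Ball_def)
  show ?case
  proof (rule Ck_on_SucI[where D="\<lambda>x h. f x * E x h + D x h * g x"])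
    show "((\<lambda>x. f x * g x) has_derivative (\<lambda>h. f x * E x h + D x h * g x)) (at x)" if "x \<in> S" for x
      by (rule has_derivative_mult[OF D(1)[OF that] E(1)[OF that]])
    show "Ck_on k S (\<lambda>x. f x * E x i + D x i * g x)" if "i \<in> Basis" for i
      by (intro Ck_on_add Suc.IH D(2) E(2) that Suc.prems[THEN Ck_on_SucD])
  qed
qed

abbreviation smooth :: "('a::euclidean_space \<Rightarrow> 'b::euclidean_space) \<Rightarrow> bool" where
  "smooth f \<equiv> \<forall>k. Ck_on k UNIV f"

lemma smooth_has_derivative:
  assumes "smooth f" shows "(f has_derivative frechet_derivative f (at x)) (at x)"
proof -
  have "Ck_on (Suc 0) UNIV f" using assms by blast
  then have "f differentiable (at x)" by (auto intro: differentiableI)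
  then show ?thesis by (simp add: frechet_derivative_works)
qed

lemma smooth_continuous: "smooth f \<Longrightarrow> continuous_on S f"
  using Ck_on_imp_continuous_on[of 0 UNIV f] continuous_on_subset by blast

lemma smooth_partial:
  assumes "smooth f" "i \<in> Basis" shows "smooth (\<lambda>x. frechet_derivative f (at x) i)"
proof
  fix k
  have "Ck_on (Suc k) UNIV f" using assms by blast
  then obtain D where D: "\<And>x. (f has_derivative D x) (at x)" "Ck_on k UNIV (\<lambda>x. D x i)"
    using assms(2) by auto
  have "frechet_derivative f (at x) = D x" for x
    using frechet_derivative_at[OF D(1)] by metis
  then show "Ck_on k UNIV (\<lambda>x. frechet_derivative f (at x) i)" using D by simp
qed

lemma has_derivative_zero_outside_closed:
  assumes "closed K" "\<And>x. x \<notin> K \<Longrightarrow> f x = 0" "x \<notin> K"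
  shows "(f has_derivative (\<lambda>h. 0)) (at x)"
proof (rule has_derivative_transform_within_open[where s="- K"])
  show "((\<lambda>x. 0) has_derivative (\<lambda>h. 0)) (at x)" by simp
qed (use assms in auto)

lemma frechet_derivative_zero_outside_closed:
  assumes "closed K" "\<And>x. x \<notin> K \<Longrightarrow> f x = 0" "x \<notin> K"
  shows "frechet_derivative f (at x) = (\<lambda>h. 0)"
  using frechet_derivative_at[OF has_derivative_zero_outside_closed[OF assms]] by simp

section \<open>Bump functions and the standard mollifier\<close>

definition exp_quot :: "nat \<Rightarrow> real \<Rightarrow> real" where
  "exp_quot n t = (if t > 0 then exp (- (1 / t)) / t ^ n else 0)"

text \<open>With s = 1 / t the limit from the right is that of s^n / exp s as s tends to infinity;
  on the left the function is zero.\<close>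

lemma exp_quot_tendsto_0: "(exp_quot n \<longlongrightarrow> 0) (at 0)"
proof -
  have "((\<lambda>t::real. (inverse t) ^ n / exp (inverse t)) \<longlongrightarrow> 0) (at_right 0)"
    by (rule filterlim_compose[OF tendsto_power_div_exp_0 filterlim_inverse_at_top_right])
  then have "(exp_quot n \<longlongrightarrow> 0) (at_right 0)"
    by (rule Lim_transform_eventually)
      (auto simp: exp_quot_def eventually_at_right_field exp_minus field_simps intro!: exI[of _ 1])
  moreover have "(exp_quot n \<longlongrightarrow> 0) (at_left 0)"
    by (rule tendsto_eventually) (auto simp: exp_quot_def eventually_at_left_field intro!: exI[of _ "-1"])
  ultimately show ?thesis by (simp add: filterlim_split_at)
qed

text \<open>The family is closed under differentiation. That is why the power n is carried along:
  smoothness of the classical exp (- 1 / t) then follows by an induction that treats all n at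
  once.\<close>

lemma exp_quot_has_derivative:
  "(exp_quot n has_real_derivative exp_quot (n + 2) t - real n * exp_quot (n + 1) t) (at t)"
proof -
  consider "t > 0" | "t = 0" | "t < 0" by linarith
  then show ?thesis
  proof cases
    case 1
    have "((\<lambda>t. exp (- (1 / t)) / t ^ n) has_real_derivative
        exp_quot (n + 2) t - real n * exp_quot (n + 1) t) (at t)"
      using 1
      apply (cases n)
       apply (auto intro!: derivative_eq_intros simp: exp_quot_def)
      apply (auto simp: field_simps power2_eq_square)
      subgoal for m by (cases m) auto
      done
    then show ?thesis
      by (rule DERIV_cong_ev[THEN iffD1, rotated 3])
        (use 1 eventually_nhds_in_open[of "{0<..}" t] in \<open>auto simp: exp_quot_def elim!: eventually_mono\<close>)
  next
    case 2
    \<comment> \<open>The difference quotient at 0 is \<open>exp_quot (Suc n) h\<close>, the next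
      member of the family, whose limit is already known.\<close>
    have "((\<lambda>h. exp_quot n h / h) \<longlongrightarrow> 0) (at 0)"
      by (rule Lim_transform_eventually[OF exp_quot_tendsto_0[of "Suc n"]])
        (auto simp: exp_quot_def eventually_at_filter)
    then show ?thesis using 2 by (simp add: DERIV_def) (simp add: exp_quot_def)
  next
    case 3
    have "((\<lambda>t. 0) has_real_derivative exp_quot (n + 2) t - real n * exp_quot (n + 1) t) (at t)"
      using 3 by (auto simp: exp_quot_def)
    then show ?thesis
      by (rule DERIV_cong_ev[THEN iffD1, rotated 3])
        (use 3 eventually_nhds_in_open[of "{..<0}" t] in \<open>auto simp: exp_quot_def elim!: eventually_mono\<close>)
  qed
qed

text \<open>For n = 0 this is the classical bump exp (- 1 / (r^2 - |x|^2)) on the ball of radius r,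
  extended by zero; the other n enter through its derivatives.\<close>

definition bump :: "nat \<Rightarrow> real \<Rightarrow> 'a::euclidean_space \<Rightarrow> real" where
  "bump n r x = exp_quot n (r\<^sup>2 - x \<bullet> x)"

lemma bump_has_derivative:
  "(bump n r has_derivative
     (\<lambda>h. (bump (n + 2) r x - real n * bump (n + 1) r x) * (- 2 * (x \<bullet> h)))) (at x)"
proof -
  have "((\<lambda>x. r\<^sup>2 - x \<bullet> x) has_derivative (\<lambda>h. - 2 * (x \<bullet> h))) (at x)"
    by (auto intro!: derivative_eq_intros simp: inner_commute)
  from DERIV_compose_FDERIV[OF exp_quot_has_derivative this, of n]
  show ?thesis unfolding bump_def by (simp add: mult.commute)
qed

text \<open>Induction on k with n free: a partial derivative is a combination of
  \<open>bump (n + 2) r\<close> and \<open>bump (n + 1) r\<close>, multiplied by a linear function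
  of x.\<close>

lemma smooth_bump: "smooth (bump n r :: 'a::euclidean_space \<Rightarrow> real)"
proof
  fix k
  have lin: "Ck_on k UNIV (\<lambda>x::'a. - 2 * (x \<bullet> i))" for k i
  proof (cases k)
    case (Suc l)
    show ?thesis unfolding Suc
      by (rule Ck_on_SucI[where D="\<lambda>x h. - 2 * (h \<bullet> i)"])
        (auto intro!: derivative_eq_intros Ck_on_const)
  qed (auto intro!: continuous_intros)
  show "Ck_on k UNIV (bump n r :: 'a \<Rightarrow> real)"
  proof (induction k arbitrary: n)
    case 0
    show ?case
      by (auto intro!: continuous_at_imp_continuous_on has_derivative_continuous[OF bump_has_derivative])
  next
    case (Suc k)
    show ?case
    proof (rule Ck_on_SucI[OF bump_has_derivative], rule Ck_on_mult)
      fix i :: 'a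
      have "Ck_on k UNIV (\<lambda>x::'a. - (real n * bump (n + 1) r x))"
        by (rule Ck_on_bounded_linear[of "\<lambda>t. - (real n * t)"])
          (auto intro!: Suc bounded_linear_minus bounded_linear_mult_right)
      from Ck_on_add[OF Suc[of "n + 2"] this]
      show "Ck_on k UNIV (\<lambda>x::'a. bump (n + 2) r x - real n * bump (n + 1) r x)" by simp
    qed (use lin in auto)
  qed
qed

lemma bump_nonneg: "bump n r x \<ge> 0"
  by (simp add: bump_def exp_quot_def)

lemma bump_eq_0: "r \<ge> 0 \<Longrightarrow> norm x \<ge> r \<Longrightarrow> bump n r x = 0"
proof -
  assume "r \<ge> 0" "norm x \<ge> r"
  then have "r\<^sup>2 \<le> x \<bullet> x" using power_mono[of r "norm x" 2] by (simp add: dot_square_norm)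
  then show ?thesis by (simp add: bump_def exp_quot_def)
qed

lemma bump_0_pos: "r > 0 \<Longrightarrow> bump n r 0 > 0"
  by (simp add: bump_def exp_quot_def)

lemma integrable_continuous_compact_support:
  fixes f :: "'a::euclidean_space \<Rightarrow> 'b::euclidean_space"
  assumes "continuous_on UNIV f" "compact K" "\<And>x. x \<notin> K \<Longrightarrow> f x = 0"
  shows "integrable lborel f"
proof -
  have "set_integrable lborel K f"
    unfolding set_integrable_def
    by (rule borel_integrable_compact[OF assms(2)]) (use assms continuous_on_subset in blast)
  moreover have "(\<lambda>x. indicat_real K x *\<^sub>R f x) = f" using assms(3) by (auto simp: indicator_def)
  ultimately show ?thesis by (simp add: set_integrable_def)
qed

text \<open>If the integral were zero, the nonvanishing set would be open and null, hence empty,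
  although the origin belongs to it. This legitimates the normalisation of the mollifier.\<close>

lemma bump_integral_pos:
  assumes "r > 0" shows "(\<integral>x. bump n r (x::'a::euclidean_space) \<partial>lborel) > 0"
proof -
  have c: "continuous_on UNIV (bump n r :: 'a \<Rightarrow> real)" using smooth_continuous[OF smooth_bump] .
  have i: "integrable lborel (bump n r :: 'a \<Rightarrow> real)"
    by (rule integrable_continuous_compact_support[OF c compact_cball[of 0 r]])
      (use assms in \<open>auto intro!: bump_eq_0\<close>)
  have "\<not> (AE x in lborel. bump n r (x::'a) = 0)"
  proof
    assume "AE x in lborel. bump n r (x::'a) = 0"
    then have "AE x in lborel. x \<notin> {x. bump n r (x::'a) \<noteq> 0}" by simp
    moreover have o: "open {x. bump n r (x::'a) \<noteq> 0}"
      by (rule open_Collect_neq[OF c continuous_on_const])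
    ultimately have "{x. bump n r (x::'a) \<noteq> 0} \<in> null_sets lborel"
      by (subst AE_iff_null_sets) (simp_all add: borel_open)
    then have "negligible {x. bump n r (x::'a) \<noteq> 0}"
      by (simp add: negligible_iff_null_sets null_sets_completionI)
    then have "{x. bump n r (x::'a) \<noteq> 0} = {}" using open_not_negligible[OF o] by blast
    then have "bump n r (0::'a) = 0" by blast
    then show False using bump_0_pos[OF assms, of n, where 'a='a] by simp
  qed
  then have "(\<integral>x. bump n r (x::'a) \<partial>lborel) \<noteq> 0"
    using integral_nonneg_eq_0_iff_AE[OF i] by (simp add: bump_nonneg)
  moreover have "(\<integral>x. bump n r (x::'a) \<partial>lborel) \<ge> 0" by (intro integral_nonneg_AE) (auto simp: bump_nonneg)
  ultimately show ?thesis by linarith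
qed

definition mollifier :: "real \<Rightarrow> 'a::euclidean_space \<Rightarrow> real" where
  "mollifier r x = bump 0 r x / (\<integral>y. bump 0 r (y::'a) \<partial>lborel)"

lemma smooth_mollifier: "smooth (mollifier r)"
  unfolding mollifier_def divide_inverse
  by (intro allI Ck_on_bounded_linear[OF bounded_linear_mult_left] smooth_bump[rule_format])

lemma mollifier_nonneg: "mollifier r x \<ge> 0"
  by (simp add: mollifier_def bump_nonneg integral_nonneg_AE)

lemma mollifier_eq_0: "r \<ge> 0 \<Longrightarrow> norm x \<ge> r \<Longrightarrow> mollifier r x = 0"
  by (simp add: mollifier_def bump_eq_0)

lemma integral_mollifier: "r > 0 \<Longrightarrow> (\<integral>x. mollifier r (x::'a::euclidean_space) \<partial>lborel) = 1"
  using bump_integral_pos[of r 0, where 'a='a] unfolding mollifier_def by simp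

lemma mollifier_cball: "r \<ge> 0 \<Longrightarrow> x \<notin> cball 0 r \<Longrightarrow> mollifier r x = 0"
  by (auto intro!: mollifier_eq_0)

section \<open>Operations on test functions and their derivatives\<close>

lemma test_functions_iff:
  "\<psi> \<in> test_functions \<Omega> \<longleftrightarrow> smooth \<psi> \<and> (\<exists>K. compact K \<and> K \<subseteq> \<Omega> \<and> (\<forall>x. x \<notin> K \<longrightarrow> \<psi> x = 0))"
  by (simp add: test_functions_def)

lemma test_functionsE:
  assumes "\<psi> \<in> test_functions \<Omega>"
  obtains K where "smooth \<psi>" "compact K" "K \<subseteq> \<Omega>" "\<And>x. x \<notin> K \<Longrightarrow> \<psi> x = 0"
    "\<And>x. x \<notin> K \<Longrightarrow> frechet_derivative \<psi> (at x) = (\<lambda>h. 0)"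
  using assms frechet_derivative_zero_outside_closed compact_imp_closed
  unfolding test_functions_iff by metis

lemma test_functions_mult:
  fixes \<psi> \<zeta> :: "'a::euclidean_space \<Rightarrow> real"
  assumes "\<psi> \<in> test_functions \<Omega>" "smooth \<zeta>"
  shows "(\<lambda>x. \<zeta> x * \<psi> x) \<in> test_functions \<Omega>"
  using assms Ck_on_mult unfolding test_functions_iff by (metis mult_zero_right)

lemma test_functions_bounded_linear:
  assumes "bounded_linear T" "\<psi> \<in> test_functions \<Omega>"
  shows "(\<lambda>x. T (\<psi> x)) \<in> test_functions \<Omega>"
  using assms Ck_on_bounded_linear[OF assms(1)] bounded_linear.linear[OF assms(1), THEN linear_0]
  unfolding test_functions_iff by metis

lemma frechet_derivative_bounded_linear:
  assumes "bounded_linear T" "smooth \<psi>"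
  shows "frechet_derivative (\<lambda>x. T (\<psi> x)) (at x) h = T (frechet_derivative \<psi> (at x) h)"
  using frechet_derivative_at[OF bounded_linear.has_derivative[OF assms(1) smooth_has_derivative[OF assms(2)]]]
  by metis

lemma frechet_derivative_mult:
  fixes \<psi> \<zeta> :: "'a::euclidean_space \<Rightarrow> real"
  assumes "smooth \<psi>" "smooth \<zeta>"
  shows "frechet_derivative (\<lambda>x. \<zeta> x * \<psi> x) (at x) h =
     \<zeta> x * frechet_derivative \<psi> (at x) h + frechet_derivative \<zeta> (at x) h * \<psi> x"
  using frechet_derivative_at[OF has_derivative_mult[OF smooth_has_derivative[OF assms(2)] smooth_has_derivative[OF assms(1)]]]
  by metis

section \<open>Convolution with a mollifier\<close>

lemma lborel_distr_reflect: "distr lborel borel (\<lambda>x. c - x) = (lborel :: 'a::euclidean_space measure)"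
proof -
  have "(lborel :: 'a measure) = density (distr lborel borel (\<lambda>x. c + (-1) *\<^sub>R x)) (\<lambda>_. ennreal (\<bar>-1\<bar> ^ DIM('a)))"
    by (rule lborel_affine) simp
  then show ?thesis by (simp add: density_1)
qed

lemma nn_integral_lborel_translate:
  fixes f :: "'a::euclidean_space \<Rightarrow> ennreal"
  assumes [measurable]: "f \<in> borel_measurable borel"
  shows "(\<integral>\<^sup>+ x. f (x + c) \<partial>lborel) = (\<integral>\<^sup>+ x. f x \<partial>lborel)"
  by (subst (2) lborel_distr_plus[of c, symmetric], subst nn_integral_distr)
    (auto simp: add.commute)

lemma integrable_lborel_translate:
  fixes f :: "'a::euclidean_space \<Rightarrow> real"
  assumes "integrable lborel f"
  shows "integrable lborel (\<lambda>x. f (x + c))"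
proof -
  have "integrable (distr lborel borel ((+) c)) f" using assms by (simp add: lborel_distr_plus)
  then show ?thesis by (subst (asm) integrable_distr_eq) (use assms in \<open>auto simp: add.commute\<close>)
qed

lemma integral_lborel_translate:
  fixes f :: "'a::euclidean_space \<Rightarrow> real"
  assumes "integrable lborel f"
  shows "(\<integral> x. f (x + c) \<partial>lborel) = (\<integral> x. f x \<partial>lborel)"
  by (subst (2) lborel_distr_plus[of c, symmetric], subst integral_distr)
    (use assms in \<open>auto simp: add.commute\<close>)

lemma integrable_lborel_reflect:
  fixes f :: "'a::euclidean_space \<Rightarrow> real"
  assumes "integrable lborel f"
  shows "integrable lborel (\<lambda>x. f (c - x))"
proof -
  have "integrable (distr lborel borel (\<lambda>x. c - x)) f" using assms by (simp add: lborel_distr_reflect)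
  then show ?thesis by (subst (asm) integrable_distr_eq) (use assms in auto)
qed

lemma integral_lborel_reflect:
  fixes f :: "'a::euclidean_space \<Rightarrow> real"
  assumes "f \<in> borel_measurable borel"
  shows "(\<integral> x. f (c - x) \<partial>lborel) = (\<integral> x. f x \<partial>lborel)"
  by (subst (2) lborel_distr_reflect[of c, symmetric], subst integral_distr) (use assms in auto)

text \<open>Density argument along the induction principle for integrable functions. The substance
  is in indicators: a set of finite measure is squeezed between a compact and an open set that have
  a positive distance, so small translations act only on the thin difference.\<close>

lemma L1_translation_continuous:
  fixes f :: "'a::euclidean_space \<Rightarrow> real"
  assumes "integrable lborel f" "e > 0"
  shows "\<exists>d>0. \<forall>h. norm h < d \<longrightarrow> (\<integral>\<^sup>+ x. ennreal \<bar>f (x + h) - f x\<bar> \<partial>lborel) \<le> ennreal e"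
  using assms
proof (induction f arbitrary: e rule: integrable_induct)
  case (base A c)
  \<comment> \<open>Four sets of measure below e' / 2 enter the estimate, at a total cost of |c| * 2
    * e' = |c| * e / (|c| + 1) \<le> e; the summand 1 covers c = 0.\<close>
  define e' where "e' = e / (2 * (\<bar>c\<bar> + 1))"
  have e': "e' > 0" using base by (simp add: e'_def)
  have A: "A \<in> sets borel" "A \<in> sets lebesgue" using base by auto
  obtain U where U: "open U" "A \<subseteq> U" "emeasure lebesgue (U - A) < ennreal (e' / 2)"
    using sets_lebesgue_outer_open[OF A(2), of "e' / 2"] e' by (metis half_gt_zero)
  obtain F where F: "closed F" "F \<subseteq> A" "emeasure lebesgue (A - F) < ennreal (e' / 4)"
    using sets_lebesgue_inner_closed[OF A(2), of "e' / 4"] e' by (metis divide_pos_pos zero_less_numeral)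
  \<comment> \<open>The closed set F inside A may be unbounded. Cutting it with a large ball loses
    little: A has finite measure, and its parts outside growing balls decrease to the empty
    set.\<close>
  have "\<exists>K. compact K \<and> K \<subseteq> A \<and> emeasure lborel (A - K) < ennreal (e' / 2)"
  proof -
    have lim: "(\<lambda>n. emeasure lborel (A - cball 0 (real n))) \<longlonglongrightarrow> emeasure lborel (\<Inter>n. A - cball 0 (real n))"
    proof (rule Lim_emeasure_decseq)
      show "decseq (\<lambda>n. A - cball 0 (real n))" by (auto simp: decseq_def)
      show "emeasure lborel (A - cball 0 (real n)) \<noteq> \<infinity>" for n
        using base(2) emeasure_mono[of "A - cball 0 (real n)" A lborel] base(1)
        by (auto simp: top_unique)
    qed (use A in auto)
    have "(\<Inter>n. A - cball 0 (real n)) = {}"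
    proof -
      have "x \<notin> (\<Inter>n. A - cball 0 (real n))" for x
        using real_arch_simple[of "norm x"] by auto
      then show ?thesis by blast
    qed
    then have "(\<lambda>n. emeasure lborel (A - cball 0 (real n))) \<longlonglongrightarrow> 0"
      using lim by (simp only: emeasure_empty)
    then have "eventually (\<lambda>n. emeasure lborel (A - cball 0 (real n)) < ennreal (e' / 4)) sequentially"
      by (rule order_tendstoD) (use e' in auto)
    then obtain n where n: "emeasure lborel (A - cball 0 (real n)) < ennreal (e' / 4)"
      by (auto simp: eventually_sequentially)
    have "emeasure lborel (A - (F \<inter> cball 0 (real n))) \<le>
        emeasure lborel (A - F) + emeasure lborel (A - cball 0 (real n))"
      by (subst Diff_Int, rule emeasure_subadditive) (use A F in auto)
    also have "\<dots> < ennreal (e' / 4) + ennreal (e' / 4)"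
      by (rule add_strict_mono) (use n F A in auto)
    also have "\<dots> = ennreal (e' / 2)" using e' by (subst ennreal_plus[symmetric]) auto
    finally show ?thesis using F by (intro exI[of _ "F \<inter> cball 0 (real n)"]) (auto intro!: closed_Int_compact)
  qed
  then obtain K where K: "compact K" "K \<subseteq> A" "emeasure lborel (A - K) < ennreal (e' / 2)" by blast
  have "\<exists>d>0. \<forall>x\<in>K. ball x d \<subseteq> U"
    using compact_subset_open_imp_ball_epsilon_subset[OF K(1) U(1)] K(2) U(2) by (metis UN_subset_iff subset_trans)
  then obtain d where d: "d > 0" "\<And>x. x \<in> K \<Longrightarrow> ball x d \<subseteq> U" by blast
  have UA: "emeasure lborel (U - A) < ennreal (e' / 2)" using U A by simp
  have KA: "emeasure lborel (A - K) < ennreal (e' / 2)" using K by simp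
  have meas[measurable]: "U - A \<in> sets borel" "A - K \<in> sets borel" "A \<in> sets borel"
    using A U K by (auto intro: borel_compact)
  show ?case
  proof (intro exI[of _ d] conjI allI impI)
    fix h :: 'a assume h: "norm h < d"
    \<comment> \<open>Where the two indicators differ, one of x and x + h lies in A and the other
      does not. The one in A is either in A - K, or it is in K, and then |h| < d places the other in
      U - A.\<close>
    have pt: "ennreal \<bar>indicat_real A (x + h) *\<^sub>R c - indicat_real A x *\<^sub>R c\<bar> \<le>
       ennreal \<bar>c\<bar> * ((indicator (A - K) (x + h) + indicator (U - A) x)
         + (indicator (A - K) x + indicator (U - A) (x + h)))" for x
    proof -
      have 1: "x + h \<in> K \<Longrightarrow> x \<in> U" using d(2)[of "x + h"] h by (auto simp: dist_norm)
      have 2: "x \<in> K \<Longrightarrow> x + h \<in> U" using d(2)[of x] h by (auto simp: dist_norm)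
      show ?thesis
        using 1 2 K U by (cases "x \<in> A"; cases "x + h \<in> A"; cases "x \<in> K"; cases "x + h \<in> K")
          (auto simp: indicator_def distrib_left intro!: order_trans[OF _ add_increasing2])
    qed
    have "(\<integral>\<^sup>+ x. ennreal \<bar>indicat_real A (x + h) *\<^sub>R c - indicat_real A x *\<^sub>R c\<bar> \<partial>lborel)
      \<le> (\<integral>\<^sup>+ x. ennreal \<bar>c\<bar> * ((indicator (A - K) (x + h) + indicator (U - A) x)
         + (indicator (A - K) x + indicator (U - A) (x + h))) \<partial>lborel)"
      by (intro nn_integral_mono pt)
    also have "\<dots> = ennreal \<bar>c\<bar> * (((\<integral>\<^sup>+ x. indicator (A - K) (x + h) \<partial>lborel) + (\<integral>\<^sup>+ x. indicator (U - A) x \<partial>lborel))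
         + ((\<integral>\<^sup>+ x. indicator (A - K) x \<partial>lborel) + (\<integral>\<^sup>+ x. indicator (U - A) (x + h) \<partial>lborel)))"
      by (simp add: nn_integral_cmult nn_integral_add)
    also have "\<dots> = ennreal \<bar>c\<bar> * ((emeasure lborel (A - K) + emeasure lborel (U - A)) + (emeasure lborel (A - K) + emeasure lborel (U - A)))"
      by (subst (1 2) nn_integral_lborel_translate) auto
    also have "\<dots> \<le> ennreal \<bar>c\<bar> * ((ennreal (e'/2) + ennreal (e'/2)) + (ennreal (e'/2) + ennreal (e'/2)))"
      by (intro mult_left_mono add_mono UA[THEN less_imp_le] KA[THEN less_imp_le]) auto
    also have "\<dots> = ennreal (\<bar>c\<bar> * (2 * e'))"
      using e' by (simp flip: ennreal_plus ennreal_mult)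
    also have "\<dots> \<le> ennreal e"
      using base e' by (intro ennreal_leI) (auto simp: e'_def field_simps)
    finally show "(\<integral>\<^sup>+ x. ennreal \<bar>indicat_real A (x + h) *\<^sub>R c - indicat_real A x *\<^sub>R c\<bar> \<partial>lborel) \<le> ennreal e" .
  qed (use d in auto)
next
  case (add f g)
  have [measurable]: "f \<in> borel_measurable borel" "g \<in> borel_measurable borel" using add by auto
  obtain d1 where d1: "d1 > 0" "\<And>h. norm h < d1 \<Longrightarrow> (\<integral>\<^sup>+ x. ennreal \<bar>f (x + h) - f x\<bar> \<partial>lborel) \<le> ennreal (e/2)"
    using add.IH(1)[of "e/2"] add.prems by auto
  obtain d2 where d2: "d2 > 0" "\<And>h. norm h < d2 \<Longrightarrow> (\<integral>\<^sup>+ x. ennreal \<bar>g (x + h) - g x\<bar> \<partial>lborel) \<le> ennreal (e/2)"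
    using add.IH(2)[of "e/2"] add.prems by auto
  show ?case
  proof (intro exI[of _ "min d1 d2"] conjI allI impI)
    fix h :: 'a assume h: "norm h < min d1 d2"
    have "(\<integral>\<^sup>+ x. ennreal \<bar>f (x + h) + g (x + h) - (f x + g x)\<bar> \<partial>lborel) \<le>
        (\<integral>\<^sup>+ x. ennreal \<bar>f (x + h) - f x\<bar> + ennreal \<bar>g (x + h) - g x\<bar> \<partial>lborel)"
      by (intro nn_integral_mono) (simp flip: ennreal_plus)
    also have "\<dots> \<le> ennreal (e/2) + ennreal (e/2)"
      using d1(2)[of h] d2(2)[of h] h by (subst nn_integral_add) (auto intro!: add_mono)
    also have "\<dots> = ennreal e" using add.prems by (simp flip: ennreal_plus)
    finally show "(\<integral>\<^sup>+ x. ennreal \<bar>f (x + h) + g (x + h) - (f x + g x)\<bar> \<partial>lborel) \<le> ennreal e" .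
  qed (use d1 d2 in auto)
next
  \<comment> \<open>Three times e / 3: an approximant s i close to f in L1, the translation estimate
    for that approximant, and translation invariance for the shifted error.\<close>
  case (lim f s)
  have [measurable]: "f \<in> borel_measurable borel" "\<And>i. s i \<in> borel_measurable borel" using lim by auto
  have "(\<lambda>i. \<integral>\<^sup>+ x. norm (f x - s i x) \<partial>lborel) \<longlonglongrightarrow> 0"
    by (rule nn_integral_dominated_convergence_norm[where w="\<lambda>x. 2 * norm (f x)"])
      (use lim in \<open>auto simp: integrable_iff_bounded ennreal_mult nn_integral_cmult ennreal_mult_less_top\<close>)
  then have "eventually (\<lambda>i. (\<integral>\<^sup>+ x. norm (f x - s i x) \<partial>lborel) < ennreal (e/3)) sequentially"
    by (rule order_tendstoD) (use lim.prems in auto)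
  then obtain i where i: "(\<integral>\<^sup>+ x. norm (f x - s i x) \<partial>lborel) < ennreal (e/3)"
    by (auto simp: eventually_sequentially)
  obtain d where d: "d > 0" "\<And>h. norm h < d \<Longrightarrow> (\<integral>\<^sup>+ x. ennreal \<bar>s i (x + h) - s i x\<bar> \<partial>lborel) \<le> ennreal (e/3)"
    using lim.IH[of "e/3" i] lim.prems by auto
  show ?case
  proof (intro exI[of _ d] conjI allI impI)
    fix h :: 'a assume h: "norm h < d"
    have tr: "(\<integral>\<^sup>+ x. ennreal (norm (f (x + h) - s i (x + h))) \<partial>lborel) = (\<integral>\<^sup>+ x. norm (f x - s i x) \<partial>lborel)"
      by (rule nn_integral_lborel_translate[of "\<lambda>x. ennreal (norm (f x - s i x))"]) simp
    have "(\<integral>\<^sup>+ x. ennreal \<bar>f (x + h) - f x\<bar> \<partial>lborel) \<le>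
        (\<integral>\<^sup>+ x. (ennreal (norm (f (x + h) - s i (x + h))) + ennreal \<bar>s i (x + h) - s i x\<bar>)
           + ennreal (norm (f x - s i x)) \<partial>lborel)"
      by (intro nn_integral_mono) (auto simp flip: ennreal_plus intro!: ennreal_leI)
    also have "\<dots> \<le> (ennreal (e/3) + ennreal (e/3)) + ennreal (e/3)"
      using d(2)[OF h] i by (subst nn_integral_add nn_integral_add tr; (simp; fail)?)+ (auto intro!: add_mono simp: tr)
    also have "\<dots> = ennreal e" using lim.prems by (simp flip: ennreal_plus)
    finally show "(\<integral>\<^sup>+ x. ennreal \<bar>f (x + h) - f x\<bar> \<partial>lborel) \<le> ennreal e" .
  qed (use d in auto)
qed

section \<open>Convolution with a smooth kernel of compact support and its derivatives\<close>

definition conv :: "('a::euclidean_space \<Rightarrow> real) \<Rightarrow> ('a \<Rightarrow> real) \<Rightarrow> 'a \<Rightarrow> real" where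
  "conv k f x = (\<integral>y. k (x - y) * f y \<partial>lborel)"

lemma bounded_continuous_compact_support:
  fixes f :: "'a::euclidean_space \<Rightarrow> 'b::euclidean_space"
  assumes "continuous_on UNIV f" "compact K" "\<And>x. x \<notin> K \<Longrightarrow> f x = 0"
  obtains B where "B \<ge> 0" "\<And>x. norm (f x) \<le> B"
proof -
  have "bounded (f ` K)"
    by (intro compact_imp_bounded compact_continuous_image continuous_on_subset[OF assms(1)] assms(2)) simp
  then obtain B where B: "\<And>x. x \<in> K \<Longrightarrow> norm (f x) \<le> B" by (auto simp: bounded_iff)
  show thesis
  proof (rule that[of "max B 0"])
    fix x
    show "norm (f x) \<le> max B 0"
    proof (cases "x \<in> K")
      case True
      then show ?thesis using B by (simp add: le_max_iff_disj)
    next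
      case False
      then show ?thesis by (simp add: assms(3))
    qed
  qed simp
qed

lemma integrable_bounded_mult:
  fixes f :: "'a \<Rightarrow> real" and k :: "'a \<Rightarrow> real"
  assumes "integrable M f" "k \<in> borel_measurable M" "\<And>x. \<bar>k x\<bar> \<le> B"
  shows "integrable M (\<lambda>x. k x * f x)"
proof (rule Bochner_Integration.integrable_bound[where f="\<lambda>x. B * f x"])
  show "AE x in M. norm (k x * f x) \<le> norm (B * f x)"
    by (auto simp: abs_mult intro!: AE_I2 mult_right_mono order_trans[OF assms(3) abs_ge_self])
qed (use assms in auto)

lemma integrable_conv_integrand:
  fixes k f :: "'a::euclidean_space \<Rightarrow> real"
  assumes "continuous_on UNIV k" "compact K" "\<And>x. x \<notin> K \<Longrightarrow> k x = 0" "integrable lborel f"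
  shows "integrable lborel (\<lambda>y. k (x - y) * f y)"
proof -
  obtain B where "\<And>x. norm (k x) \<le> B"
    using bounded_continuous_compact_support[OF assms(1,2,3)] by metis
  moreover have [measurable]: "k \<in> borel_measurable borel"
    using assms(1) by (rule borel_measurable_continuous_onI)
  ultimately show ?thesis by (intro integrable_bounded_mult[OF assms(4)]) auto
qed

text \<open>The partial derivatives of k are continuous with compact support, hence uniformly
  continuous, and the mean value bound turns this into a remainder estimate with one d for all base
  points z. This uniformity is what differentiation under the integral sign uses.\<close>

lemma uniform_differentiable:
  fixes k :: "'a::euclidean_space \<Rightarrow> real"
  assumes "smooth k" "compact K" "\<And>x. x \<notin> K \<Longrightarrow> k x = 0" "e > 0"
  shows "\<exists>d>0. \<forall>z h. norm h < d \<longrightarrow>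
    \<bar>k (z + h) - k z - frechet_derivative k (at z) h\<bar> \<le> e * norm h"
proof -
  \<comment> \<open>The operator norm of a difference of derivatives is bounded by the sum over the
    basis vectors, so each partial derivative may vary by e divided by the dimension.\<close>
  define e' where "e' = e / real DIM('a)"
  have e': "e' > 0" using assms(4) by (simp add: e'_def)
  have "\<exists>d>0. \<forall>z w. norm (w - z) < d \<longrightarrow>
      \<bar>frechet_derivative k (at w) i - frechet_derivative k (at z) i\<bar> < e'" if i: "i \<in> Basis" for i
  proof -
    let ?g = "\<lambda>x. frechet_derivative k (at x) i"
    have c: "continuous_on UNIV ?g" using smooth_continuous[OF smooth_partial[OF assms(1) i]] .
    obtain R where R: "K \<subseteq> ball 0 R" using compact_imp_bounded[OF assms(2)] bounded_subset_ballD by blast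
    have z: "?g x = 0" if "norm x \<ge> R" for x
    proof -
      have "x \<notin> K" using R that by auto
      then show ?thesis
        using frechet_derivative_zero_outside_closed[OF compact_imp_closed[OF assms(2)] assms(3)] by simp
    qed
    \<comment> \<open>The margin 1 matches the bound \<open>min d 1\<close> on the step: if one of
      the two points leaves the ball of radius R + 1, both are outside radius R, where the
      derivative vanishes.\<close>
    have "uniformly_continuous_on (cball 0 (R + 1)) ?g"
      by (rule compact_uniformly_continuous) (use c continuous_on_subset in auto)
    then obtain d where d: "d > 0" "\<And>x y. x \<in> cball 0 (R+1) \<Longrightarrow> y \<in> cball 0 (R+1) \<Longrightarrow> dist y x < d \<Longrightarrow> dist (?g y) (?g x) < e'"
      unfolding uniformly_continuous_on_def using e' by metis
    show ?thesis
    proof (intro exI[of _ "min d 1"] conjI allI impI)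
      fix z w :: 'a assume zw: "norm (w - z) < min d 1"
      have t: "norm w \<le> norm z + norm (w - z)" "norm z \<le> norm w + norm (w - z)"
        by (metis norm_triangle_sub, metis norm_minus_commute norm_triangle_sub)
      show "\<bar>?g w - ?g z\<bar> < e'"
      proof (cases "norm z \<le> R + 1 \<and> norm w \<le> R + 1")
        case True
        then show ?thesis using d(2)[of z w] zw by (auto simp: dist_norm)
      next
        case False
        then show ?thesis using z[of z] z[of w] t zw e' by auto
      qed
    qed (use d in auto)
  qed
  then obtain d where d: "\<And>i. i \<in> Basis \<Longrightarrow> d i > 0"
    "\<And>i z w. i \<in> Basis \<Longrightarrow> norm (w - z) < d i \<Longrightarrow>
      \<bar>frechet_derivative k (at w) i - frechet_derivative k (at z) i\<bar> < e'" by metis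
  define D where "D = Min (d ` Basis)"
  have D: "D > 0" "\<And>i. i \<in> Basis \<Longrightarrow> D \<le> d i" using d(1) by (auto simp: D_def)
  have lin: "linear (frechet_derivative k (at z))" for z
    using has_derivative_linear[OF smooth_has_derivative[OF assms(1)]] .
  show ?thesis
  proof (intro exI[of _ D] conjI allI impI)
    fix z h :: 'a assume h: "norm h < D"
    have "norm (k (z + h) - k z - frechet_derivative k (at z) ((z + h) - z)) \<le> norm ((z + h) - z) * e"
    proof (rule differentiable_bound_linearization[where S="ball z D" and f'="\<lambda>x. frechet_derivative k (at x)"])
      show "z + t *\<^sub>R (z + h - z) \<in> ball z D" if "t \<in> {0..1}" for t
        using h that mult_right_mono[of t 1 "norm h"] by (auto simp: dist_norm)
      show "(k has_derivative frechet_derivative k (at x)) (at x within ball z D)" for x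
        using smooth_has_derivative[OF assms(1)] by (rule has_derivative_at_withinI)
      show "z \<in> ball z D" using D by simp
      fix w assume w: "w \<in> ball z D"
      show "onorm (frechet_derivative k (at w) - frechet_derivative k (at z)) \<le> e"
      proof (rule onorm_le)
        fix x :: 'a
        have "(frechet_derivative k (at w) - frechet_derivative k (at z)) x =
          (\<Sum>i\<in>Basis. (x \<bullet> i) * (frechet_derivative k (at w) i - frechet_derivative k (at z) i))"
          using Linear_Algebra.linear_componentwise[OF lin, of w x 1] Linear_Algebra.linear_componentwise[OF lin, of z x 1]
          by (simp add: sum_subtractf right_diff_distrib)
        also have "norm \<dots> \<le> (\<Sum>i\<in>(Basis::'a set). norm x * e')"
        proof (rule sum_norm_le)
          fix i :: 'a assume i: "i \<in> Basis"
          have "\<bar>frechet_derivative k (at w) i - frechet_derivative k (at z) i\<bar> \<le> e'"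
            using d(2)[OF i, of w z] D(2)[OF i] w by (auto simp: dist_norm norm_minus_commute)
          then show "norm ((x \<bullet> i) * (frechet_derivative k (at w) i - frechet_derivative k (at z) i)) \<le> norm x * e'"
            using Basis_le_norm[OF i, of x] by (auto simp: abs_mult intro!: mult_mono)
        qed
        also have "\<dots> = e * norm x" by (simp add: e'_def)
        finally show "norm ((frechet_derivative k (at w) - frechet_derivative k (at z)) x) \<le> e * norm x" .
      qed
    qed
    then show "\<bar>k (z + h) - k z - frechet_derivative k (at z) h\<bar> \<le> e * norm h"
      by (simp add: mult.commute)
  qed (use D in auto)
qed

text \<open>Differentiation under the integral: x occurs in the kernel only, and the linearisation
  error of the kernel, uniform in the base point, is integrated against |f|.\<close>

lemma conv_has_derivative:
  fixes k f :: "'a::euclidean_space \<Rightarrow> real"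
  assumes k: "smooth k" "compact K" "\<And>x. x \<notin> K \<Longrightarrow> k x = 0" and f: "integrable lborel f"
  shows "(conv k f has_derivative
     (\<lambda>h. \<Sum>i\<in>Basis. (h \<bullet> i) * conv (\<lambda>z. frechet_derivative k (at z) i) f x)) (at x)"
proof -
  let ?D = "\<lambda>h. \<Sum>i\<in>Basis. (h \<bullet> i) * conv (\<lambda>z. frechet_derivative k (at z) i) f x"
  have int: "integrable lborel (\<lambda>y. k (x - y) * f y)" for x
    by (rule integrable_conv_integrand[OF smooth_continuous[OF k(1)] k(2,3) f])
  have intD: "integrable lborel (\<lambda>y. frechet_derivative k (at (x - y)) i * f y)" if i: "i \<in> Basis" for i x
    by (rule integrable_conv_integrand[OF smooth_continuous[OF smooth_partial[OF k(1) i]] k(2) _ f])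
      (simp add: frechet_derivative_zero_outside_closed[OF compact_imp_closed[OF k(2)] k(3)])
  have lin: "linear (frechet_derivative k (at z))" for z
    using has_derivative_linear[OF smooth_has_derivative[OF k(1)]] .
  have fd: "frechet_derivative k (at z) h = (\<Sum>i\<in>Basis. (h \<bullet> i) * frechet_derivative k (at z) i)" for z h
    using Linear_Algebra.linear_componentwise[OF lin, of z h 1] by simp
  have intDh: "integrable lborel (\<lambda>y. frechet_derivative k (at (x - y)) h * f y)" for x h
  proof -
    have "integrable lborel (\<lambda>y. \<Sum>i\<in>Basis. (h \<bullet> i) * (frechet_derivative k (at (x - y)) i * f y))"
      using intD by auto
    then show ?thesis by (subst fd) (simp add: sum_distrib_right mult.assoc)
  qed
  have D: "?D h = (\<integral>y. frechet_derivative k (at (x - y)) h * f y \<partial>lborel)" for h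
  proof -
    have "(\<integral>y. frechet_derivative k (at (x - y)) h * f y \<partial>lborel) =
        (\<integral>y. (\<Sum>i\<in>Basis. (h \<bullet> i) * (frechet_derivative k (at (x - y)) i * f y)) \<partial>lborel)"
      by (subst fd) (simp add: sum_distrib_right mult.assoc)
    also have "\<dots> = ?D h" using intD by (simp add: Bochner_Integration.integral_sum conv_def)
    finally show ?thesis by simp
  qed
  show ?thesis
    unfolding has_derivative_at_alt
  proof (intro conjI allI impI)
    show "bounded_linear ?D"
      by (intro bounded_linear_sum bounded_linear_mult_left[THEN bounded_linear_compose] bounded_linear_inner_left)
    fix e :: real assume e: "e > 0"
    \<comment> \<open>L is the L1 norm of f; the tolerance is divided by L + 1 because L may be
      zero.\<close>
    define L where "L = (\<integral>y. \<bar>f y\<bar> \<partial>lborel)"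
    have L: "L \<ge> 0" by (simp add: L_def)
    obtain d where d: "d > 0" "\<And>z h. norm h < d \<Longrightarrow>
      \<bar>k (z + h) - k z - frechet_derivative k (at z) h\<bar> \<le> e / (L + 1) * norm h"
      using uniform_differentiable[OF k, of "e / (L + 1)"] e L by auto
    show "\<exists>d>0. \<forall>y. norm (y - x) < d \<longrightarrow> norm (conv k f y - conv k f x - ?D (y - x)) \<le> e * norm (y - x)"
    proof (intro exI[of _ d] conjI allI impI)
      fix w assume w: "norm (w - x) < d"
      have "conv k f w - conv k f x - ?D (w - x) =
         (\<integral>y. k (w - y) * f y - k (x - y) * f y - frechet_derivative k (at (x - y)) (w - x) * f y \<partial>lborel)"
        unfolding D using int intDh by (simp add: conv_def)
      also have "norm \<dots> \<le> (\<integral>y. e / (L + 1) * norm (w - x) * \<bar>f y\<bar> \<partial>lborel)"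
      proof (rule order_trans[OF integral_norm_bound integral_mono])
        fix y
        have "norm (k (w - y) * f y - k (x - y) * f y - frechet_derivative k (at (x - y)) (w - x) * f y) =
          \<bar>k ((x - y) + (w - x)) - k (x - y) - frechet_derivative k (at (x - y)) (w - x)\<bar> * \<bar>f y\<bar>"
          by (simp add: abs_mult[symmetric] algebra_simps)
        also have "\<dots> \<le> e / (L + 1) * norm (w - x) * \<bar>f y\<bar>"
          by (intro mult_right_mono d(2) w) auto
        finally show "norm (k (w - y) * f y - k (x - y) * f y - frechet_derivative k (at (x - y)) (w - x) * f y)
            \<le> e / (L + 1) * norm (w - x) * \<bar>f y\<bar>" .
      qed (use int intDh f in auto)
      also have "\<dots> = e * norm (w - x) * (L / (L + 1))" by (simp add: L_def)
      also have "\<dots> \<le> e * norm (w - x) * 1"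
        using L e by (intro mult_left_mono) (auto simp: field_simps)
      finally show "norm (conv k f w - conv k f x - ?D (w - x)) \<le> e * norm (w - x)" by simp
    qed (use d in auto)
  qed
qed

lemma frechet_derivative_conv:
  fixes k f :: "'a::euclidean_space \<Rightarrow> real"
  assumes k: "smooth k" "compact K" "\<And>x. x \<notin> K \<Longrightarrow> k x = 0" and f: "integrable lborel f"
    and i: "i \<in> Basis"
  shows "frechet_derivative (conv k f) (at x) i = conv (\<lambda>z. frechet_derivative k (at z) i) f x"
proof -
  have "frechet_derivative (conv k f) (at x) i =
      (\<Sum>j\<in>Basis. (i \<bullet> j) * conv (\<lambda>z. frechet_derivative k (at z) j) f x)"
    using fun_cong[OF frechet_derivative_at[OF conv_has_derivative[OF k f]], of i x] by simp
  also have "\<dots> = (\<Sum>j\<in>Basis. if j = i then conv (\<lambda>z. frechet_derivative k (at z) j) f x else 0)"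
    using i by (intro sum.cong) (auto simp: inner_Basis)
  finally show ?thesis using i by simp
qed

text \<open>Induction on the order with the kernel free: a partial derivative of the convolution is
  the convolution with the partial derivative of the kernel, which is again smooth and vanishes off
  the same K.\<close>

lemma smooth_conv:
  fixes k f :: "'a::euclidean_space \<Rightarrow> real"
  assumes k: "smooth k" "compact K" "\<And>x. x \<notin> K \<Longrightarrow> k x = 0" and f: "integrable lborel f"
  shows "smooth (conv k f)"
proof
  fix n show "Ck_on n UNIV (conv k f)"
    using k
  proof (induction n arbitrary: k)
    case 0
    show ?case
      unfolding Ck_on.simps
      by (intro continuous_at_imp_continuous_on ballI)
        (rule has_derivative_continuous[OF conv_has_derivative[OF 0 f]])
  next
    case (Suc n)
    show ?case
    proof (rule Ck_on_SucI[OF conv_has_derivative[OF Suc.prems f]])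
      fix i :: 'a assume i: "i \<in> Basis"
      have eq: "(\<lambda>x. \<Sum>j\<in>Basis. (i \<bullet> j) * conv (\<lambda>z. frechet_derivative k (at z) j) f x) =
          conv (\<lambda>z. frechet_derivative k (at z) i) f"
      proof
        fix x
        have "(\<Sum>j\<in>Basis. (i \<bullet> j) * conv (\<lambda>z. frechet_derivative k (at z) j) f x) =
          (\<Sum>j\<in>Basis. if j = i then conv (\<lambda>z. frechet_derivative k (at z) j) f x else 0)"
          using i by (intro sum.cong) (auto simp: inner_Basis)
        then show "(\<Sum>j\<in>Basis. (i \<bullet> j) * conv (\<lambda>z. frechet_derivative k (at z) j) f x) =
          conv (\<lambda>z. frechet_derivative k (at z) i) f x" using i by simp
      qed
      show "Ck_on n UNIV (\<lambda>x. \<Sum>j\<in>Basis. (i \<bullet> j) * conv (\<lambda>z. frechet_derivative k (at z) j) f x)"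
        unfolding eq
        by (rule Suc.IH[OF smooth_partial[OF Suc.prems(1) i] Suc.prems(2)])
          (simp add: frechet_derivative_zero_outside_closed[OF compact_imp_closed[OF Suc.prems(2)] Suc.prems(3)])
    qed
  qed
qed

lemma conv_shift:
  fixes k f :: "'a::euclidean_space \<Rightarrow> real"
  assumes [measurable]: "k \<in> borel_measurable borel" "f \<in> borel_measurable borel"
  shows "conv k f x = (\<integral>z. k z * f (x - z) \<partial>lborel)"
  using integral_lborel_reflect[of "\<lambda>z. k z * f (x - z)" x] by (simp add: conv_def)

lemma mollifier_measurable[measurable]: "mollifier r \<in> borel_measurable borel"
  by (rule borel_measurable_continuous_onI[OF smooth_continuous[OF smooth_mollifier]])

lemma integrable_mollifier:
  assumes "r \<ge> 0" shows "integrable lborel (mollifier r :: 'a::euclidean_space \<Rightarrow> real)"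
  by (rule integrable_continuous_compact_support[OF smooth_continuous[OF smooth_mollifier[of r]] compact_cball[of 0 r]
      mollifier_cball[OF assms]])

lemma nn_integral_mollifier:
  assumes "r > 0" shows "(\<integral>\<^sup>+ x. ennreal (mollifier r (x::'a::euclidean_space)) \<partial>lborel) = 1"
  using nn_integral_eq_integral[OF integrable_mollifier[of r, where 'a='a]] assms integral_mollifier[OF assms, where 'a='a]
  by (simp add: mollifier_nonneg)

lemma integrable_conv_mollifier:
  assumes "r \<ge> 0" "integrable lborel f"
  shows "integrable lborel (\<lambda>y. mollifier r (x - y) * f y)"
  by (rule integrable_conv_integrand[OF smooth_continuous[OF smooth_mollifier] compact_cball[of 0 r] mollifier_cball])
    (use assms in auto)

lemma integrable_conv_mollifier':
  fixes f :: "'a::euclidean_space \<Rightarrow> real"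
  assumes "r \<ge> 0" "integrable lborel f"
  shows "integrable lborel (\<lambda>z. mollifier r z * f (x - z))"
  using integrable_lborel_reflect[OF integrable_conv_mollifier[OF assms, of x], of x] by simp

text \<open>As the mollifier has mass one, the error is an average of the differences f (x - z) - f
  x over z; exchanging the order of integration leaves the L1 size of the translation
  differences.\<close>

lemma conv_mollifier_L1_bound:
  fixes f :: "'a::euclidean_space \<Rightarrow> real"
  assumes r: "r > 0" and f: "integrable lborel f"
  shows "(\<integral>\<^sup>+ x. ennreal \<bar>conv (mollifier r) f x - f x\<bar> \<partial>lborel) \<le>
    (\<integral>\<^sup>+ z. ennreal (mollifier r z) * (\<integral>\<^sup>+ x. ennreal \<bar>f (x - z) - f x\<bar> \<partial>lborel) \<partial>lborel)"
proof -
  have [measurable]: "f \<in> borel_measurable borel" using f by auto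
  have "ennreal \<bar>conv (mollifier r) f x - f x\<bar> \<le>
      (\<integral>\<^sup>+ z. ennreal (mollifier r z) * ennreal \<bar>f (x - z) - f x\<bar> \<partial>lborel)" for x
  proof -
    have i1: "integrable lborel (\<lambda>z. mollifier r z * f (x - z))"
      using integrable_conv_mollifier'[OF _ f] r by simp
    have i2: "integrable lborel (\<lambda>z::'a. mollifier r z * f x)"
      using integrable_mollifier[of r, where 'a='a] r by (intro integrable_mult_left) auto
    have "conv (mollifier r) f x - f x = (\<integral>z. mollifier r z * f (x - z) - mollifier r z * f x \<partial>lborel)"
      using i1 i2 r by (simp add: conv_shift integral_mollifier)
    also have "ennreal \<bar>\<dots>\<bar> \<le> (\<integral>\<^sup>+ z. ennreal \<bar>mollifier r z * f (x - z) - mollifier r z * f x\<bar> \<partial>lborel)"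
      using integral_norm_bound_ennreal[OF Bochner_Integration.integrable_diff[OF i1 i2]] by simp
    also have "\<dots> = (\<integral>\<^sup>+ z. ennreal (mollifier r z) * ennreal \<bar>f (x - z) - f x\<bar> \<partial>lborel)"
      by (simp add: right_diff_distrib[symmetric] abs_mult mollifier_nonneg ennreal_mult)
    finally show ?thesis .
  qed
  then have "(\<integral>\<^sup>+ x. ennreal \<bar>conv (mollifier r) f x - f x\<bar> \<partial>lborel) \<le>
     (\<integral>\<^sup>+ x. (\<integral>\<^sup>+ z. ennreal (mollifier r z) * ennreal \<bar>f (x - z) - f x\<bar> \<partial>lborel) \<partial>lborel)"
    by (intro nn_integral_mono)
  also have "\<dots> = (\<integral>\<^sup>+ z. (\<integral>\<^sup>+ x. ennreal (mollifier r z) * ennreal \<bar>f (x - z) - f x\<bar> \<partial>lborel) \<partial>lborel)"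
    by (rule lborel_pair.Fubini') measurable
  also have "\<dots> = (\<integral>\<^sup>+ z. ennreal (mollifier r z) * (\<integral>\<^sup>+ x. ennreal \<bar>f (x - z) - f x\<bar> \<partial>lborel) \<partial>lborel)"
    by (subst nn_integral_cmult) auto
  finally show ?thesis .
qed

lemma conv_mollifier_L1_small:
  fixes f :: "'a::euclidean_space \<Rightarrow> real"
  assumes f: "integrable lborel f" and e: "e > 0"
  shows "\<exists>d>0. \<forall>r. 0 < r \<longrightarrow> r < d \<longrightarrow>
    (\<integral>\<^sup>+ x. ennreal \<bar>conv (mollifier r) f x - f x\<bar> \<partial>lborel) \<le> ennreal e"
proof -
  obtain d where d: "d > 0" "\<And>h. norm h < d \<Longrightarrow> (\<integral>\<^sup>+ x. ennreal \<bar>f (x + h) - f x\<bar> \<partial>lborel) \<le> ennreal e"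
    using L1_translation_continuous[OF f e] by metis
  show ?thesis
  proof (intro exI[of _ d] conjI allI impI)
    fix r :: real assume r: "0 < r" "r < d"
    have "(\<integral>\<^sup>+ x. ennreal \<bar>conv (mollifier r) f x - f x\<bar> \<partial>lborel) \<le>
      (\<integral>\<^sup>+ z. ennreal (mollifier r z) * (\<integral>\<^sup>+ x. ennreal \<bar>f (x - z) - f x\<bar> \<partial>lborel) \<partial>lborel)"
      by (rule conv_mollifier_L1_bound[OF r(1) f])
    also have "\<dots> \<le> (\<integral>\<^sup>+ z. ennreal (mollifier r (z::'a)) * ennreal e \<partial>lborel)"
    proof (rule nn_integral_mono)
      fix z :: 'a
      show "ennreal (mollifier r z) * (\<integral>\<^sup>+ x. ennreal \<bar>f (x - z) - f x\<bar> \<partial>lborel) \<le> ennreal (mollifier r z) * ennreal e"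
      proof (cases "norm z < r")
        case True
        then show ?thesis using d(2)[of "- z"] r by (intro mult_left_mono) auto
      next
        case False
        then show ?thesis using mollifier_eq_0[of r z] r by simp
      qed
    qed
    also have "\<dots> = ennreal e" using r by (simp add: nn_integral_multc nn_integral_mollifier)
    finally show "(\<integral>\<^sup>+ x. ennreal \<bar>conv (mollifier r) f x - f x\<bar> \<partial>lborel) \<le> ennreal e" .
  qed (use d in auto)
qed

text \<open>The error \<open>conv (mollifier r) f x - f x\<close> is integrable because every
  translation difference has L1 norm at most twice that of f and the mollifier has mass one; f is
  then added back.\<close>

lemma integrable_conv:
  fixes f :: "'a::euclidean_space \<Rightarrow> real"
  assumes r: "r > 0" and f: "integrable lborel f"
  shows "integrable lborel (conv (mollifier r) f)"
proof -
  have [measurable]: "f \<in> borel_measurable borel" using f by auto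
  have m[measurable]: "conv (mollifier r) f \<in> borel_measurable borel"
    by (rule borel_measurable_continuous_onI[OF smooth_continuous[OF
          smooth_conv[OF smooth_mollifier compact_cball[of 0 r] mollifier_cball f]]]) (use r in auto)
  have T: "(\<integral>\<^sup>+ x. ennreal \<bar>f (x - z) - f x\<bar> \<partial>lborel) \<le> 2 * (\<integral>\<^sup>+ x. ennreal \<bar>f x\<bar> \<partial>lborel)" for z
  proof -
    have "(\<integral>\<^sup>+ x. ennreal \<bar>f (x - z) - f x\<bar> \<partial>lborel) \<le> (\<integral>\<^sup>+ x. ennreal \<bar>f (x + (- z))\<bar> + ennreal \<bar>f x\<bar> \<partial>lborel)"
      by (intro nn_integral_mono) (simp flip: ennreal_plus)
    also have "\<dots> = (\<integral>\<^sup>+ x. ennreal \<bar>f x\<bar> \<partial>lborel) + (\<integral>\<^sup>+ x. ennreal \<bar>f x\<bar> \<partial>lborel)"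
      using nn_integral_lborel_translate[of "\<lambda>x. ennreal \<bar>f x\<bar>" "- z"] by (subst nn_integral_add) auto
    finally show ?thesis by (simp add: mult_2)
  qed
  have "(\<integral>\<^sup>+ x. ennreal \<bar>conv (mollifier r) f x - f x\<bar> \<partial>lborel) \<le>
      (\<integral>\<^sup>+ z. ennreal (mollifier r (z::'a)) * (2 * (\<integral>\<^sup>+ x. ennreal \<bar>f x\<bar> \<partial>lborel)) \<partial>lborel)"
    using conv_mollifier_L1_bound[OF r f] by (rule order_trans) (intro nn_integral_mono mult_left_mono T, simp)
  also have "\<dots> = 2 * (\<integral>\<^sup>+ x. ennreal \<bar>f x\<bar> \<partial>lborel)" using r by (simp add: nn_integral_multc nn_integral_mollifier)
  also have "\<dots> < \<infinity>" using f by (auto simp: integrable_iff_bounded ennreal_mult_less_top)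
  finally have "integrable lborel (\<lambda>x. conv (mollifier r) f x - f x)"
    by (intro integrableI_bounded) auto
  from Bochner_Integration.integrable_add[OF this f] show ?thesis by simp
qed

text \<open>A fixed null sequence of radii, positive also at n = 0, replaces the limit r
  \<rightarrow> 0.\<close>

abbreviation mol :: "nat \<Rightarrow> 'a::euclidean_space \<Rightarrow> real" where
  "mol n \<equiv> mollifier (1 / (real n + 1))"

lemma smooth_conv_mol: "integrable lborel f \<Longrightarrow> smooth (conv (mol n) f)"
  by (rule smooth_conv[OF smooth_mollifier compact_cball[of 0 "1 / (real n + 1)"] mollifier_cball]) auto

lemma eventually_mol_radius:
  assumes "d > 0" shows "eventually (\<lambda>n. 1 / (real n + 1) < d) sequentially"
proof -
  have "(\<lambda>n. 1 / (real n + 1)) \<longlonglongrightarrow> 0"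
    using LIMSEQ_inverse_real_of_nat by (simp add: inverse_eq_divide add.commute)
  then show ?thesis by (rule order_tendstoD) (rule assms)
qed

lemma conv_mol_L1:
  fixes f :: "'a::euclidean_space \<Rightarrow> real"
  assumes f: "integrable lborel f"
  shows "(\<lambda>n. \<integral>x. \<bar>conv (mol n) f x - f x\<bar> \<partial>lborel) \<longlonglongrightarrow> 0"
proof (rule LIMSEQ_I)
  fix e :: real assume e: "e > 0"
  obtain d where d: "d > 0" "\<And>r. 0 < r \<Longrightarrow> r < d \<Longrightarrow>
    (\<integral>\<^sup>+ x. ennreal \<bar>conv (mollifier r) f x - f x\<bar> \<partial>lborel) \<le> ennreal (e / 2)"
    using conv_mollifier_L1_small[OF f, of "e / 2"] e by auto
  obtain N where N: "\<And>n. n \<ge> N \<Longrightarrow> 1 / (real n + 1) < d"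
    using eventually_mol_radius[OF d(1)] by (auto simp: eventually_sequentially)
  show "\<exists>no. \<forall>n\<ge>no. norm ((\<integral>x. \<bar>conv (mol n) f x - f x\<bar> \<partial>lborel) - 0) < e"
  proof (intro exI[of _ N] allI impI)
    fix n assume n: "n \<ge> N"
    have i: "integrable lborel (\<lambda>x. \<bar>conv (mol n) f x - f x\<bar>)"
      using integrable_conv[OF _ f, of "1 / (real n + 1)"] f by (intro Bochner_Integration.integrable_abs Bochner_Integration.integrable_diff) auto
    have "ennreal (\<integral>x. \<bar>conv (mol n) f x - f x\<bar> \<partial>lborel) \<le> ennreal (e / 2)"
      using d(2)[OF _ N[OF n]] nn_integral_eq_integral[OF i] by simp
    then have "(\<integral>x. \<bar>conv (mol n) f x - f x\<bar> \<partial>lborel) \<le> e / 2" using e by simp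
    then show "norm ((\<integral>x. \<bar>conv (mol n) f x - f x\<bar> \<partial>lborel) - 0) < e" using e by simp
  qed
qed

text \<open>The convolution is a weighted mean of the values of f on the ball of radius r. Besides
  pointwise convergence this keeps mollified functions inside an interval on which an outer function
  is under control.\<close>

lemma conv_mollifier_between:
  fixes f :: "'a::euclidean_space \<Rightarrow> real"
  assumes r: "r > 0" and f: "integrable lborel f"
    and b: "\<And>y. dist x y < r \<Longrightarrow> l \<le> f y \<and> f y \<le> u"
  shows "l \<le> conv (mollifier r) f x" "conv (mollifier r) f x \<le> u"
proof -
  have i0: "integrable lborel (\<lambda>y. mollifier r (x - y))"
    using integrable_lborel_reflect[OF integrable_mollifier[of r], of x] r by simp
  have i1: "(\<integral>y. mollifier r (x - y) \<partial>lborel) = 1"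
    using integral_lborel_reflect[of "mollifier r" x] integral_mollifier[OF r, where 'a='a] by simp
  have i2: "integrable lborel (\<lambda>y. mollifier r (x - y) * f y)"
    using integrable_conv_mollifier[OF _ f] r by simp
  have p: "mollifier r (x - y) * l \<le> mollifier r (x - y) * f y \<and>
      mollifier r (x - y) * f y \<le> mollifier r (x - y) * u" for y
  proof (cases "dist x y < r")
    case True
    then show ?thesis using b[OF True] by (auto intro!: mult_left_mono mollifier_nonneg)
  next
    case False
    then have "mollifier r (x - y) = 0" using r by (intro mollifier_eq_0) (auto simp: dist_norm)
    then show ?thesis by simp
  qed
  have "l = (\<integral>y. mollifier r (x - y) * l \<partial>lborel)" using i1 by simp
  also have "\<dots> \<le> conv (mollifier r) f x"
    unfolding conv_def using i0 i2 p by (intro integral_mono) auto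
  finally show "l \<le> conv (mollifier r) f x" .
  have "conv (mollifier r) f x \<le> (\<integral>y. mollifier r (x - y) * u \<partial>lborel)"
    unfolding conv_def using i0 i2 p by (intro integral_mono) auto
  also have "\<dots> = u" using i1 by simp
  finally show "conv (mollifier r) f x \<le> u" .
qed

lemma conv_mol_pointwise:
  fixes f :: "'a::euclidean_space \<Rightarrow> real"
  assumes f: "integrable lborel f" and c: "isCont f x"
  shows "(\<lambda>n. conv (mol n) f x) \<longlonglongrightarrow> f x"
proof (rule LIMSEQ_I)
  fix e :: real assume e: "e > 0"
  obtain d where d: "d > 0" "\<And>y. dist y x < d \<Longrightarrow> dist (f y) (f x) < e / 2"
    using c e unfolding continuous_at_eps_delta by (metis half_gt_zero)
  obtain N where N: "\<And>n. n \<ge> N \<Longrightarrow> 1 / (real n + 1) < d"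
    using eventually_mol_radius[OF d(1)] by (auto simp: eventually_sequentially)
  have "norm (conv (mol n) f x - f x) < e" if "n \<ge> N" for n
  proof -
    have "f x - e / 2 \<le> f y \<and> f y \<le> f x + e / 2" if "dist x y < 1 / (real n + 1)" for y
      using d(2)[of y] N[OF \<open>n \<ge> N\<close>] that by (auto simp: dist_commute dist_real_def abs_if split: if_splits)
    then have "f x - e / 2 \<le> conv (mol n) f x" "conv (mol n) f x \<le> f x + e / 2"
      using conv_mollifier_between[OF _ f, of "1 / (real n + 1)" x "f x - e / 2" "f x + e / 2"] by auto
    then show ?thesis using e by (auto simp: abs_less_iff)
  qed
  then show "\<exists>no. \<forall>n\<ge>no. norm (conv (mol n) f x - f x) < e" by blast
qed

lemma has_real_derivative_line:
  fixes f :: "'a::real_normed_vector \<Rightarrow> real"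
  assumes D: "(f has_derivative D) (at (x + s *\<^sub>R i))"
  shows "((\<lambda>t. f (x + t *\<^sub>R i)) has_real_derivative D i) (at s)"
proof -
  have "((\<lambda>t. x + t *\<^sub>R i) has_derivative (\<lambda>t. t *\<^sub>R i)) (at s)"
    by (auto intro!: derivative_eq_intros)
  from has_derivative_compose[OF this D]
  have "((\<lambda>t. f (x + t *\<^sub>R i)) has_derivative (\<lambda>t. D (t *\<^sub>R i))) (at s)" .
  moreover have "(\<lambda>t. D (t *\<^sub>R i)) = (*) (D i)"
    by (simp add: fun_eq_iff linear_scale[OF has_derivative_linear[OF D]])
  ultimately show ?thesis by (simp add: has_field_derivative_def)
qed

text \<open>Integration by parts in its simplest form. Difference quotients of f have integral zero
  by translation invariance, and they converge boundedly to the partial derivative, which thereby is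
  measurable as well.\<close>

lemma integral_partial_derivative_eq_0:
  fixes f :: "'a::euclidean_space \<Rightarrow> real"
  assumes D: "\<And>x. (f has_derivative D x) (at x)"
    and K: "compact K" "\<And>x. x \<notin> K \<Longrightarrow> f x = 0"
    and B: "\<And>x. \<bar>D x i\<bar> \<le> B" and i: "i \<in> Basis"
  shows "integrable lborel (\<lambda>x. D x i)" "(\<integral>x. D x i \<partial>lborel) = 0"
proof -
  define q where "q n x = (f (x + (1 / (real n + 1)) *\<^sub>R i) - f x) * (real n + 1)" for n x
  have cont: "continuous_on UNIV f"
    using D by (intro continuous_at_imp_continuous_on ballI has_derivative_continuous)
  have [measurable]: "f \<in> borel_measurable borel" by (rule borel_measurable_continuous_onI[OF cont])
  have int: "integrable lborel f" by (rule integrable_continuous_compact_support[OF cont K])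
  \<comment> \<open>The steps 1 / (n + 1) are at most 1, so all difference quotients vanish outside
    the unit neighbourhood of K; the indicator of this compact set times B dominates them.\<close>
  define K' where "K' = {x + y | x y. x \<in> K \<and> y \<in> cball (0::'a) 1}"
  have K': "compact K'" unfolding K'_def by (intro compact_sums K compact_cball)
  have B0: "B \<ge> 0" using B[of 0] by linarith
  have lim: "(\<lambda>n. q n x) \<longlonglongrightarrow> D x i" for x
  proof -
    have d: "((\<lambda>t. f (x + t *\<^sub>R i)) has_real_derivative D x i) (at 0)"
      by (rule has_real_derivative_line) (simp add: D)
    have "((\<lambda>h. (f (x + h *\<^sub>R i) - f x) / h) \<longlongrightarrow> D x i) (at 0)"
      using d by (simp add: DERIV_def)
    then have "(\<lambda>n. (f (x + (1 / (real n + 1)) *\<^sub>R i) - f x) / (1 / (real n + 1))) \<longlonglongrightarrow> D x i"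
    proof (rule tendsto_compose_eventually[where f="\<lambda>n. 1 / (real n + 1)" and g="\<lambda>h. (f (x + h *\<^sub>R i) - f x) / h"])
      show "(\<lambda>n. 1 / (real n + 1)) \<longlonglongrightarrow> 0"
        using LIMSEQ_inverse_real_of_nat by (simp add: inverse_eq_divide add.commute)
    qed simp
    then show ?thesis by (simp add: q_def)
  qed
  have dom: "\<bar>q n x\<bar> \<le> indicator K' x * B" for n x
  proof (cases "x \<in> K'")
    case True
    let ?t = "1 / (real n + 1)"
    have "norm (f (x + ?t *\<^sub>R i) - f x) \<le> B * ?t"
    proof -
      have "\<exists>s>0. s < ?t \<and> f (x + ?t *\<^sub>R i) - f (x + 0 *\<^sub>R i) = (?t - 0) * D (x + s *\<^sub>R i) i"
        by (rule MVT2) (use has_real_derivative_line[OF D] in auto)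
      then obtain s where "f (x + ?t *\<^sub>R i) - f x = ?t * D (x + s *\<^sub>R i) i" by auto
      then show ?thesis using mult_left_mono[OF B[of "x + s *\<^sub>R i"], of ?t] by (simp add: abs_mult)
    qed
    then have "\<bar>f (x + ?t *\<^sub>R i) - f x\<bar> * (real n + 1) \<le> B" by (simp add: pos_le_divide_eq)
    then show ?thesis using True by (simp add: q_def abs_mult)
  next
    case False
    have "x \<notin> K" using False unfolding K'_def by (force intro: exI[of _ x] exI[of _ 0])
    moreover have "x + (1 / (real n + 1)) *\<^sub>R i \<notin> K"
    proof
      assume "x + (1 / (real n + 1)) *\<^sub>R i \<in> K"
      moreover have "x = (x + (1 / (real n + 1)) *\<^sub>R i) + (- (1 / (real n + 1)) *\<^sub>R i)" by simp
      moreover have "- (1 / (real n + 1)) *\<^sub>R i \<in> cball 0 1" using i by (simp add: field_simps)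
      ultimately show False using False unfolding K'_def by blast
    qed
    ultimately show ?thesis using False K(2) by (simp add: q_def)
  qed
  have iB: "integrable lborel (\<lambda>x. indicator K' x * B)"
    using emeasure_compact_finite[OF K'] K' by (intro integrable_mult_left) (auto intro!: integrable_real_indicator borel_compact)
  have qm: "q n \<in> borel_measurable lborel" for n unfolding q_def by measurable
  have Dm: "(\<lambda>x. D x i) \<in> borel_measurable lborel"
    by (rule borel_measurable_LIMSEQ_real[OF lim qm])
  show "integrable lborel (\<lambda>x. D x i)"
    by (rule integrable_dominated_convergence[where s=q, OF Dm qm iB]) (use lim dom in auto)
  have "(\<lambda>n. \<integral>x. q n x \<partial>lborel) \<longlonglongrightarrow> (\<integral>x. D x i \<partial>lborel)"
    by (rule integral_dominated_convergence[where s=q, OF Dm qm iB]) (use lim dom in auto)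
  moreover have "(\<integral>x. q n x \<partial>lborel) = 0" for n
    unfolding q_def using int by (simp add: integrable_lborel_translate integral_lborel_translate)
  ultimately show "(\<integral>x. D x i \<partial>lborel) = 0" by (simp add: LIMSEQ_const_iff)
qed

section \<open>Weak derivatives\<close>

lemma compact_neighbourhood:
  fixes K :: "'a::euclidean_space set"
  assumes "compact K" "K \<subseteq> \<Omega>" "open \<Omega>"
  obtains \<delta> K' where "\<delta> > 0" "compact K'" "K \<subseteq> K'" "K' \<subseteq> \<Omega>" "\<And>x. x \<in> K \<Longrightarrow> cball x \<delta> \<subseteq> K'"
proof -
  obtain \<delta> where \<delta>: "\<delta> > 0" "(\<Union>x\<in>K. cball x \<delta>) \<subseteq> \<Omega>"
    using compact_subset_open_imp_cball_epsilon_subset[OF assms(1,3,2)] by blast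
  have eq: "(\<Union>x\<in>K. cball x \<delta>) = {x + y | x y. x \<in> K \<and> y \<in> cball 0 \<delta>}"
  proof (intro equalityI subsetI)
    fix z assume "z \<in> (\<Union>x\<in>K. cball x \<delta>)"
    then obtain x where "x \<in> K" "dist x z \<le> \<delta>" by auto
    moreover have "z = x + (z - x)" by simp
    ultimately show "z \<in> {x + y | x y. x \<in> K \<and> y \<in> cball 0 \<delta>}"
      by (smt (verit) dist_norm dist_commute mem_Collect_eq mem_cball_0)
  next
    fix z assume "z \<in> {x + y | x y. x \<in> K \<and> y \<in> cball 0 \<delta>}"
    then obtain x y where "z = x + y" "x \<in> K" "norm y \<le> \<delta>" by auto
    then show "z \<in> (\<Union>x\<in>K. cball x \<delta>)" by (auto simp: dist_norm intro!: bexI[of _ x])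
  qed
  show thesis
  proof (rule that[of \<delta> "\<Union>x\<in>K. cball x \<delta>"])
    show "compact (\<Union>x\<in>K. cball x \<delta>)"
      unfolding eq by (intro compact_sums assms compact_cball)
    show "K \<subseteq> (\<Union>x\<in>K. cball x \<delta>)" using \<delta>(1) by (auto intro!: bexI)
  qed (use \<delta> in auto)
qed

lemma AE_lebesgue_on_iff:
  assumes "open \<Omega>"
  shows "(AE x in lebesgue_on \<Omega>. P x) \<longleftrightarrow> (AE x in lborel. x \<in> \<Omega> \<longrightarrow> P x)"
  using assms by (subst AE_restrict_space_iff) (auto simp: AE_completion_iff)

lemma borel_measurable_lebesgue_cong_AE:
  fixes f g :: "'a::euclidean_space \<Rightarrow> 'b::euclidean_space"
  assumes "f \<in> borel_measurable lebesgue" "AE x in lborel. f x = g x"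
  shows "g \<in> borel_measurable lebesgue"
  using borel_measurable_AE[OF assms(1)] assms(2) by (simp add: AE_completion_iff)

text \<open>The definitions integrate over \<Omega> with respect to the completed measure, while
  convolution and the exchange of integrals live on \<open>lborel\<close>. This lemma is the bridge
  between the two.\<close>

lemma lebesgue_on_transfer:
  fixes p p0 :: "'a::euclidean_space \<Rightarrow> real"
  assumes \<Omega>: "open \<Omega>" and p0[measurable]: "p0 \<in> borel_measurable borel" and z: "\<And>x. x \<notin> \<Omega> \<Longrightarrow> p0 x = 0"
    and ae: "AE x in lborel. x \<in> \<Omega> \<longrightarrow> p x = p0 x"
  shows integral_lebesgue_on_transfer: "(\<integral>x. p x \<partial>lebesgue_on \<Omega>) = (\<integral>x. p0 x \<partial>lborel)"
    and integrable_lebesgue_on_transfer: "integrable (lebesgue_on \<Omega>) p \<longleftrightarrow> integrable lborel p0"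
proof -
  let ?p = "\<lambda>x. indicator \<Omega> x *\<^sub>R p x"
  have s: "\<Omega> \<inter> space lebesgue \<in> sets lebesgue" using \<Omega> by auto
  have ae': "AE x in lborel. p0 x = ?p x" using ae z by (auto simp: indicator_def elim!: eventually_mono)
  have m0: "p0 \<in> borel_measurable lebesgue" by (rule measurable_completion) simp
  have m: "?p \<in> borel_measurable lebesgue" by (rule borel_measurable_lebesgue_cong_AE[OF m0 ae'])
  have ae'': "AE x in lebesgue. p0 x = ?p x" using ae' by (simp add: AE_completion_iff)
  have "(\<integral>x. p x \<partial>lebesgue_on \<Omega>) = (\<integral>x. ?p x \<partial>lebesgue)" by (rule integral_restrict_space[OF s])
  also have "\<dots> = (\<integral>x. p0 x \<partial>lebesgue)" by (rule integral_cong_AE[OF m m0]) (use ae'' in auto)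
  also have "\<dots> = (\<integral>x. p0 x \<partial>lborel)" by (rule integral_completion) simp
  finally show "(\<integral>x. p x \<partial>lebesgue_on \<Omega>) = (\<integral>x. p0 x \<partial>lborel)" .
  have "integrable (lebesgue_on \<Omega>) p \<longleftrightarrow> integrable lebesgue ?p" by (rule integrable_restrict_space[OF s])
  also have "\<dots> \<longleftrightarrow> integrable lebesgue p0" by (rule integrable_cong_AE[OF m m0]) (use ae'' in auto)
  also have "\<dots> \<longleftrightarrow> integrable lborel p0" by (rule integrable_completion) simp
  finally show "integrable (lebesgue_on \<Omega>) p \<longleftrightarrow> integrable lborel p0" .
qed

text \<open>A locally integrable function is Lebesgue measurable and matters on \<Omega> only, which
  is too little for a convolution. The substitute f0 is Borel and integrable on the whole space,
  equals f almost everywhere on K and is zero elsewhere.\<close>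

definition borel_rep :: "'a::euclidean_space set \<Rightarrow> ('a \<Rightarrow> real) \<Rightarrow> ('a \<Rightarrow> real) \<Rightarrow> bool" where
  "borel_rep K f f0 \<longleftrightarrow> integrable lborel f0 \<and> (\<forall>x. x \<notin> K \<longrightarrow> f0 x = 0) \<and>
     (AE x in lborel. x \<in> K \<longrightarrow> f x = f0 x)"

lemma loc_integrable_borel_rep:
  assumes "loc_integrable \<Omega> f" "compact K" "K \<subseteq> \<Omega>"
  obtains f0 where "borel_rep K f f0"
proof -
  have K[measurable]: "K \<in> sets borel" using assms(2) by (rule borel_compact)
  have i: "integrable lebesgue (\<lambda>x. indicator K x *\<^sub>R f x)"
    using assms unfolding loc_integrable_def set_integrable_def by blast
  then obtain g where g[measurable]: "g \<in> borel_measurable lborel" and ae: "AE x in lborel. indicator K x *\<^sub>R f x = g x"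
    using completion_ex_borel_measurable_real[OF borel_measurable_integrable[OF i]] by blast
  let ?f0 = "\<lambda>x. indicator K x * g x"
  have m0: "?f0 \<in> borel_measurable lborel" by measurable
  have ae0: "AE x in lborel. indicator K x *\<^sub>R f x = ?f0 x" using ae by (auto simp: indicator_def elim!: eventually_mono)
  have "integrable lebesgue ?f0"
    by (rule integrable_cong_AE_imp[OF i measurable_completion[OF m0]])
      (use ae0 in \<open>auto simp: AE_completion_iff elim!: eventually_mono\<close>)
  then have "integrable lborel ?f0" using integrable_completion[OF m0] by blast
  moreover have "AE x in lborel. x \<in> K \<longrightarrow> f x = ?f0 x" using ae0 by (auto elim!: eventually_mono)
  ultimately show thesis by (intro that[of ?f0]) (auto simp: borel_rep_def)
qed

lemma borel_rep_measurable: "borel_rep K f f0 \<Longrightarrow> f0 \<in> borel_measurable borel"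
  by (auto simp: borel_rep_def)

lemma integral_borel_rep:
  assumes "open \<Omega>" "K \<subseteq> \<Omega>" "borel_rep K' f f0" "K \<subseteq> K'" "k \<in> borel_measurable borel" "\<And>x. x \<notin> K \<Longrightarrow> k x = 0"
  shows "(\<integral>x. k x * f x \<partial>lebesgue_on \<Omega>) = (\<integral>x. k x * f0 x \<partial>lborel)"
proof (rule integral_lebesgue_on_transfer[OF assms(1)])
  show "(\<lambda>x. k x * f0 x) \<in> borel_measurable borel"
    using borel_rep_measurable[OF assms(3)] assms(5) by measurable
  have "AE x in lborel. x \<in> K' \<longrightarrow> f x = f0 x" using assms(3) by (simp add: borel_rep_def)
  then show "AE x in lborel. x \<in> \<Omega> \<longrightarrow> k x * f x = k x * f0 x"
  proof eventually_elim
    case (elim x)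
    then show ?case using assms(4,6) by (cases "x \<in> K") auto
  qed
qed (use assms in auto)

section \<open>Mollification of weak derivatives and their uniqueness\<close>

lemma Ck_on_reflect:
  fixes f :: "'a::euclidean_space \<Rightarrow> 'b::euclidean_space"
  shows "Ck_on k UNIV f \<Longrightarrow> Ck_on k UNIV (\<lambda>y. f (x - y))"
proof (induction k arbitrary: f)
  case 0
  then show ?case
    by (auto intro!: continuous_intros continuous_on_compose2[of UNIV f])
next
  case (Suc k)
  then obtain D where D: "\<And>x. (f has_derivative D x) (at x)" "\<And>i. i \<in> Basis \<Longrightarrow> Ck_on k UNIV (\<lambda>x. D x i)"
    by auto
  show ?case
  proof (rule Ck_on_SucI[where D="\<lambda>y h. - D (x - y) h"])
    fix y
    have "((\<lambda>y. x - y) has_derivative (\<lambda>h. - h)) (at y)" by (auto intro!: derivative_eq_intros)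
    from has_derivative_compose[OF this D(1)]
    show "((\<lambda>y. f (x - y)) has_derivative (\<lambda>h. - D (x - y) h)) (at y)"
      by (simp add: linear_neg[OF has_derivative_linear[OF D(1)]])
  next
    fix i :: 'a assume "i \<in> Basis"
    then show "Ck_on k UNIV (\<lambda>y. - D (x - y) i)"
      by (intro Ck_on_bounded_linear[OF bounded_linear_minus[OF bounded_linear_ident]] Suc.IH D(2))
  qed
qed

lemma frechet_derivative_reflect:
  assumes "smooth f"
  shows "frechet_derivative (\<lambda>y. f (x - y)) (at y) h = - frechet_derivative f (at (x - y)) h"
proof -
  have "((\<lambda>y. x - y) has_derivative (\<lambda>h. - h)) (at y)" by (auto intro!: derivative_eq_intros)
  from has_derivative_compose[OF this smooth_has_derivative[OF assms]]
  have "((\<lambda>y. f (x - y)) has_derivative (\<lambda>h. - frechet_derivative f (at (x - y)) h)) (at y)"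
    by (simp add: linear_neg[OF has_derivative_linear[OF smooth_has_derivative[OF assms]]])
  from frechet_derivative_at[OF this] show ?thesis by (metis)
qed

lemma has_weak_derivD:
  fixes f g :: "'a::euclidean_space \<Rightarrow> real"
  assumes "has_weak_deriv \<Omega> i f g" "\<psi> \<in> test_functions \<Omega>"
  shows "(\<integral>x. frechet_derivative \<psi> (at x) i * f x \<partial>lebesgue_on \<Omega>) = - (\<integral>x. \<psi> x * g x \<partial>lebesgue_on \<Omega>)"
  using assms by (simp add: has_weak_deriv_def)

lemma smooth_borel_measurable: "smooth f \<Longrightarrow> f \<in> borel_measurable borel"
  by (rule borel_measurable_continuous_onI[OF smooth_continuous])

text \<open>Mollification commutes with weak differentiation at points whose r-ball stays in K: the
  reflected kernel centred at x is then a test function on \<Omega>. The sign from the reflection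
  cancels the sign in the definition of the weak derivative.\<close>

lemma frechet_derivative_conv_weak:
  fixes f g :: "'a::euclidean_space \<Rightarrow> real"
  assumes \<Omega>: "open \<Omega>" and wd: "has_weak_deriv \<Omega> i f g" and i: "i \<in> Basis"
    and K: "compact K" "K \<subseteq> \<Omega>" and f0: "borel_rep K f f0" and g0: "borel_rep K g g0"
    and r: "r > 0" "cball x r \<subseteq> K"
  shows "frechet_derivative (conv (mollifier r) f0) (at x) i = conv (mollifier r) g0 x"
proof -
  let ?\<eta> = "mollifier r :: 'a \<Rightarrow> real"
  let ?\<psi> = "\<lambda>y. ?\<eta> (x - y)"
  have z: "?\<psi> y = 0" if "y \<notin> cball x r" for y
    using r(1) that by (intro mollifier_eq_0) (auto simp: dist_norm)
  have sm: "smooth ?\<psi>" using Ck_on_reflect smooth_mollifier by blast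
  have test: "?\<psi> \<in> test_functions \<Omega>"
    unfolding test_functions_iff using sm z r K by (auto intro!: exI[of _ "cball x r"])
  have fz: "frechet_derivative ?\<psi> (at y) i = 0" if "y \<notin> cball x r" for y
    using frechet_derivative_zero_outside_closed[OF closed_cball z that] by simp
  have "frechet_derivative (conv ?\<eta> f0) (at x) i = conv (\<lambda>z. frechet_derivative ?\<eta> (at z) i) f0 x"
    by (rule frechet_derivative_conv[OF smooth_mollifier compact_cball[of 0 r] mollifier_cball _ i])
      (use r f0 in \<open>auto simp: borel_rep_def\<close>)
  also have "\<dots> = - (\<integral>y. frechet_derivative ?\<psi> (at y) i * f0 y \<partial>lborel)"
    unfolding conv_def by (simp add: frechet_derivative_reflect[OF smooth_mollifier])
  also have "(\<integral>y. frechet_derivative ?\<psi> (at y) i * f0 y \<partial>lborel) =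
      (\<integral>y. frechet_derivative ?\<psi> (at y) i * f y \<partial>lebesgue_on \<Omega>)"
    by (rule integral_borel_rep[OF \<Omega> _ f0 r(2), symmetric])
      (use r K fz smooth_borel_measurable[OF smooth_partial[OF sm i]] in auto)
  also have "\<dots> = - (\<integral>y. ?\<psi> y * g y \<partial>lebesgue_on \<Omega>)" by (rule has_weak_derivD[OF wd test])
  also have "(\<integral>y. ?\<psi> y * g y \<partial>lebesgue_on \<Omega>) = (\<integral>y. ?\<psi> y * g0 y \<partial>lborel)"
    by (rule integral_borel_rep[OF \<Omega> _ g0 r(2)]) (use r K z smooth_borel_measurable[OF sm] in auto)
  finally show ?thesis by (simp add: conv_def[of _ g0])
qed

text \<open>A set that is negligible near each of its points is negligible.\<close>

lemma AE_lborel_locally: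
  fixes \<Omega> :: "'a::euclidean_space set"
  assumes "\<And>x. x \<in> \<Omega> \<Longrightarrow> \<exists>r>0. AE y in lborel. y \<in> ball x r \<longrightarrow> P y"
  shows "AE x in lborel. x \<in> \<Omega> \<longrightarrow> P x"
proof -
  have "negligible {x \<in> \<Omega>. \<not> P x}"
    unfolding locally_negligible_alt[of "{x \<in> \<Omega>. \<not> P x}"]
  proof
    fix x assume x: "x \<in> {x \<in> \<Omega>. \<not> P x}"
    then obtain r where r: "r > 0" "AE y in lborel. y \<in> ball x r \<longrightarrow> P y" using assms by blast
    have "AE y in lebesgue. y \<in> ball x r \<longrightarrow> P y" using r(2) by (simp add: AE_completion_iff)
    then have "{y. \<not> (y \<in> ball x r \<longrightarrow> P y)} \<in> null_sets lebesgue"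
      by (simp add: completion.AE_iff_null_sets)
    then have "negligible {y. \<not> (y \<in> ball x r \<longrightarrow> P y)}" by (simp add: negligible_iff_null_sets)
    then have "negligible ({x \<in> \<Omega>. \<not> P x} \<inter> ball x r)" by (rule negligible_subset) auto
    then show "\<exists>U. openin (top_of_set {x \<in> \<Omega>. \<not> P x}) U \<and> x \<in> U \<and> negligible U"
      using x r by (intro exI[of _ "{x \<in> \<Omega>. \<not> P x} \<inter> ball x r"]) (auto simp: openin_open_Int)
  qed
  then have "AE x in lebesgue. \<not> (x \<in> \<Omega> \<and> \<not> P x)"
    by (simp add: completion.AE_iff_null_sets negligible_iff_null_sets)
  then show ?thesis by (simp add: AE_completion_iff)
qed

text \<open>On a small ball the mollifications of g and g' are both the classical derivative of the
  mollified f, hence equal; both converge in L1 to g and g'.\<close>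

lemma has_weak_deriv_unique_real:
  fixes f g g' :: "'a::euclidean_space \<Rightarrow> real"
  assumes \<Omega>: "open \<Omega>" and wd: "has_weak_deriv \<Omega> i f g" "has_weak_deriv \<Omega> i f g'" and i: "i \<in> Basis"
  shows "AE x in lborel. x \<in> \<Omega> \<longrightarrow> g x = g' x"
proof (rule AE_lborel_locally)
  fix x assume "x \<in> \<Omega>"
  then obtain r where r: "r > 0" "cball x r \<subseteq> \<Omega>" using \<Omega> open_contains_cball by blast
  define K where "K = cball x r"
  have K: "compact K" "K \<subseteq> \<Omega>" using r by (auto simp: K_def)
  obtain f0 g0 g0' where reps: "borel_rep K f f0" "borel_rep K g g0" "borel_rep K g' g0'"
    using loc_integrable_borel_rep[OF _ K] wd unfolding has_weak_deriv_def by metis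
  have int: "integrable lborel g0" "integrable lborel g0'" using reps by (auto simp: borel_rep_def)
  \<comment> \<open>Half the radius leaves room for the mollification: for radii below r / 2 the
    balls around points of ?B stay in K.\<close>
  let ?B = "ball x (r / 2)"
  have ev: "eventually (\<lambda>n. (\<integral>y. indicator ?B y * \<bar>g0 y - g0' y\<bar> \<partial>lborel) \<le>
      (\<integral>y. \<bar>conv (mol n) g0 y - g0 y\<bar> \<partial>lborel) + (\<integral>y. \<bar>conv (mol n) g0' y - g0' y\<bar> \<partial>lborel)) sequentially"
    using eventually_mol_radius[OF half_gt_zero[OF r(1)]]
  proof (rule eventually_mono)
    fix n assume n: "1 / (real n + 1) < r / 2"
    have i1: "integrable lborel (\<lambda>y. \<bar>conv (mol n) g0 y - g0 y\<bar>)" "integrable lborel (\<lambda>y. \<bar>conv (mol n) g0' y - g0' y\<bar>)"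
      using int integrable_conv[of "1 / (real n + 1)"] by (auto intro!: Bochner_Integration.integrable_abs Bochner_Integration.integrable_diff)
    have "conv (mol n) g0 y = conv (mol n) g0' y" if y: "y \<in> ?B" for y
    proof -
      have "cball y (1 / (real n + 1)) \<subseteq> K"
      proof
        fix z assume "z \<in> cball y (1 / (real n + 1))"
        then show "z \<in> K" using y n dist_triangle[of x z y] by (auto simp: K_def)
      qed
      then have "frechet_derivative (conv (mol n) f0) (at y) i = conv (mol n) g0 y"
        "frechet_derivative (conv (mol n) f0) (at y) i = conv (mol n) g0' y"
        using frechet_derivative_conv_weak[OF \<Omega> wd(1) i K reps(1,2)]
          frechet_derivative_conv_weak[OF \<Omega> wd(2) i K reps(1,3)] by auto
      then show ?thesis by simp
    qed
    then have "indicator ?B y * \<bar>g0 y - g0' y\<bar> \<le> \<bar>conv (mol n) g0 y - g0 y\<bar> + \<bar>conv (mol n) g0' y - g0' y\<bar>" for y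
      by (cases "y \<in> ?B") auto
    then have "(\<integral>y. indicator ?B y * \<bar>g0 y - g0' y\<bar> \<partial>lborel) \<le>
       (\<integral>y. \<bar>conv (mol n) g0 y - g0 y\<bar> + \<bar>conv (mol n) g0' y - g0' y\<bar> \<partial>lborel)"
      using i1 int by (intro integral_mono Bochner_Integration.integrable_add integrable_real_mult_indicator[where A="?B", simplified mult.commute])
        (auto intro!: integrable_bounded_mult[where B=1] simp: indicator_def)
    then show "(\<integral>y. indicator ?B y * \<bar>g0 y - g0' y\<bar> \<partial>lborel) \<le>
      (\<integral>y. \<bar>conv (mol n) g0 y - g0 y\<bar> \<partial>lborel) + (\<integral>y. \<bar>conv (mol n) g0' y - g0' y\<bar> \<partial>lborel)"
      using i1 by simp
  qed
  have int2: "integrable lborel (\<lambda>y. indicator ?B y * \<bar>g0 y - g0' y\<bar>)"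
    using int by (intro integrable_bounded_mult[where B=1]) (auto simp: indicator_def)
  have "(\<integral>y. indicator ?B y * \<bar>g0 y - g0' y\<bar> \<partial>lborel) \<le> 0 + 0"
    by (rule tendsto_lowerbound[OF tendsto_add[OF conv_mol_L1[OF int(1)] conv_mol_L1[OF int(2)]] ev]) simp
  moreover have "(\<integral>y. indicator ?B y * \<bar>g0 y - g0' y\<bar> \<partial>lborel) \<ge> 0"
    by (intro integral_nonneg_AE) (auto simp: indicator_def)
  ultimately have "(\<integral>y. indicator ?B y * \<bar>g0 y - g0' y\<bar> \<partial>lborel) = 0" by linarith
  then have "AE y in lborel. indicator ?B y * \<bar>g0 y - g0' y\<bar> = 0"
    using integral_nonneg_eq_0_iff_AE[OF int2] by (simp add: indicator_def)
  moreover have "AE y in lborel. y \<in> K \<longrightarrow> g y = g0 y" "AE y in lborel. y \<in> K \<longrightarrow> g' y = g0' y"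
    using reps by (auto simp: borel_rep_def)
  ultimately have "AE y in lborel. y \<in> ball x (r/2) \<longrightarrow> g y = g' y"
  proof eventually_elim
    case (elim y)
    moreover have "y \<in> K" if "y \<in> ?B"
    proof -
      have "dist x y < r / 2" using that by simp
      with zero_le_dist[of x y] have "dist x y \<le> r" by linarith
      then show ?thesis by (simp add: K_def)
    qed
    ultimately show ?case by auto
  qed
  then show "\<exists>r>0. AE y in lborel. y \<in> ball x r \<longrightarrow> g y = g' y" using r by (intro exI[of _ "r/2"]) auto
qed

section \<open>Linear operations on weak derivatives and changes on null sets\<close>

lemma integrable_loc_mult:
  fixes f :: "'a::euclidean_space \<Rightarrow> 'b::euclidean_space"
  assumes \<Omega>: "open \<Omega>" and f: "loc_integrable \<Omega> f" and K: "compact K" "K \<subseteq> \<Omega>"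
    and k: "k \<in> borel_measurable borel" "\<And>x. x \<notin> K \<Longrightarrow> k x = 0" "\<And>x. \<bar>k x\<bar> \<le> B"
  shows "integrable (lebesgue_on \<Omega>) (\<lambda>x. k x *\<^sub>R f x)"
proof -
  have i: "integrable lebesgue (\<lambda>x. indicator K x *\<^sub>R f x)"
    using f K unfolding loc_integrable_def set_integrable_def by blast
  have [measurable]: "k \<in> borel_measurable lebesgue" using k(1) by (simp add: measurable_completion)
  have "integrable lebesgue (\<lambda>x. k x *\<^sub>R (indicator K x *\<^sub>R f x))"
  proof (rule Bochner_Integration.integrable_bound[where f="\<lambda>x. B *\<^sub>R (indicator K x *\<^sub>R f x)"])
    show "AE x in lebesgue. norm (k x *\<^sub>R (indicator K x *\<^sub>R f x)) \<le> norm (B *\<^sub>R (indicator K x *\<^sub>R f x))"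
      by (auto simp: abs_mult intro!: AE_I2 mult_right_mono order_trans[OF k(3) abs_ge_self])
    show "integrable lebesgue (\<lambda>x. B *\<^sub>R (indicator K x *\<^sub>R f x))" by (intro integrable_scaleR_right i)
    show "(\<lambda>x. k x *\<^sub>R (indicator K x *\<^sub>R f x)) \<in> borel_measurable lebesgue"
      by (intro borel_measurable_scaleR borel_measurable_integrable[OF i]) measurable
  qed
  also have "(\<lambda>x. k x *\<^sub>R (indicator K x *\<^sub>R f x)) = (\<lambda>x. indicator \<Omega> x *\<^sub>R (k x *\<^sub>R f x))"
    using k(2) K(2) by (auto simp: indicator_def fun_eq_iff)
  finally show ?thesis using \<Omega> by (subst integrable_restrict_space) auto
qed

lemma integrable_test_mult:
  fixes f :: "'a::euclidean_space \<Rightarrow> 'b::euclidean_space" and \<psi> :: "'a \<Rightarrow> real"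
  assumes "open \<Omega>" "loc_integrable \<Omega> f" "\<psi> \<in> test_functions \<Omega>"
  shows "integrable (lebesgue_on \<Omega>) (\<lambda>x. \<psi> x *\<^sub>R f x)"
proof -
  obtain K where K: "smooth \<psi>" "compact K" "K \<subseteq> \<Omega>" "\<And>x. x \<notin> K \<Longrightarrow> \<psi> x = 0"
    using test_functionsE[OF assms(3)] by metis
  obtain B where "\<And>x. \<bar>\<psi> x\<bar> \<le> B"
    using bounded_continuous_compact_support[OF smooth_continuous[OF K(1)] K(2,4)] by (metis real_norm_def)
  then show ?thesis
    using integrable_loc_mult[OF assms(1,2) K(2,3) smooth_borel_measurable[OF K(1)] K(4)] by blast
qed

lemma test_functions_partial:
  assumes "\<psi> \<in> test_functions \<Omega>" "i \<in> Basis"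
  shows "(\<lambda>x. frechet_derivative \<psi> (at x) i) \<in> test_functions \<Omega>"
proof -
  obtain K where "smooth \<psi>" "compact K" "K \<subseteq> \<Omega>" "\<And>x. x \<notin> K \<Longrightarrow> frechet_derivative \<psi> (at x) = (\<lambda>h. 0)"
    by (rule test_functionsE[OF assms(1)]) blast
  then show ?thesis using smooth_partial[OF _ assms(2)] unfolding test_functions_iff by metis
qed

lemma loc_integrable_bounded_linear:
  assumes "bounded_linear T" "loc_integrable \<Omega> f"
  shows "loc_integrable \<Omega> (\<lambda>x. T (f x))"
  unfolding loc_integrable_def set_integrable_def
proof (intro allI impI)
  fix K assume "compact K" "K \<subseteq> \<Omega>"
  then have "integrable lebesgue (\<lambda>x. indicator K x *\<^sub>R f x)"
    using assms(2) unfolding loc_integrable_def set_integrable_def by blast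
  from integrable_bounded_linear[OF assms(1) this]
  show "integrable lebesgue (\<lambda>x. indicator K x *\<^sub>R T (f x))"
    by (simp add: bounded_linear.linear[OF assms(1), THEN linear_scale])
qed

lemma has_weak_deriv_bounded_linear:
  fixes f g :: "'a::euclidean_space \<Rightarrow> 'b::euclidean_space" and T :: "'b \<Rightarrow> 'c::euclidean_space"
  assumes \<Omega>: "open \<Omega>" and T: "bounded_linear T" and wd: "has_weak_deriv \<Omega> i f g" and i: "i \<in> Basis"
  shows "has_weak_deriv \<Omega> i (\<lambda>x. T (f x)) (\<lambda>x. T (g x))"
  unfolding has_weak_deriv_def
proof (intro conjI ballI)
  have loc: "loc_integrable \<Omega> f" "loc_integrable \<Omega> g" using wd by (auto simp: has_weak_deriv_def)
  then show "loc_integrable \<Omega> (\<lambda>x. T (f x))" "loc_integrable \<Omega> (\<lambda>x. T (g x))"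
    by (auto intro: loc_integrable_bounded_linear[OF T])
  fix \<psi> :: "'a \<Rightarrow> real" assume \<psi>: "\<psi> \<in> test_functions \<Omega>"
  have lin: "linear T" using T by (rule bounded_linear.linear)
  have "(\<integral>x. frechet_derivative \<psi> (at x) i *\<^sub>R T (f x) \<partial>lebesgue_on \<Omega>) =
      T (\<integral>x. frechet_derivative \<psi> (at x) i *\<^sub>R f x \<partial>lebesgue_on \<Omega>)"
    using integral_bounded_linear[OF T integrable_test_mult[OF \<Omega> loc(1) test_functions_partial[OF \<psi> i]]]
    by (simp add: linear_scale[OF lin])
  also have "\<dots> = T (- (\<integral>x. \<psi> x *\<^sub>R g x \<partial>lebesgue_on \<Omega>))"
    using wd \<psi> by (simp add: has_weak_deriv_def)
  also have "\<dots> = - (\<integral>x. \<psi> x *\<^sub>R T (g x) \<partial>lebesgue_on \<Omega>)"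
    using integral_bounded_linear[OF T integrable_test_mult[OF \<Omega> loc(2) \<psi>]]
    by (simp add: linear_scale[OF lin] linear_neg[OF lin])
  finally show "(\<integral>x. frechet_derivative \<psi> (at x) i *\<^sub>R T (f x) \<partial>lebesgue_on \<Omega>) =
     - (\<integral>x. \<psi> x *\<^sub>R T (g x) \<partial>lebesgue_on \<Omega>)" .
qed

lemma loc_integrable_add:
  assumes "loc_integrable \<Omega> f" "loc_integrable \<Omega> g"
  shows "loc_integrable \<Omega> (\<lambda>x. f x + g x)"
  using assms unfolding loc_integrable_def by (auto intro: set_integral_add)

lemma has_weak_deriv_add:
  fixes f g :: "'a::euclidean_space \<Rightarrow> 'b::euclidean_space"
  assumes \<Omega>: "open \<Omega>" and wd: "has_weak_deriv \<Omega> i f df" "has_weak_deriv \<Omega> i g dg" and i: "i \<in> Basis"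
  shows "has_weak_deriv \<Omega> i (\<lambda>x. f x + g x) (\<lambda>x. df x + dg x)"
  unfolding has_weak_deriv_def
proof (intro conjI ballI)
  have loc: "loc_integrable \<Omega> f" "loc_integrable \<Omega> df" "loc_integrable \<Omega> g" "loc_integrable \<Omega> dg"
    using wd by (auto simp: has_weak_deriv_def)
  then show "loc_integrable \<Omega> (\<lambda>x. f x + g x)" "loc_integrable \<Omega> (\<lambda>x. df x + dg x)"
    by (auto intro: loc_integrable_add)
  fix \<psi> :: "'a \<Rightarrow> real" assume \<psi>: "\<psi> \<in> test_functions \<Omega>"
  show "(\<integral>x. frechet_derivative \<psi> (at x) i *\<^sub>R (f x + g x) \<partial>lebesgue_on \<Omega>) =
     - (\<integral>x. \<psi> x *\<^sub>R (df x + dg x) \<partial>lebesgue_on \<Omega>)"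
    using wd \<psi> loc
    by (simp add: scaleR_add_right integrable_test_mult[OF \<Omega> _ \<psi>]
        integrable_test_mult[OF \<Omega> _ test_functions_partial[OF \<psi> i]] has_weak_deriv_def)
qed

lemma has_weak_deriv_sum:
  fixes f :: "'j \<Rightarrow> 'a::euclidean_space \<Rightarrow> 'b::euclidean_space"
  assumes \<Omega>: "open \<Omega>" and i: "i \<in> Basis" and J: "finite J"
    and wd: "\<And>j. j \<in> J \<Longrightarrow> has_weak_deriv \<Omega> i (f j) (df j)"
  shows "has_weak_deriv \<Omega> i (\<lambda>x. \<Sum>j\<in>J. f j x) (\<lambda>x. \<Sum>j\<in>J. df j x)"
  using J wd
proof (induction J rule: finite_induct)
  case empty
  then show ?case by (simp add: has_weak_deriv_def loc_integrable_def set_integrable_def)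
next
  case (insert j J)
  then show ?case
    using has_weak_deriv_add[OF \<Omega> insert.prems[of j] insert.IH i] by (simp add: insert.hyps)
qed

text \<open>Convolution is set up for real functions; through components the results carry over to
  complex values.\<close>

lemma has_weak_deriv_componentwise:
  fixes f g :: "'a::euclidean_space \<Rightarrow> 'b::euclidean_space"
  assumes \<Omega>: "open \<Omega>" and i: "i \<in> Basis"
    and wd: "\<And>j. j \<in> Basis \<Longrightarrow> has_weak_deriv \<Omega> i (\<lambda>x. f x \<bullet> j) (\<lambda>x. g x \<bullet> j)"
  shows "has_weak_deriv \<Omega> i f g"
proof -
  have "has_weak_deriv \<Omega> i (\<lambda>x. \<Sum>j\<in>Basis. (f x \<bullet> j) *\<^sub>R j) (\<lambda>x. \<Sum>j\<in>Basis. (g x \<bullet> j) *\<^sub>R j)"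
    by (intro has_weak_deriv_sum[OF \<Omega> i] has_weak_deriv_bounded_linear[OF \<Omega> bounded_linear_scaleR_left _ i] wd) simp_all
  then show ?thesis by (simp add: euclidean_representation)
qed

lemma has_weak_deriv_inner:
  fixes f g :: "'a::euclidean_space \<Rightarrow> 'b::euclidean_space"
  assumes "open \<Omega>" "has_weak_deriv \<Omega> i f g" "i \<in> Basis"
  shows "has_weak_deriv \<Omega> i (\<lambda>x. f x \<bullet> j) (\<lambda>x. g x \<bullet> j)"
  by (rule has_weak_deriv_bounded_linear[OF assms(1) bounded_linear_inner_left assms(2,3)])

lemma has_weak_deriv_unique:
  fixes f g g' :: "'a::euclidean_space \<Rightarrow> 'b::euclidean_space"
  assumes \<Omega>: "open \<Omega>" and wd: "has_weak_deriv \<Omega> i f g" "has_weak_deriv \<Omega> i f g'" and i: "i \<in> Basis"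
  shows "AE x in lebesgue_on \<Omega>. g x = g' x"
proof -
  have "AE x in lborel. \<forall>j\<in>(Basis :: 'b set). x \<in> \<Omega> \<longrightarrow> g x \<bullet> j = g' x \<bullet> j"
    using has_weak_deriv_unique_real[OF \<Omega> has_weak_deriv_inner[OF \<Omega> wd(1) i] has_weak_deriv_inner[OF \<Omega> wd(2) i] i]
    by (intro AE_finite_allI) auto
  then have "AE x in lborel. x \<in> \<Omega> \<longrightarrow> g x = g' x"
    by eventually_elim (auto intro: euclidean_eqI)
  then show ?thesis by (simp add: AE_lebesgue_on_iff[OF \<Omega>])
qed

lemma measurable_lebesgue_on_cong_AE:
  fixes f g :: "'a::euclidean_space \<Rightarrow> 'b::euclidean_space"
  assumes \<Omega>: "open \<Omega>" and f: "f \<in> borel_measurable (lebesgue_on \<Omega>)"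
    and ae: "AE x in lebesgue_on \<Omega>. f x = g x"
  shows "g \<in> borel_measurable (lebesgue_on \<Omega>)"
proof -
  have s: "\<Omega> \<inter> space lebesgue \<in> sets lebesgue" using \<Omega> by auto
  have "(\<lambda>x. indicator \<Omega> x *\<^sub>R f x) \<in> borel_measurable lebesgue"
    using f by (simp add: borel_measurable_restrict_space_iff[OF s])
  moreover have "AE x in lborel. indicator \<Omega> x *\<^sub>R f x = indicator \<Omega> x *\<^sub>R g x"
    using ae unfolding AE_lebesgue_on_iff[OF \<Omega>] by eventually_elim (auto simp: indicator_def)
  ultimately have "(\<lambda>x. indicator \<Omega> x *\<^sub>R g x) \<in> borel_measurable lebesgue"
    by (rule borel_measurable_lebesgue_cong_AE)
  then show ?thesis by (simp add: borel_measurable_restrict_space_iff[OF s])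
qed

lemma loc_integrable_cong_AE:
  fixes f g :: "'a::euclidean_space \<Rightarrow> 'b::euclidean_space"
  assumes \<Omega>: "open \<Omega>" and f: "loc_integrable \<Omega> f" and ae: "AE x in lebesgue_on \<Omega>. f x = g x"
  shows "loc_integrable \<Omega> g"
  unfolding loc_integrable_def set_integrable_def
proof (intro allI impI)
  fix K assume K: "compact K" "K \<subseteq> \<Omega>"
  then have i: "integrable lebesgue (\<lambda>x. indicator K x *\<^sub>R f x)"
    using f unfolding loc_integrable_def set_integrable_def by blast
  have ae': "AE x in lborel. indicator K x *\<^sub>R f x = indicator K x *\<^sub>R g x"
    using ae K unfolding AE_lebesgue_on_iff[OF \<Omega>] by (auto simp: indicator_def elim!: eventually_mono)
  show "integrable lebesgue (\<lambda>x. indicator K x *\<^sub>R g x)"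
    by (rule integrable_cong_AE_imp[OF i borel_measurable_lebesgue_cong_AE[OF borel_measurable_integrable[OF i] ae']])
      (use ae' in \<open>auto simp: AE_completion_iff elim!: eventually_mono\<close>)
qed

lemma integral_lebesgue_on_cong_AE:
  fixes f g :: "'a::euclidean_space \<Rightarrow> 'b::euclidean_space"
  assumes \<Omega>: "open \<Omega>" and ae: "AE x in lebesgue_on \<Omega>. f x = g x"
  shows "(\<integral>x. f x \<partial>lebesgue_on \<Omega>) = (\<integral>x. g x \<partial>lebesgue_on \<Omega>)"
    and "integrable (lebesgue_on \<Omega>) f \<longleftrightarrow> integrable (lebesgue_on \<Omega>) g"
proof -
  have ae2: "AE x in lebesgue_on \<Omega>. g x = f x" using ae by (auto elim: eventually_mono)
  have *: "integrable (lebesgue_on \<Omega>) f" if "integrable (lebesgue_on \<Omega>) g" "AE x in lebesgue_on \<Omega>. g x = f x" for f g :: "'a \<Rightarrow> 'b"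
    by (rule integrable_cong_AE_imp[OF that(1) measurable_lebesgue_on_cong_AE[OF \<Omega> borel_measurable_integrable[OF that(1)] that(2)]])
      (use that in \<open>auto elim: eventually_mono\<close>)
  show iff: "integrable (lebesgue_on \<Omega>) f \<longleftrightarrow> integrable (lebesgue_on \<Omega>) g"
    using *[OF _ ae] *[OF _ ae2] by blast
  show "(\<integral>x. f x \<partial>lebesgue_on \<Omega>) = (\<integral>x. g x \<partial>lebesgue_on \<Omega>)"
  proof (cases "integrable (lebesgue_on \<Omega>) f")
    case True
    then show ?thesis using iff ae by (intro integral_cong_AE) auto
  next
    case False
    then show ?thesis using iff by (simp add: not_integrable_integral_eq)
  qed
qed

lemma has_weak_deriv_cong_AE:
  fixes f g :: "'a::euclidean_space \<Rightarrow> 'b::euclidean_space"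
  assumes \<Omega>: "open \<Omega>" and wd: "has_weak_deriv \<Omega> i f g"
    and ae: "AE x in lebesgue_on \<Omega>. f x = f' x" "AE x in lebesgue_on \<Omega>. g x = g' x"
  shows "has_weak_deriv \<Omega> i f' g'"
  unfolding has_weak_deriv_def
proof (intro conjI ballI)
  have loc: "loc_integrable \<Omega> f" "loc_integrable \<Omega> g" using wd by (auto simp: has_weak_deriv_def)
  then show "loc_integrable \<Omega> f'" "loc_integrable \<Omega> g'" using loc_integrable_cong_AE[OF \<Omega>] ae by blast+
  fix \<psi> :: "'a \<Rightarrow> real" assume \<psi>: "\<psi> \<in> test_functions \<Omega>"
  have "(\<integral>x. frechet_derivative \<psi> (at x) i *\<^sub>R f' x \<partial>lebesgue_on \<Omega>) =
      (\<integral>x. frechet_derivative \<psi> (at x) i *\<^sub>R f x \<partial>lebesgue_on \<Omega>)"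
    by (rule integral_lebesgue_on_cong_AE(1)[OF \<Omega>]) (use ae(1) in \<open>auto elim: eventually_mono\<close>)
  moreover have "(\<integral>x. \<psi> x *\<^sub>R g' x \<partial>lebesgue_on \<Omega>) = (\<integral>x. \<psi> x *\<^sub>R g x \<partial>lebesgue_on \<Omega>)"
    by (rule integral_lebesgue_on_cong_AE(1)[OF \<Omega>]) (use ae(2) in \<open>auto elim: eventually_mono\<close>)
  ultimately show "(\<integral>x. frechet_derivative \<psi> (at x) i *\<^sub>R f' x \<partial>lebesgue_on \<Omega>) =
     - (\<integral>x. \<psi> x *\<^sub>R g' x \<partial>lebesgue_on \<Omega>)"
    using wd \<psi> by (simp add: has_weak_deriv_def)
qed

text \<open>Equality holds everywhere and not just almost everywhere: both sides choose from the
  same predicate, because having a given weak derivative is a property of the class modulo null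
  sets. Nested weak derivatives can be rewritten thanks to this.\<close>

lemma weak_deriv_cong_AE:
  fixes f g :: "'a::euclidean_space \<Rightarrow> 'b::euclidean_space"
  assumes \<Omega>: "open \<Omega>" and ae: "AE x in lebesgue_on \<Omega>. f x = g x"
  shows "weak_deriv \<Omega> i f = weak_deriv \<Omega> i g"
proof -
  have ae2: "AE x in lebesgue_on \<Omega>. g x = f x" using ae by (auto elim: eventually_mono)
  have "has_weak_deriv \<Omega> i f = has_weak_deriv \<Omega> i g"
    using has_weak_deriv_cong_AE[OF \<Omega> _ ae] has_weak_deriv_cong_AE[OF \<Omega> _ ae2] by (auto simp: fun_eq_iff)
  then show ?thesis by (simp add: weak_deriv_def)
qed

lemma weak_deriv_has_weak_deriv:
  "has_weak_deriv \<Omega> i f g \<Longrightarrow> has_weak_deriv \<Omega> i f (weak_deriv \<Omega> i f)"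
  unfolding weak_deriv_def by (rule someI[of "has_weak_deriv \<Omega> i f"])

lemma weak_deriv_AE_eq:
  fixes f g :: "'a::euclidean_space \<Rightarrow> 'b::euclidean_space"
  assumes "open \<Omega>" "has_weak_deriv \<Omega> i f g" "i \<in> Basis"
  shows "AE x in lebesgue_on \<Omega>. weak_deriv \<Omega> i f x = g x"
  by (rule has_weak_deriv_unique[OF assms(1) weak_deriv_has_weak_deriv[OF assms(2)] assms(2,3)])

section \<open>Product rule and chain rule for weak derivatives\<close>

lemma loc_integrable_Linf_mult:
  fixes c :: "'a::euclidean_space \<Rightarrow> real" and f :: "'a \<Rightarrow> 'b::euclidean_space"
  assumes \<Omega>: "open \<Omega>" and c: "c \<in> Linf_space (lebesgue_on \<Omega>)" and f: "loc_integrable \<Omega> f"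
  shows "loc_integrable \<Omega> (\<lambda>x. c x *\<^sub>R f x)"
  unfolding loc_integrable_def set_integrable_def
proof (intro allI impI)
  fix K assume K: "compact K" "K \<subseteq> \<Omega>"
  then have i: "integrable lebesgue (\<lambda>x. indicator K x *\<^sub>R f x)"
    using f unfolding loc_integrable_def set_integrable_def by blast
  have s: "\<Omega> \<inter> space lebesgue \<in> sets lebesgue" using \<Omega> by auto
  obtain B where B: "AE x in lebesgue_on \<Omega>. norm (c x) \<le> B" using c by (auto simp: Linf_space_def)
  have [measurable]: "(\<lambda>x. indicator \<Omega> x *\<^sub>R c x) \<in> borel_measurable lebesgue"
    using c by (simp add: Linf_space_def borel_measurable_restrict_space_iff[OF s])
  have B': "AE x in lebesgue. x \<in> \<Omega> \<longrightarrow> norm (c x) \<le> B"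
    using B by (simp add: AE_restrict_space_iff[OF s])
  have "integrable lebesgue (\<lambda>x. (indicator \<Omega> x *\<^sub>R c x) *\<^sub>R (indicator K x *\<^sub>R f x))"
  proof (rule Bochner_Integration.integrable_bound[where f="\<lambda>x. B *\<^sub>R (indicator K x *\<^sub>R f x)"])
    show "AE x in lebesgue. norm ((indicator \<Omega> x *\<^sub>R c x) *\<^sub>R (indicator K x *\<^sub>R f x)) \<le> norm (B *\<^sub>R (indicator K x *\<^sub>R f x))"
      using B'
    proof eventually_elim
      case (elim x)
      show ?case
      proof (cases "x \<in> \<Omega>")
        case True
        then have "\<bar>c x\<bar> \<le> \<bar>B\<bar>" using elim by simp
        then show ?thesis using True by (auto simp: abs_mult intro!: mult_right_mono)
      qed simp
    qed
    show "integrable lebesgue (\<lambda>x. B *\<^sub>R (indicator K x *\<^sub>R f x))" by (intro integrable_scaleR_right i)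
    show "(\<lambda>x. (indicator \<Omega> x *\<^sub>R c x) *\<^sub>R (indicator K x *\<^sub>R f x)) \<in> borel_measurable lebesgue"
      by (intro borel_measurable_scaleR[of "\<lambda>x. indicator \<Omega> x *\<^sub>R c x"] borel_measurable_integrable[OF i]) measurable
  qed
  also have "(\<lambda>x. (indicator \<Omega> x *\<^sub>R c x) *\<^sub>R (indicator K x *\<^sub>R f x)) = (\<lambda>x. indicator K x *\<^sub>R (c x *\<^sub>R f x))"
    using K(2) by (auto simp: indicator_def fun_eq_iff)
  finally show "integrable lebesgue (\<lambda>x. indicator K x *\<^sub>R (c x *\<^sub>R f x))" .
qed

text \<open>The error is at most |B| times the L1 distance between f and its mollification.\<close>

lemma conv_mol_mult_tendsto:
  fixes f m :: "'a::euclidean_space \<Rightarrow> real"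
  assumes f: "integrable lborel f" and m[measurable]: "m \<in> borel_measurable borel"
    and B: "AE x in lborel. \<bar>m x\<bar> \<le> B"
  shows "(\<lambda>n. \<integral>x. conv (mol n) f x * m x \<partial>lborel) \<longlonglongrightarrow> (\<integral>x. f x * m x \<partial>lborel)"
proof -
  have int: "integrable lborel (\<lambda>x. g x * m x)" if "integrable lborel g" for g :: "'a \<Rightarrow> real"
  proof (rule Bochner_Integration.integrable_bound[where f="\<lambda>x. B * g x"])
    show "AE x in lborel. norm (g x * m x) \<le> norm (B * g x)"
      using B
    proof eventually_elim
      case (elim x)
      then have "\<bar>m x\<bar> \<le> \<bar>B\<bar>" by simp
      then show ?case by (simp add: abs_mult mult.commute[of "\<bar>g x\<bar>"] mult_right_mono)
    qed
  qed (use that in auto)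
  have ic: "integrable lborel (conv (mol n) f)" for n using integrable_conv[OF _ f] by simp
  have "(\<lambda>n. (\<integral>x. conv (mol n) f x * m x \<partial>lborel) - (\<integral>x. f x * m x \<partial>lborel)) \<longlonglongrightarrow> 0"
  proof (rule Lim_null_comparison)
    show "(\<lambda>n. \<bar>B\<bar> * (\<integral>x. \<bar>conv (mol n) f x - f x\<bar> \<partial>lborel)) \<longlonglongrightarrow> 0"
      using tendsto_mult_left[OF conv_mol_L1[OF f], of "\<bar>B\<bar>"] by simp
    show "eventually (\<lambda>n. norm ((\<integral>x. conv (mol n) f x * m x \<partial>lborel) - (\<integral>x. f x * m x \<partial>lborel)) \<le>
        \<bar>B\<bar> * (\<integral>x. \<bar>conv (mol n) f x - f x\<bar> \<partial>lborel)) sequentially"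
    proof (rule always_eventually, rule allI)
      fix n
      have "(\<integral>x. conv (mol n) f x * m x \<partial>lborel) - (\<integral>x. f x * m x \<partial>lborel) =
          (\<integral>x. (conv (mol n) f x - f x) * m x \<partial>lborel)"
        using int[OF ic] int[OF f] by (simp add: left_diff_distrib)
      also have "norm \<dots> \<le> (\<integral>x. norm ((conv (mol n) f x - f x) * m x) \<partial>lborel)" by (rule integral_norm_bound)
      also have "\<dots> \<le> (\<integral>x. \<bar>B\<bar> * \<bar>conv (mol n) f x - f x\<bar> \<partial>lborel)"
      proof (rule integral_mono_AE)
        show "AE x in lborel. norm ((conv (mol n) f x - f x) * m x) \<le> \<bar>B\<bar> * \<bar>conv (mol n) f x - f x\<bar>"
          using B
        proof eventually_elim
          case (elim x)
          then have "\<bar>m x\<bar> \<le> \<bar>B\<bar>" by simp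
          then show ?case by (simp add: abs_mult mult.commute[of "\<bar>_ - _\<bar>"] mult_right_mono)
        qed
      qed (use int[OF Bochner_Integration.integrable_diff[OF ic f]] ic f in auto)
      finally show "norm ((\<integral>x. conv (mol n) f x * m x \<partial>lborel) - (\<integral>x. f x * m x \<partial>lborel)) \<le>
        \<bar>B\<bar> * (\<integral>x. \<bar>conv (mol n) f x - f x\<bar> \<partial>lborel)" by simp
    qed
  qed
  then show ?thesis by (rule LIM_zero_cancel)
qed

lemma borel_rep_Linf_bounded:
  assumes \<Omega>: "open \<Omega>" and K: "K \<subseteq> \<Omega>" and c: "c \<in> Linf_space (lebesgue_on \<Omega>)" and rep: "borel_rep K c c0"
  obtains B where "B \<ge> 0" "AE x in lborel. \<bar>c0 x\<bar> \<le> B"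
proof -
  obtain B where "AE x in lebesgue_on \<Omega>. norm (c x) \<le> B" using c by (auto simp: Linf_space_def)
  then have "AE x in lborel. x \<in> \<Omega> \<longrightarrow> norm (c x) \<le> B" by (simp add: AE_lebesgue_on_iff[OF \<Omega>])
  moreover have "AE x in lborel. x \<in> K \<longrightarrow> c x = c0 x" using rep by (simp add: borel_rep_def)
  ultimately have "AE x in lborel. \<bar>c0 x\<bar> \<le> max B 0"
  proof eventually_elim
    case (elim x)
    then show ?case using rep K by (cases "x \<in> K") (auto simp: borel_rep_def le_max_iff_disj)
  qed
  then show thesis by (intro that[of "max B 0"]) auto
qed

lemma integrable_AE_bounded_mult:
  fixes f m :: "'a::euclidean_space \<Rightarrow> real"
  assumes "integrable lborel f" "m \<in> borel_measurable borel" "AE x in lborel. \<bar>m x\<bar> \<le> B"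
  shows "integrable lborel (\<lambda>x. m x * f x)"
proof (rule Bochner_Integration.integrable_bound[where f="\<lambda>x. B * f x"])
  show "AE x in lborel. norm (m x * f x) \<le> norm (B * f x)"
    using assms(3)
  proof eventually_elim
    case (elim x)
    then have "\<bar>m x\<bar> \<le> \<bar>B\<bar>" by simp
    then show ?case by (simp add: abs_mult mult_right_mono)
  qed
qed (use assms in auto)

text \<open>Mollifying \<open>u\<close> turns \<open>u \<psi>\<close> into an admissible test function for \<open>c\<close>; only the boundedness of \<open>c\<close>
  and of its weak derivative is needed to pass to the limit.\<close>

lemma has_weak_deriv_mult_real:
  fixes c u :: "'a::euclidean_space \<Rightarrow> real"
  assumes \<Omega>: "open \<Omega>" and i: "i \<in> Basis"
    and c: "c \<in> Linf_space (lebesgue_on \<Omega>)" and dc: "dc \<in> Linf_space (lebesgue_on \<Omega>)"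
    and wc: "has_weak_deriv \<Omega> i c dc" and wu: "has_weak_deriv \<Omega> i u du"
  shows "has_weak_deriv \<Omega> i (\<lambda>x. c x * u x) (\<lambda>x. c x * du x + dc x * u x)"
  unfolding has_weak_deriv_def
proof (intro conjI ballI)
  have loc: "loc_integrable \<Omega> u" "loc_integrable \<Omega> du" "loc_integrable \<Omega> c" "loc_integrable \<Omega> dc"
    using wu wc by (auto simp: has_weak_deriv_def)
  show "loc_integrable \<Omega> (\<lambda>x. c x * u x)" "loc_integrable \<Omega> (\<lambda>x. c x * du x + dc x * u x)"
    using loc_integrable_Linf_mult[OF \<Omega> c loc(1)] loc_integrable_Linf_mult[OF \<Omega> c loc(2)]
      loc_integrable_Linf_mult[OF \<Omega> dc loc(1)] loc_integrable_add by fastforce+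
  fix \<psi> :: "'a \<Rightarrow> real" assume \<psi>: "\<psi> \<in> test_functions \<Omega>"
  define d\<psi> where "d\<psi> = (\<lambda>x. frechet_derivative \<psi> (at x) i)"
  obtain K where K: "smooth \<psi>" "compact K" "K \<subseteq> \<Omega>" "\<And>x. x \<notin> K \<Longrightarrow> \<psi> x = 0"
      "\<And>x. x \<notin> K \<Longrightarrow> frechet_derivative \<psi> (at x) = (\<lambda>h. 0)"
    using test_functionsE[OF \<psi>] by metis
  have d\<psi>0: "\<And>x. x \<notin> K \<Longrightarrow> d\<psi> x = 0" using K(5) by (simp add: d\<psi>_def)
  have sd: "smooth d\<psi>" unfolding d\<psi>_def by (rule smooth_partial[OF K(1) i])
  have meas[measurable]: "\<psi> \<in> borel_measurable borel" "d\<psi> \<in> borel_measurable borel"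
    using smooth_borel_measurable[OF K(1)] smooth_borel_measurable[OF sd] .
  obtain B1 where B1: "B1 \<ge> 0" "\<And>x. \<bar>\<psi> x\<bar> \<le> B1"
    using bounded_continuous_compact_support[OF smooth_continuous[OF K(1)] K(2,4)] by (metis real_norm_def)
  obtain B2 where B2: "B2 \<ge> 0" "\<And>x. \<bar>d\<psi> x\<bar> \<le> B2"
    using bounded_continuous_compact_support[OF smooth_continuous[OF sd] K(2) d\<psi>0] by (metis real_norm_def)
  \<comment> \<open>The mollified u on K averages values of u over a neighbourhood, so u and du are
    represented on the larger K'. The factors c and dc always meet \<psi> or its derivative and are
    represented on K.\<close>
  obtain \<delta> K' where K': "\<delta> > 0" "compact K'" "K \<subseteq> K'" "K' \<subseteq> \<Omega>" "\<And>x. x \<in> K \<Longrightarrow> cball x \<delta> \<subseteq> K'"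
    using compact_neighbourhood[OF K(2,3) \<Omega>] by metis
  obtain u0 du0 where rep': "borel_rep K' u u0" "borel_rep K' du du0"
    using loc_integrable_borel_rep[OF _ K'(2,4)] loc by metis
  obtain c0 dc0 where rep: "borel_rep K c c0" "borel_rep K dc dc0"
    using loc_integrable_borel_rep[OF _ K(2,3)] loc by metis
  obtain C where C: "C \<ge> 0" "AE x in lborel. \<bar>c0 x\<bar> \<le> C" by (rule borel_rep_Linf_bounded[OF \<Omega> K(3) c rep(1)])
  obtain C' where C': "C' \<ge> 0" "AE x in lborel. \<bar>dc0 x\<bar> \<le> C'" by (rule borel_rep_Linf_bounded[OF \<Omega> K(3) dc rep(2)])
  have int: "integrable lborel u0" "integrable lborel du0" using rep' by (auto simp: borel_rep_def)
  have [measurable]: "u0 \<in> borel_measurable borel" "du0 \<in> borel_measurable borel"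
     "c0 \<in> borel_measurable borel" "dc0 \<in> borel_measurable borel"
    using rep rep' borel_rep_measurable by blast+
  have b1: "AE x in lborel. \<bar>d\<psi> x * c0 x\<bar> \<le> B2 * C"
    using C(2) by eventually_elim (use B2 C(1) in \<open>auto simp: abs_mult intro!: mult_mono\<close>)
  have b2: "AE x in lborel. \<bar>\<psi> x * c0 x\<bar> \<le> B1 * C"
    using C(2) by eventually_elim (use B1 C(1) in \<open>auto simp: abs_mult intro!: mult_mono\<close>)
  have b3: "AE x in lborel. \<bar>\<psi> x * dc0 x\<bar> \<le> B1 * C'"
    using C'(2) by eventually_elim (use B1 C'(1) in \<open>auto simp: abs_mult intro!: mult_mono\<close>)
  \<comment> \<open>The weak derivative of c is tested with the mollified u times \<psi>. On K the
    derivative of the mollified u is the mollified du; off K the factor \<psi> and its derivative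
    vanish.\<close>
  have eq: "(\<integral>x. conv (mol n) u0 x * (d\<psi> x * c0 x) \<partial>lborel) + (\<integral>x. conv (mol n) du0 x * (\<psi> x * c0 x) \<partial>lborel)
      = - (\<integral>x. conv (mol n) u0 x * (\<psi> x * dc0 x) \<partial>lborel)" if n: "1 / (real n + 1) < \<delta>" for n
  proof -
    let ?z = "conv (mol n) u0" and ?dz = "conv (mol n) du0"
    have sz: "smooth ?z" by (rule smooth_conv_mol[OF int(1)])
    let ?\<phi> = "\<lambda>x. ?z x * \<psi> x"
    have \<phi>: "?\<phi> \<in> test_functions \<Omega>" by (rule test_functions_mult[OF \<psi> sz])
    have d\<phi>: "frechet_derivative ?\<phi> (at x) i = ?z x * d\<psi> x + ?dz x * \<psi> x" for x
    proof (cases "x \<in> K")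
      case True
      have "cball x (1 / (real n + 1)) \<subseteq> K'" using K'(5)[OF True] n subset_cball[of "1 / (real n + 1)" \<delta> x] by auto
      then have "frechet_derivative ?z (at x) i = ?dz x"
        by (intro frechet_derivative_conv_weak[OF \<Omega> wu i K'(2,4) rep']) auto
      then show ?thesis by (simp add: frechet_derivative_mult[OF K(1) sz] d\<psi>_def)
    next
      case False
      then show ?thesis by (simp add: frechet_derivative_mult[OF K(1) sz] K(4,5) d\<psi>_def)
    qed
    have ci: "integrable lborel ?z" "integrable lborel ?dz" using int by (auto intro!: integrable_conv)
    have [measurable]: "?z \<in> borel_measurable borel" "?dz \<in> borel_measurable borel" using ci by auto
    have "(\<integral>x. (?z x * d\<psi> x + ?dz x * \<psi> x) * c0 x \<partial>lborel) = (\<integral>x. (?z x * d\<psi> x + ?dz x * \<psi> x) * c x \<partial>lebesgue_on \<Omega>)"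
      by (rule integral_borel_rep[OF \<Omega> K(3) rep(1), symmetric]) (use K(4) d\<psi>0 in auto)
    also have "\<dots> = - (\<integral>x. ?\<phi> x * dc x \<partial>lebesgue_on \<Omega>)"
      using has_weak_derivD[OF wc \<phi>] by (simp only: d\<phi>)
    also have "(\<integral>x. ?\<phi> x * dc x \<partial>lebesgue_on \<Omega>) = (\<integral>x. ?\<phi> x * dc0 x \<partial>lborel)"
      by (rule integral_borel_rep[OF \<Omega> K(3) rep(2)]) (use K(4) in auto)
    finally have e: "(\<integral>x. (?z x * d\<psi> x + ?dz x * \<psi> x) * c0 x \<partial>lborel) = - (\<integral>x. ?\<phi> x * dc0 x \<partial>lborel)" .
    have "(\<integral>x. (?z x * d\<psi> x + ?dz x * \<psi> x) * c0 x \<partial>lborel) =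
        (\<integral>x. (d\<psi> x * c0 x) * ?z x + (\<psi> x * c0 x) * ?dz x \<partial>lborel)"
      by (simp add: algebra_simps)
    also have "\<dots> = (\<integral>x. (d\<psi> x * c0 x) * ?z x \<partial>lborel) + (\<integral>x. (\<psi> x * c0 x) * ?dz x \<partial>lborel)"
      by (intro Bochner_Integration.integral_add integrable_AE_bounded_mult[OF ci(1) _ b1] integrable_AE_bounded_mult[OF ci(2) _ b2]) auto
    finally show ?thesis using e by (simp add: mult_ac)
  qed
  have ev: "eventually (\<lambda>n. (\<integral>x. conv (mol n) u0 x * (d\<psi> x * c0 x) \<partial>lborel) + (\<integral>x. conv (mol n) du0 x * (\<psi> x * c0 x) \<partial>lborel)
      = - (\<integral>x. conv (mol n) u0 x * (\<psi> x * dc0 x) \<partial>lborel)) sequentially"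
    using eventually_mol_radius[OF K'(1)] by (rule eventually_mono) (rule eq)
  have l1: "(\<lambda>n. (\<integral>x. conv (mol n) u0 x * (d\<psi> x * c0 x) \<partial>lborel) + (\<integral>x. conv (mol n) du0 x * (\<psi> x * c0 x) \<partial>lborel))
     \<longlonglongrightarrow> (\<integral>x. u0 x * (d\<psi> x * c0 x) \<partial>lborel) + (\<integral>x. du0 x * (\<psi> x * c0 x) \<partial>lborel)"
    by (intro tendsto_add conv_mol_mult_tendsto[OF int(1) _ b1] conv_mol_mult_tendsto[OF int(2) _ b2]) auto
  have l2: "(\<lambda>n. - (\<integral>x. conv (mol n) u0 x * (\<psi> x * dc0 x) \<partial>lborel)) \<longlonglongrightarrow> - (\<integral>x. u0 x * (\<psi> x * dc0 x) \<partial>lborel)"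
    by (intro tendsto_minus conv_mol_mult_tendsto[OF int(1) _ b3]) auto
  have lim: "(\<integral>x. u0 x * (d\<psi> x * c0 x) \<partial>lborel) + (\<integral>x. du0 x * (\<psi> x * c0 x) \<partial>lborel) = - (\<integral>x. u0 x * (\<psi> x * dc0 x) \<partial>lborel)"
    using LIMSEQ_unique[OF Lim_transform_eventually[OF l1 ev] l2] .
  have aeK: "AE x in lborel. x \<in> K' \<longrightarrow> u x = u0 x" "AE x in lborel. x \<in> K' \<longrightarrow> du x = du0 x"
    "AE x in lborel. x \<in> K \<longrightarrow> c x = c0 x" "AE x in lborel. x \<in> K \<longrightarrow> dc x = dc0 x"
    using rep rep' by (auto simp: borel_rep_def)
  have z: "\<And>x. x \<notin> K \<Longrightarrow> c0 x = 0" "\<And>x. x \<notin> K \<Longrightarrow> dc0 x = 0" using rep by (auto simp: borel_rep_def)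
  have icu: "integrable lborel (\<lambda>x. c0 x * u0 x)" "integrable lborel (\<lambda>x. c0 x * du0 x)" "integrable lborel (\<lambda>x. dc0 x * u0 x)"
    using integrable_AE_bounded_mult[OF int(1) _ C(2)] integrable_AE_bounded_mult[OF int(2) _ C(2)]
      integrable_AE_bounded_mult[OF int(1) _ C'(2)] by auto
  have r1: "borel_rep K (\<lambda>x. c x * u x) (\<lambda>x. c0 x * u0 x)"
    unfolding borel_rep_def
  proof (intro conjI)
    show "AE x in lborel. x \<in> K \<longrightarrow> c x * u x = c0 x * u0 x"
      using aeK(1,3) by eventually_elim (use K'(3) in auto)
  qed (use icu z in auto)
  have r2: "borel_rep K (\<lambda>x. c x * du x + dc x * u x) (\<lambda>x. c0 x * du0 x + dc0 x * u0 x)"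
    unfolding borel_rep_def
  proof (intro conjI)
    show "AE x in lborel. x \<in> K \<longrightarrow> c x * du x + dc x * u x = c0 x * du0 x + dc0 x * u0 x"
      using aeK by eventually_elim (use K'(3) in auto)
  qed (use icu z in auto)
  have "(\<integral>x. d\<psi> x * (c x * u x) \<partial>lebesgue_on \<Omega>) = (\<integral>x. d\<psi> x * (c0 x * u0 x) \<partial>lborel)"
    by (rule integral_borel_rep[OF \<Omega> K(3) r1 subset_refl meas(2) d\<psi>0])
  also have "\<dots> = - (\<integral>x. u0 x * (\<psi> x * dc0 x) \<partial>lborel) - (\<integral>x. du0 x * (\<psi> x * c0 x) \<partial>lborel)"
    using lim by (simp add: mult_ac)
  also have "\<dots> = - ((\<integral>x. (\<psi> x * c0 x) * du0 x \<partial>lborel) + (\<integral>x. (\<psi> x * dc0 x) * u0 x \<partial>lborel))"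
    by (simp add: mult_ac)
  also have "(\<integral>x. (\<psi> x * c0 x) * du0 x \<partial>lborel) + (\<integral>x. (\<psi> x * dc0 x) * u0 x \<partial>lborel) =
      (\<integral>x. (\<psi> x * c0 x) * du0 x + (\<psi> x * dc0 x) * u0 x \<partial>lborel)"
    by (intro Bochner_Integration.integral_add[symmetric] integrable_AE_bounded_mult[OF int(1) _ b3] integrable_AE_bounded_mult[OF int(2) _ b2]) auto
  also have "\<dots> = (\<integral>x. \<psi> x * (c0 x * du0 x + dc0 x * u0 x) \<partial>lborel)" by (simp add: algebra_simps)
  also have "\<dots> = (\<integral>x. \<psi> x * (c x * du x + dc x * u x) \<partial>lebesgue_on \<Omega>)"
    by (rule integral_borel_rep[OF \<Omega> K(3) r2 subset_refl meas(1) K(4), symmetric])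
  finally show "(\<integral>x. frechet_derivative \<psi> (at x) i *\<^sub>R (c x * u x) \<partial>lebesgue_on \<Omega>) =
      - (\<integral>x. \<psi> x *\<^sub>R (c x * du x + dc x * u x) \<partial>lebesgue_on \<Omega>)"
    by (simp add: d\<psi>_def)
qed

lemma has_weak_deriv_scaleR:
  fixes c :: "'a::euclidean_space \<Rightarrow> real" and u :: "'a \<Rightarrow> 'b::euclidean_space"
  assumes \<Omega>: "open \<Omega>" and i: "i \<in> Basis"
    and c: "c \<in> Linf_space (lebesgue_on \<Omega>)" and dc: "dc \<in> Linf_space (lebesgue_on \<Omega>)"
    and wc: "has_weak_deriv \<Omega> i c dc" and wu: "has_weak_deriv \<Omega> i u du"
  shows "has_weak_deriv \<Omega> i (\<lambda>x. c x *\<^sub>R u x) (\<lambda>x. c x *\<^sub>R du x + dc x *\<^sub>R u x)"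
  by (rule has_weak_deriv_componentwise[OF \<Omega> i])
    (use has_weak_deriv_mult_real[OF \<Omega> i c dc wc has_weak_deriv_inner[OF \<Omega> wu i]] in \<open>simp add: inner_add_left\<close>)

lemma loc_integrable_continuous:
  fixes f :: "'a::euclidean_space \<Rightarrow> 'b::euclidean_space"
  assumes "continuous_on \<Omega> f"
  shows "loc_integrable \<Omega> f"
  unfolding loc_integrable_def set_integrable_def
proof (intro allI impI)
  fix K assume K: "compact K" "K \<subseteq> \<Omega>"
  have i: "integrable lborel (\<lambda>x. indicator K x *\<^sub>R f x)"
    using borel_integrable_compact[OF K(1)] assms K(2) continuous_on_subset by blast
  then show "integrable lebesgue (\<lambda>x. indicator K x *\<^sub>R f x)"
    by (subst integrable_completion) auto
qed

lemma loc_integrable_continuous_mult: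
  fixes c :: "'a::euclidean_space \<Rightarrow> real" and f :: "'a \<Rightarrow> 'b::euclidean_space"
  assumes c: "continuous_on \<Omega> c" and f: "loc_integrable \<Omega> f"
  shows "loc_integrable \<Omega> (\<lambda>x. c x *\<^sub>R f x)"
  unfolding loc_integrable_def set_integrable_def
proof (intro allI impI)
  fix K assume K: "compact K" "K \<subseteq> \<Omega>"
  then have i: "integrable lebesgue (\<lambda>x. indicator K x *\<^sub>R f x)"
    using f unfolding loc_integrable_def set_integrable_def by blast
  have cK: "continuous_on K c" using c K continuous_on_subset by blast
  have "bounded (c ` K)" by (intro compact_imp_bounded compact_continuous_image cK K)
  then obtain B where B: "\<And>x. x \<in> K \<Longrightarrow> norm (c x) \<le> B" by (auto simp: bounded_iff)
  have "(\<lambda>x. indicator K x *\<^sub>R c x) \<in> borel_measurable borel"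
    by (rule borel_measurable_continuous_on_indicator[OF borel_compact[OF K(1)] cK])
  then have m: "(\<lambda>x. indicator K x *\<^sub>R c x) \<in> borel_measurable lebesgue" by (simp add: measurable_completion)
  have "integrable lebesgue (\<lambda>x. (indicator K x *\<^sub>R c x) *\<^sub>R (indicator K x *\<^sub>R f x))"
  proof (rule Bochner_Integration.integrable_bound[where f="\<lambda>x. B *\<^sub>R (indicator K x *\<^sub>R f x)"])
    have "norm ((indicator K x *\<^sub>R c x) *\<^sub>R (indicator K x *\<^sub>R f x)) \<le> norm (B *\<^sub>R (indicator K x *\<^sub>R f x))" for x
    proof (cases "x \<in> K")
      case True
      then have "\<bar>c x\<bar> \<le> \<bar>B\<bar>" using B[OF True] by simp
      then show ?thesis using True by (auto simp: abs_mult intro!: mult_right_mono)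
    qed simp
    then show "AE x in lebesgue. norm ((indicator K x *\<^sub>R c x) *\<^sub>R (indicator K x *\<^sub>R f x)) \<le> norm (B *\<^sub>R (indicator K x *\<^sub>R f x))"
      by (rule AE_I2)
    show "integrable lebesgue (\<lambda>x. B *\<^sub>R (indicator K x *\<^sub>R f x))" by (intro integrable_scaleR_right i)
    show "(\<lambda>x. (indicator K x *\<^sub>R c x) *\<^sub>R (indicator K x *\<^sub>R f x)) \<in> borel_measurable lebesgue"
      by (intro borel_measurable_scaleR m borel_measurable_integrable[OF i])
  qed
  also have "(\<lambda>x. (indicator K x *\<^sub>R c x) *\<^sub>R (indicator K x *\<^sub>R f x)) = (\<lambda>x. indicator K x *\<^sub>R (c x *\<^sub>R f x))"
    by (auto simp: indicator_def fun_eq_iff)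
  finally show "integrable lebesgue (\<lambda>x. indicator K x *\<^sub>R (c x *\<^sub>R f x))" .
qed

text \<open>The classical chain rule holds for the mollified f and is integrated against \<psi>. In
  the limit the outer functions converge pointwise, since f is continuous, and stay bounded, while
  the mollified g converges in L1.\<close>

lemma has_weak_deriv_chain:
  fixes f g :: "'a::euclidean_space \<Rightarrow> real" and F F' :: "real \<Rightarrow> real"
  assumes \<Omega>: "open \<Omega>" and i: "i \<in> Basis" and wd: "has_weak_deriv \<Omega> i f g"
    and cf: "continuous_on \<Omega> f" and range: "\<And>x. x \<in> \<Omega> \<Longrightarrow> f x \<in> {l..u}"
    and F: "\<And>t. t \<in> {l..u} \<Longrightarrow> (F has_real_derivative F' t) (at t)" and cF': "continuous_on {l..u} F'"
  shows "has_weak_deriv \<Omega> i (\<lambda>x. F (f x)) (\<lambda>x. F' (f x) * g x)"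
  unfolding has_weak_deriv_def
proof (intro conjI ballI)
  have cF: "continuous_on {l..u} F"
    using F by (intro continuous_at_imp_continuous_on ballI) (blast intro: DERIV_isCont)
  have cFf: "continuous_on \<Omega> (\<lambda>x. F (f x))" "continuous_on \<Omega> (\<lambda>x. F' (f x))"
    using range by (intro continuous_on_compose2[OF cF cf] continuous_on_compose2[OF cF' cf]; blast)+
  have loc: "loc_integrable \<Omega> g" using wd by (auto simp: has_weak_deriv_def)
  show "loc_integrable \<Omega> (\<lambda>x. F (f x))" by (rule loc_integrable_continuous[OF cFf(1)])
  show "loc_integrable \<Omega> (\<lambda>x. F' (f x) * g x)"
    using loc_integrable_continuous_mult[OF cFf(2) loc] by simp
  fix \<psi> :: "'a \<Rightarrow> real" assume \<psi>: "\<psi> \<in> test_functions \<Omega>"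
  define d\<psi> where "d\<psi> = (\<lambda>x. frechet_derivative \<psi> (at x) i)"
  obtain K where K: "smooth \<psi>" "compact K" "K \<subseteq> \<Omega>" "\<And>x. x \<notin> K \<Longrightarrow> \<psi> x = 0"
      "\<And>x. x \<notin> K \<Longrightarrow> frechet_derivative \<psi> (at x) = (\<lambda>h. 0)"
    using test_functionsE[OF \<psi>] by metis
  have d\<psi>0: "\<And>x. x \<notin> K \<Longrightarrow> d\<psi> x = 0" using K(5) by (simp add: d\<psi>_def)
  have sd: "smooth d\<psi>" unfolding d\<psi>_def by (rule smooth_partial[OF K(1) i])
  have meas[measurable]: "\<psi> \<in> borel_measurable borel" "d\<psi> \<in> borel_measurable borel" "K \<in> sets borel"
    using smooth_borel_measurable[OF K(1)] smooth_borel_measurable[OF sd] borel_compact[OF K(2)] .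
  obtain B1 where B1: "B1 \<ge> 0" "\<And>x. \<bar>\<psi> x\<bar> \<le> B1"
    using bounded_continuous_compact_support[OF smooth_continuous[OF K(1)] K(2,4)] by (metis real_norm_def)
  obtain B2 where B2: "B2 \<ge> 0" "\<And>x. \<bar>d\<psi> x\<bar> \<le> B2"
    using bounded_continuous_compact_support[OF smooth_continuous[OF sd] K(2) d\<psi>0] by (metis real_norm_def)
  obtain BF where BF: "\<And>t. t \<in> {l..u} \<Longrightarrow> \<bar>F t\<bar> \<le> BF"
    using compact_imp_bounded[OF compact_continuous_image[OF cF compact_Icc]]
    unfolding bounded_iff by (metis image_eqI real_norm_def)
  obtain BF' where BF': "\<And>t. t \<in> {l..u} \<Longrightarrow> \<bar>F' t\<bar> \<le> BF'"
    using compact_imp_bounded[OF compact_continuous_image[OF cF' compact_Icc]]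
    unfolding bounded_iff by (metis image_eqI real_norm_def)
  obtain \<delta> K' where K': "\<delta> > 0" "compact K'" "K \<subseteq> K'" "K' \<subseteq> \<Omega>" "\<And>x. x \<in> K \<Longrightarrow> cball x \<delta> \<subseteq> K'"
    using compact_neighbourhood[OF K(2,3) \<Omega>] by metis
  define f0 where "f0 = (\<lambda>x. indicator K' x * f x)"
  have repf: "borel_rep K' f f0"
    unfolding borel_rep_def
  proof (intro conjI allI impI)
    show "integrable lborel f0"
      using borel_integrable_compact[OF K'(2), of f] continuous_on_subset[OF cf K'(4)] by (simp add: f0_def)
  qed (auto simp: f0_def)
  obtain g0 where repg: "borel_rep K' g g0"
    using loc_integrable_borel_rep[OF loc K'(2,4)] by metis
  have int: "integrable lborel f0" "integrable lborel g0" using repf repg by (auto simp: borel_rep_def)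
  have [measurable]: "f0 \<in> borel_measurable borel" "g0 \<in> borel_measurable borel"
    using repf repg borel_rep_measurable by blast+
  let ?f = "\<lambda>n. conv (mol n) f0" and ?g = "\<lambda>n. conv (mol n) g0"
  have sm: "smooth (?f n)" "smooth (?g n)" for n using smooth_conv_mol int by blast+
  have [measurable]: "?f n \<in> borel_measurable borel" "?g n \<in> borel_measurable borel" for n
    using smooth_borel_measurable[OF sm(1)] smooth_borel_measurable[OF sm(2)] .
  have ig: "integrable lborel (?g n)" for n using int by (auto intro!: integrable_conv)
  have f0eq: "f0 y = f y" if "x \<in> K" "dist x y \<le> \<delta>" for x y
    using K'(5)[OF that(1)] that(2) by (auto simp: f0_def indicator_def)
  \<comment> \<open>F is controlled on {l..u} only; an average of values in an interval cannot leave
    it.\<close>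
  have inI: "?f n x \<in> {l..u}" if n: "1 / (real n + 1) < \<delta>" and x: "x \<in> K" for n x
  proof -
    have "l \<le> f0 y \<and> f0 y \<le> u" if "dist x y < 1 / (real n + 1)" for y
    proof -
      have d: "dist x y \<le> \<delta>" using that n by linarith
      then have "y \<in> \<Omega>" using K'(4) K'(5)[OF x] by auto
      then show ?thesis using f0eq[OF x d] range[of y] by simp
    qed
    then show ?thesis using conv_mollifier_between[OF _ int(1), of "1 / (real n + 1)" x l u] by auto
  qed
  have ptw: "(\<lambda>n. ?f n x) \<longlonglongrightarrow> f x" if x: "x \<in> K" for x
  proof -
    have "isCont f x" using cf \<Omega> x K(3) continuous_on_eq_continuous_at by blast
    moreover have "eventually (\<lambda>y. f y = f0 y) (nhds x)"
      by (rule eventually_nhds_metric[THEN iffD2]) (use K'(1) f0eq[OF x] in \<open>auto simp: dist_commute intro!: exI[of _ \<delta>]\<close>)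
    ultimately have "isCont f0 x" using isCont_cong by blast
    from conv_mol_pointwise[OF int(1) this] show ?thesis using f0eq[OF x, of x] K'(1) by simp
  qed
  obtain N where N: "\<And>n. 1 / (real (n + N) + 1) < \<delta>"
    using eventually_mol_radius[OF K'(1)] unfolding eventually_sequentially by (metis le_add2)
  \<comment> \<open>Off K, where \<psi> vanishes, the argument is set to l so that the bounds on F
    and F' over {l..u} hold at every point. The shift by N makes the mollification radius small
    enough for all n.\<close>
  define f1 where "f1 n x = (if x \<in> K then ?f (n + N) x else l)" for n x
  define g1 where "g1 n = ?g (n + N)" for n
  define fl where "fl x = (if x \<in> K then f x else l)" for x
  have lu: "K \<noteq> {} \<Longrightarrow> l \<le> u" using range K(3) by fastforce
  have eq: "(\<integral>x. F' (f1 n x) * g1 n x * \<psi> x + F (f1 n x) * d\<psi> x \<partial>lborel) = 0"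
    and ieq: "integrable lborel (\<lambda>x. F' (f1 n x) * g1 n x * \<psi> x + F (f1 n x) * d\<psi> x)" for n
  proof -
    define m where "m = n + N"
    have m: "1 / (real m + 1) < \<delta>" using N by (simp add: m_def)
    \<comment> \<open>This is the total derivative of \<psi> times F of the mollified f. Off K the
      mollified f may leave the interval, but there the product is identically zero on an open
      set.\<close>
    define D where "D x h = (if x \<in> K then F (?f m x) * frechet_derivative \<psi> (at x) h +
        (F' (?f m x) * frechet_derivative (?f m) (at x) h) * \<psi> x else 0)" for x h
    have DD: "((\<lambda>x. F (?f m x) * \<psi> x) has_derivative D x) (at x)" for x
    proof (cases "x \<in> K")
      case True
      have "((\<lambda>x. F (?f m x)) has_derivative (\<lambda>h. F' (?f m x) * frechet_derivative (?f m) (at x) h)) (at x)"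
        using DERIV_compose_FDERIV[OF F[OF inI[OF m True]] smooth_has_derivative[OF sm(1)]]
        by (simp add: mult.commute)
      from has_derivative_mult[OF this smooth_has_derivative[OF K(1)]] show ?thesis using True by (simp add: D_def[abs_def])
    next
      case False
      have "((\<lambda>x. F (?f m x) * \<psi> x) has_derivative (\<lambda>h. 0)) (at x)"
        by (rule has_derivative_zero_outside_closed[OF compact_imp_closed[OF K(2)] _ False]) (simp add: K(4))
      then show ?thesis using False by (simp add: D_def[abs_def])
    qed
    have Di: "D x i = F' (f1 n x) * g1 n x * \<psi> x + F (f1 n x) * d\<psi> x" for x
    proof (cases "x \<in> K")
      case True
      have "cball x (1 / (real m + 1)) \<subseteq> K'" using K'(5)[OF True] m subset_cball[of "1 / (real m + 1)" \<delta> x] by auto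
      then have "frechet_derivative (?f m) (at x) i = ?g m x"
        by (intro frechet_derivative_conv_weak[OF \<Omega> wd i K'(2,4) repf repg]) auto
      then show ?thesis using True by (simp add: D_def f1_def g1_def m_def d\<psi>_def)
    next
      case False
      then show ?thesis by (simp add: D_def K(4) d\<psi>0)
    qed
    have "\<exists>B. \<forall>x. \<bar>D x i\<bar> \<le> B"
    proof -
      have fK: "?f m ` K \<subseteq> {l..u}" using inI[OF m] by blast
      have "continuous_on K (\<lambda>x. F' (?f m x) * ?g m x * \<psi> x + F (?f m x) * d\<psi> x)"
        by (intro continuous_intros continuous_on_compose2[OF cF' _ fK] continuous_on_compose2[OF cF _ fK] smooth_continuous[OF sm(1)]
            smooth_continuous[OF sm(2)] smooth_continuous[OF K(1)] smooth_continuous[OF sd])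
      from compact_imp_bounded[OF compact_continuous_image[OF this K(2)]]
      obtain B where B: "\<And>x. x \<in> K \<Longrightarrow> \<bar>F' (?f m x) * ?g m x * \<psi> x + F (?f m x) * d\<psi> x\<bar> \<le> B"
        by (auto simp: bounded_iff)
      have "\<bar>D x i\<bar> \<le> max B 0" for x
      proof (cases "x \<in> K")
        case True
        then show ?thesis using B[OF True] by (simp add: Di f1_def g1_def m_def le_max_iff_disj)
      next
        case False
        then show ?thesis by (simp add: D_def)
      qed
      then show ?thesis by blast
    qed
    then obtain B where "\<And>x. \<bar>D x i\<bar> \<le> B" by blast
    from integral_partial_derivative_eq_0[OF DD K(2) _ this i] K(4)
    show "(\<integral>x. F' (f1 n x) * g1 n x * \<psi> x + F (f1 n x) * d\<psi> x \<partial>lborel) = 0"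
      "integrable lborel (\<lambda>x. F' (f1 n x) * g1 n x * \<psi> x + F (f1 n x) * d\<psi> x)"
      by (simp_all add: Di)
  qed
  have f1m[measurable]: "f1 n \<in> borel_measurable borel" for n unfolding f1_def by measurable
  have flm[measurable]: "fl \<in> borel_measurable borel"
  proof -
    have "(\<lambda>x. if x \<in> K then f0 x else l) \<in> borel_measurable borel" by measurable
    also have "(\<lambda>x. if x \<in> K then f0 x else l) = fl" using K'(3) by (auto simp: fl_def f0_def indicator_def fun_eq_iff)
    finally show ?thesis .
  qed
  have g1m[measurable]: "g1 n \<in> borel_measurable borel" for n unfolding g1_def by measurable
  show "(\<integral>x. frechet_derivative \<psi> (at x) i *\<^sub>R F (f x) \<partial>lebesgue_on \<Omega>) =
      - (\<integral>x. \<psi> x *\<^sub>R (F' (f x) * g x) \<partial>lebesgue_on \<Omega>)"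
  \<comment> \<open>A nonempty K guarantees l \<le> u. If K is empty, \<psi> is zero and both sides
    vanish.\<close>
  proof (cases "K = {}")
    case True
    then have "\<psi> x = 0" "d\<psi> x = 0" for x using K(4) d\<psi>0 by auto
    then show ?thesis by (simp add: d\<psi>_def)
  next
    case ne: False
    have lu': "l \<in> {l..u}" using lu[OF ne] by simp
    have f1I: "f1 n x \<in> {l..u}" for n x using inI[OF N] lu' by (simp add: f1_def)
    have flI: "fl x \<in> {l..u}" for x using range K(3) lu' by (auto simp: fl_def)
    have lim1: "(\<lambda>n. f1 n x) \<longlonglongrightarrow> fl x" for x
      using LIMSEQ_ignore_initial_segment[OF ptw, of x N] by (cases "x \<in> K") (auto simp: f1_def fl_def)
    have limF: "(\<lambda>n. F (f1 n x)) \<longlonglongrightarrow> F (fl x)" "(\<lambda>n. F' (f1 n x)) \<longlonglongrightarrow> F' (fl x)" for x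
      using continuous_on_tendsto_compose[OF cF lim1 flI] continuous_on_tendsto_compose[OF cF' lim1 flI] f1I
      by (auto intro: always_eventually)
    \<comment> \<open>Nothing is known about F and F' off {l..u}, not even measurability. Clipping
      the argument to the interval gives continuous functions on the line with the same values where
      they are used.\<close>
    have Fext: "(\<lambda>x. F (max l (min u x))) \<in> borel_measurable borel" "(\<lambda>x. F' (max l (min u x))) \<in> borel_measurable borel"
      by (rule borel_measurable_continuous_onI, rule continuous_on_compose2[OF cF], use lu[OF ne] in \<open>auto intro!: continuous_intros\<close>)
        (rule borel_measurable_continuous_onI, rule continuous_on_compose2[OF cF'], use lu[OF ne] in \<open>auto intro!: continuous_intros\<close>)
    have clip: "max l (min u t) = t" if "t \<in> {l..u}" for t using that by auto
    have mF: "(\<lambda>x. F (h x)) \<in> borel_measurable borel" "(\<lambda>x. F' (h x)) \<in> borel_measurable borel"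
      if "h \<in> borel_measurable borel" "\<And>x. h x \<in> {l..u}" for h :: "'a \<Rightarrow> real"
      using measurable_compose[OF that(1) Fext(1)] measurable_compose[OF that(1) Fext(2)] by (simp_all add: clip[OF that(2)])
    have [measurable]: "(\<lambda>x. F (f1 n x)) \<in> borel_measurable borel" "(\<lambda>x. F' (f1 n x)) \<in> borel_measurable borel" for n
      using mF[OF f1m f1I] by auto
    have [measurable]: "(\<lambda>x. F (fl x)) \<in> borel_measurable borel" "(\<lambda>x. F' (fl x)) \<in> borel_measurable borel"
      using mF[OF flm flI] by auto
    have id: "integrable lborel (\<lambda>x. \<bar>d\<psi> x\<bar>)"
      using integrable_continuous_compact_support[OF smooth_continuous[OF sd] K(2) d\<psi>0] by simp
    have L1: "(\<lambda>n. \<integral>x. F (f1 n x) * d\<psi> x \<partial>lborel) \<longlonglongrightarrow> (\<integral>x. F (fl x) * d\<psi> x \<partial>lborel)"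
      by (rule integral_dominated_convergence[where w="\<lambda>x. BF * \<bar>d\<psi> x\<bar>"])
        (use id in \<open>auto simp: abs_mult intro!: AE_I2 tendsto_intros limF mult_right_mono BF[OF f1I]\<close>)
    have BF0: "BF' \<ge> 0" using order_trans[OF abs_ge_zero BF'[OF lu']] .
    have bd: "\<bar>F' (f1 n x) * \<psi> x\<bar> \<le> BF' * B1" for n x
      unfolding abs_mult by (intro mult_mono BF'[OF f1I] B1 BF0) auto
    have L2: "(\<lambda>n. \<integral>x. F' (f1 n x) * \<psi> x * g0 x \<partial>lborel) \<longlonglongrightarrow> (\<integral>x. F' (fl x) * \<psi> x * g0 x \<partial>lborel)"
      by (rule integral_dominated_convergence[where w="\<lambda>x. BF' * B1 * \<bar>g0 x\<bar>"])
        (use int in \<open>auto simp: abs_mult[of _ "g0 _"] intro!: AE_I2 tendsto_intros limF mult_right_mono bd\<close>)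
    have ib: "integrable lborel (\<lambda>x. F' (f1 n x) * \<psi> x * h x)" if "integrable lborel h" for n and h :: "'a \<Rightarrow> real"
      by (rule integrable_bounded_mult[OF that _ bd]) measurable
    have ig1: "integrable lborel (g1 n)" for n unfolding g1_def by (rule ig)
    \<comment> \<open>Two limits are separated: replacing the mollified g by g0 costs an L1 error
      times a uniform bound, after which dominated convergence applies with the fixed majorant from
      g0.\<close>
    have L3: "(\<lambda>n. (\<integral>x. F' (f1 n x) * \<psi> x * g1 n x \<partial>lborel) - (\<integral>x. F' (f1 n x) * \<psi> x * g0 x \<partial>lborel)) \<longlonglongrightarrow> 0"
    proof (rule Lim_null_comparison)
      show "(\<lambda>n. (BF' * B1) * (\<integral>x. \<bar>g1 n x - g0 x\<bar> \<partial>lborel)) \<longlonglongrightarrow> 0"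
        using tendsto_mult_left[OF LIMSEQ_ignore_initial_segment[OF conv_mol_L1[OF int(2)], of N], of "BF' * B1"]
        unfolding g1_def by simp
      show "eventually (\<lambda>n. norm ((\<integral>x. F' (f1 n x) * \<psi> x * g1 n x \<partial>lborel) - (\<integral>x. F' (f1 n x) * \<psi> x * g0 x \<partial>lborel)) \<le>
          (BF' * B1) * (\<integral>x. \<bar>g1 n x - g0 x\<bar> \<partial>lborel)) sequentially"
      proof (rule always_eventually, rule allI)
        fix n
        have "(\<integral>x. F' (f1 n x) * \<psi> x * g1 n x \<partial>lborel) - (\<integral>x. F' (f1 n x) * \<psi> x * g0 x \<partial>lborel) =
          (\<integral>x. F' (f1 n x) * \<psi> x * (g1 n x - g0 x) \<partial>lborel)"
          using ib[OF ig1] ib[OF int(2)] by (simp add: right_diff_distrib)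
        also have "norm \<dots> \<le> (\<integral>x. norm (F' (f1 n x) * \<psi> x * (g1 n x - g0 x)) \<partial>lborel)" by (rule integral_norm_bound)
        also have "\<dots> \<le> (\<integral>x. (BF' * B1) * \<bar>g1 n x - g0 x\<bar> \<partial>lborel)"
        proof (rule integral_mono)
          show "integrable lborel (\<lambda>x. norm (F' (f1 n x) * \<psi> x * (g1 n x - g0 x)))"
            by (intro integrable_norm ib Bochner_Integration.integrable_diff ig1 int)
          show "integrable lborel (\<lambda>x. (BF' * B1) * \<bar>g1 n x - g0 x\<bar>)" using ig1 int by auto
          show "norm (F' (f1 n x) * \<psi> x * (g1 n x - g0 x)) \<le> (BF' * B1) * \<bar>g1 n x - g0 x\<bar>" for x
            unfolding real_norm_def abs_mult[of "F' _ * _"] by (rule mult_right_mono[OF bd]) simp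
        qed
        finally show "norm ((\<integral>x. F' (f1 n x) * \<psi> x * g1 n x \<partial>lborel) - (\<integral>x. F' (f1 n x) * \<psi> x * g0 x \<partial>lborel)) \<le>
          (BF' * B1) * (\<integral>x. \<bar>g1 n x - g0 x\<bar> \<partial>lborel)" by simp
      qed
    qed
    have L4: "(\<lambda>n. \<integral>x. F' (f1 n x) * \<psi> x * g1 n x \<partial>lborel) \<longlonglongrightarrow> (\<integral>x. F' (fl x) * \<psi> x * g0 x \<partial>lborel)"
      using tendsto_add[OF L3 L2] by simp
    have idF: "integrable lborel (\<lambda>x. F (f1 n x) * d\<psi> x)" for n
      by (rule integrable_bounded_mult[where B=BF]) (use integrable_continuous_compact_support[OF smooth_continuous[OF sd] K(2) d\<psi>0] BF[OF f1I] in auto)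
    have "(\<integral>x. F' (f1 n x) * \<psi> x * g1 n x \<partial>lborel) = - (\<integral>x. F (f1 n x) * d\<psi> x \<partial>lborel)" for n
    proof -
      have "0 = (\<integral>x. F' (f1 n x) * \<psi> x * g1 n x + F (f1 n x) * d\<psi> x \<partial>lborel)"
        using eq[of n] by (simp add: mult_ac)
      also have "\<dots> = (\<integral>x. F' (f1 n x) * \<psi> x * g1 n x \<partial>lborel) + (\<integral>x. F (f1 n x) * d\<psi> x \<partial>lborel)"
        by (rule Bochner_Integration.integral_add[OF ib[OF ig1] idF])
      finally show ?thesis by simp
    qed
    then have lim: "(\<integral>x. F' (fl x) * \<psi> x * g0 x \<partial>lborel) = - (\<integral>x. F (fl x) * d\<psi> x \<partial>lborel)"
      using LIMSEQ_unique[OF L4] tendsto_minus[OF L1] by simp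
    have "(\<integral>x. d\<psi> x * F (f x) \<partial>lebesgue_on \<Omega>) = (\<integral>x. F (fl x) * d\<psi> x \<partial>lborel)"
    proof (rule integral_lebesgue_on_transfer[OF \<Omega>])
      have "d\<psi> x * F (f x) = F (fl x) * d\<psi> x" for x using d\<psi>0 by (cases "x \<in> K") (auto simp: fl_def)
      then show "AE x in lborel. x \<in> \<Omega> \<longrightarrow> d\<psi> x * F (f x) = F (fl x) * d\<psi> x" by simp
    qed (use d\<psi>0 K(3) in auto)
    moreover have "(\<integral>x. \<psi> x * (F' (f x) * g x) \<partial>lebesgue_on \<Omega>) = (\<integral>x. F' (fl x) * \<psi> x * g0 x \<partial>lborel)"
    proof (rule integral_lebesgue_on_transfer[OF \<Omega>])
      have "AE x in lborel. x \<in> K' \<longrightarrow> g x = g0 x" using repg by (simp add: borel_rep_def)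
      then show "AE x in lborel. x \<in> \<Omega> \<longrightarrow> \<psi> x * (F' (f x) * g x) = F' (fl x) * \<psi> x * g0 x"
      proof eventually_elim
        case (elim x)
        then show ?case using K'(3) K(4) by (cases "x \<in> K") (auto simp: fl_def)
      qed
      show "F' (fl x) * \<psi> x * g0 x = 0" if "x \<notin> \<Omega>" for x using K(3,4) that by auto
    qed measurable
    ultimately show ?thesis using lim by (simp add: d\<psi>_def)
  qed
qed

section \<open>Sobolev spaces\<close>

lemma norm_add_sq_le: "(norm (x + y))\<^sup>2 \<le> 2 * (norm x)\<^sup>2 + 2 * (norm (y :: 'b::real_normed_vector))\<^sup>2"
proof -
  have "(norm (x + y))\<^sup>2 \<le> (norm x + norm y)\<^sup>2" by (intro power_mono norm_triangle_ineq) simp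
  also have "\<dots> \<le> 2 * (norm x)\<^sup>2 + 2 * (norm y)\<^sup>2"
    using sum_squares_bound[of "norm x" "norm y"] by (simp add: power2_sum)
  finally show ?thesis .
qed

lemma L2_spaceI:
  assumes "f \<in> borel_measurable M" "integrable M g" "AE x in M. (norm (f x))\<^sup>2 \<le> g x"
  shows "f \<in> L2_space M"
  unfolding L2_space_def
proof (intro CollectI conjI assms(1))
  show "integrable M (\<lambda>x. (norm (f x))\<^sup>2)"
    by (rule Bochner_Integration.integrable_bound[OF assms(2)])
      (use assms(1,3) in \<open>auto elim!: eventually_mono\<close>)
qed

lemma L2_spaceD:
  assumes "f \<in> L2_space M"
  shows "f \<in> borel_measurable M" "integrable M (\<lambda>x. (norm (f x))\<^sup>2)"
  using assms by (auto simp: L2_space_def)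

lemma L2_space_add:
  assumes "f \<in> L2_space M" "g \<in> L2_space M"
  shows "(\<lambda>x. f x + g x) \<in> L2_space M"
  by (rule L2_spaceI[where g="\<lambda>x. 2 * (norm (f x))\<^sup>2 + 2 * (norm (g x))\<^sup>2"])
    (use L2_spaceD[OF assms(1)] L2_spaceD[OF assms(2)] norm_add_sq_le in auto)

lemma L2_space_scaleR:
  assumes c: "c \<in> Linf_space M" and f: "f \<in> L2_space M"
  shows "(\<lambda>x. c x *\<^sub>R f x) \<in> L2_space M"
proof -
  obtain B where B: "AE x in M. norm (c x) \<le> B" using c by (auto simp: Linf_space_def)
  have "AE x in M. (norm (c x *\<^sub>R f x))\<^sup>2 \<le> B\<^sup>2 * (norm (f x))\<^sup>2"
    using B by eventually_elim (auto simp: power_mult_distrib abs_le_square_iff[symmetric] intro!: mult_right_mono)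
  then show ?thesis
    using L2_spaceD[OF f] c by (intro L2_spaceI[where g="\<lambda>x. B\<^sup>2 * (norm (f x))\<^sup>2"]) (auto simp: Linf_space_def)
qed

lemma L2_space_bounded_linear:
  assumes T: "bounded_linear T" and f: "f \<in> L2_space M"
  shows "(\<lambda>x. T (f x)) \<in> L2_space M"
proof -
  obtain B where B: "\<And>x. norm (T x) \<le> norm x * B" using bounded_linear.bounded[OF T] by blast
  have "(norm (T (f x)))\<^sup>2 \<le> B\<^sup>2 * (norm (f x))\<^sup>2" for x
    using power_mono[OF B[of "f x"], of 2] by (simp add: power_mult_distrib mult.commute)
  then show ?thesis
    using L2_spaceD[OF f] bounded_linear.linear[OF T]
    by (intro L2_spaceI[where g="\<lambda>x. B\<^sup>2 * (norm (f x))\<^sup>2"])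
      (auto intro!: borel_measurable_continuous_on[OF linear_continuous_on[OF T]])
qed

lemma Linf_spaceI:
  assumes "f \<in> borel_measurable M" "AE x in M. norm (f x) \<le> C"
  shows "f \<in> Linf_space M"
  using assms by (auto simp: Linf_space_def)

lemma Linf_space_add:
  assumes "f \<in> Linf_space M" "g \<in> Linf_space M"
  shows "(\<lambda>x. f x + g x) \<in> Linf_space M"
proof -
  obtain A B where "AE x in M. norm (f x) \<le> A" "AE x in M. norm (g x) \<le> B"
    using assms by (auto simp: Linf_space_def)
  then have "AE x in M. norm (f x + g x) \<le> A + B"
    by eventually_elim (rule norm_triangle_le, simp)
  then show ?thesis using assms by (intro Linf_spaceI) (auto simp: Linf_space_def)
qed

lemma Linf_space_mult:
  fixes f g :: "'a \<Rightarrow> real"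
  assumes "f \<in> Linf_space M" "g \<in> Linf_space M"
  shows "(\<lambda>x. f x * g x) \<in> Linf_space M"
proof -
  obtain A B where "AE x in M. norm (f x) \<le> A" "AE x in M. norm (g x) \<le> B"
    using assms by (auto simp: Linf_space_def)
  then have "AE x in M. norm (f x * g x) \<le> A * B"
    by eventually_elim (auto simp: abs_mult intro!: mult_mono)
  then show ?thesis using assms by (intro Linf_spaceI) (auto simp: Linf_space_def)
qed

lemma Linf_space_const: "(\<lambda>x. c) \<in> Linf_space M"
  by (rule Linf_spaceI[where C="norm c"]) auto

lemma Linf_space_sum:
  assumes "finite I" "\<And>i. i \<in> I \<Longrightarrow> f i \<in> Linf_space M"
  shows "(\<lambda>x. \<Sum>i\<in>I. f i x) \<in> Linf_space M"
  using assms by (induction I rule: finite_induct) (auto simp: Linf_space_const intro!: Linf_space_add)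

locale bounded_open =
  fixes \<Omega> :: "'a::euclidean_space set"
  assumes opn: "open \<Omega>" and bdd: "bounded \<Omega>" and nonempty: "\<Omega> \<noteq> {}"
begin

abbreviation L2 :: "('a \<Rightarrow> 'b::euclidean_space) set" where "L2 \<equiv> L2_space (lebesgue_on \<Omega>)"
abbreviation Linf :: "('a \<Rightarrow> real) set" where "Linf \<equiv> Linf_space (lebesgue_on \<Omega>)"

lemma finite_measure_Omega: "finite_measure (lebesgue_on \<Omega>)"
  by (rule finite_measure_lebesgue_on) (use opn bdd lmeasurable_open in blast)

lemma L2_cong_AE:
  fixes f g :: "'a \<Rightarrow> 'b::euclidean_space"
  assumes f: "f \<in> L2" and ae: "AE x in lebesgue_on \<Omega>. f x = g x"
  shows "g \<in> L2"
  by (rule L2_spaceI[OF measurable_lebesgue_on_cong_AE[OF opn L2_spaceD(1)[OF f] ae] L2_spaceD(2)[OF f]])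
    (use ae in \<open>auto elim: eventually_mono\<close>)

lemma Linf_cong_AE:
  assumes f: "f \<in> Linf" and ae: "AE x in lebesgue_on \<Omega>. f x = g x"
  shows "g \<in> Linf"
proof -
  obtain B where B: "AE x in lebesgue_on \<Omega>. norm (f x) \<le> B" using f by (auto simp: Linf_space_def)
  show ?thesis
  proof (rule Linf_spaceI[OF measurable_lebesgue_on_cong_AE[OF opn _ ae]])
    show "AE x in lebesgue_on \<Omega>. norm (g x) \<le> B" using B ae by eventually_elim simp
  qed (use f in \<open>auto simp: Linf_space_def\<close>)
qed

lemma Linf_imp_L2:
  assumes "f \<in> Linf" shows "f \<in> L2"
proof -
  interpret finite_measure "lebesgue_on \<Omega>" by (rule finite_measure_Omega)
  obtain B where "AE x in lebesgue_on \<Omega>. norm (f x) \<le> B" using assms by (auto simp: Linf_space_def)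
  then have "AE x in lebesgue_on \<Omega>. (norm (f x))\<^sup>2 \<le> B\<^sup>2"
    by eventually_elim (auto simp: abs_le_square_iff[symmetric])
  then show ?thesis using assms by (intro L2_spaceI[where g="\<lambda>x. B\<^sup>2"]) (auto simp: Linf_space_def)
qed

lemma continuous_closure_Linf:
  assumes "continuous_on (closure \<Omega>) c" shows "c \<in> Linf"
proof -
  have "compact (closure \<Omega>)" using bdd by (simp add: compact_closure)
  then have "bounded (c ` closure \<Omega>)" by (intro compact_imp_bounded compact_continuous_image assms)
  then obtain B where B: "\<And>x. x \<in> closure \<Omega> \<Longrightarrow> norm (c x) \<le> B" by (auto simp: bounded_iff)
  have "continuous_on \<Omega> c" using assms closure_subset continuous_on_subset by blast
  then have "c \<in> borel_measurable (lebesgue_on \<Omega>)"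
    using opn by (intro continuous_imp_measurable_on_sets_lebesgue) auto
  moreover have "AE x in lebesgue_on \<Omega>. norm (c x) \<le> B"
    using B closure_subset by (intro AE_I2) auto
  ultimately show ?thesis by (rule Linf_spaceI)
qed

text \<open>The derivatives are explicit arguments because \<open>weak_deriv\<close> picks an
  unspecified representative; Leibniz formulas can be computed with du and are compared with
  \<open>weak_deriv\<close> almost everywhere at the end.\<close>

definition H1_data :: "('a \<Rightarrow> 'b::euclidean_space) \<Rightarrow> ('a \<Rightarrow> 'a \<Rightarrow> 'b) \<Rightarrow> bool" where
  "H1_data u du \<longleftrightarrow> u \<in> L2 \<and> (\<forall>i\<in>Basis. du i \<in> L2 \<and> has_weak_deriv \<Omega> i u (du i))"

text \<open>Index convention: \<open>ddu i j\<close> is the derivative in direction j of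
  \<open>du i\<close>.\<close>

definition H2_data :: "('a \<Rightarrow> 'b::euclidean_space) \<Rightarrow> ('a \<Rightarrow> 'a \<Rightarrow> 'b) \<Rightarrow> ('a \<Rightarrow> 'a \<Rightarrow> 'a \<Rightarrow> 'b) \<Rightarrow> bool" where
  "H2_data u du ddu \<longleftrightarrow> H1_data u du \<and> (\<forall>i\<in>Basis. H1_data (du i) (ddu i))"

definition W1_data :: "('a \<Rightarrow> real) \<Rightarrow> ('a \<Rightarrow> 'a \<Rightarrow> real) \<Rightarrow> bool" where
  "W1_data c dc \<longleftrightarrow> c \<in> Linf \<and> (\<forall>i\<in>Basis. dc i \<in> Linf \<and> has_weak_deriv \<Omega> i c (dc i))"

definition W2_data :: "('a \<Rightarrow> real) \<Rightarrow> ('a \<Rightarrow> 'a \<Rightarrow> real) \<Rightarrow> ('a \<Rightarrow> 'a \<Rightarrow> 'a \<Rightarrow> real) \<Rightarrow> bool" where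
  "W2_data c dc ddc \<longleftrightarrow> W1_data c dc \<and> (\<forall>i\<in>Basis. W1_data (dc i) (ddc i))"

lemma H_space_1_iff: "u \<in> H_space (Suc 0) \<Omega> \<longleftrightarrow> (\<exists>du. H1_data u du)"
  unfolding sobolev.simps H1_data_def by (auto; metis)

lemma H_space_2_iff: "u \<in> H_space 2 \<Omega> \<longleftrightarrow> (\<exists>du ddu. H2_data u du ddu)"
proof
  assume "u \<in> H_space 2 \<Omega>"
  then have u: "u \<in> L2" "\<forall>i\<in>Basis. \<exists>g \<in> H_space (Suc 0) \<Omega>. has_weak_deriv \<Omega> i u g"
    unfolding numeral_2_eq_2 sobolev.simps(2)[of "Suc 0"] by auto
  then obtain du where du: "\<And>i. i \<in> Basis \<Longrightarrow> du i \<in> H_space (Suc 0) \<Omega> \<and> has_weak_deriv \<Omega> i u (du i)" by metis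
  then obtain ddu where "\<And>i. i \<in> Basis \<Longrightarrow> H1_data (du i) (ddu i)"
    unfolding H_space_1_iff by metis
  moreover have "H1_data u du" using u du by (auto simp: H1_data_def)
  ultimately show "\<exists>du ddu. H2_data u du ddu" by (auto simp: H2_data_def)
next
  assume "\<exists>du ddu. H2_data u du ddu"
  then obtain du ddu where d: "H2_data u du ddu" by blast
  then have "du i \<in> H_space (Suc 0) \<Omega>" if "i \<in> Basis" for i
    using that unfolding H_space_1_iff H2_data_def by blast
  then show "u \<in> H_space 2 \<Omega>"
    using d unfolding numeral_2_eq_2 sobolev.simps(2)[of "Suc 0"] H2_data_def H1_data_def by blast
qed

lemma Winf_space_2E:
  assumes "a \<in> Winf_space 2 \<Omega>"
  obtains da dda where "W2_data a da dda"
proof -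
  have u: "a \<in> Linf" "\<forall>i\<in>Basis. \<exists>g \<in> Winf_space (Suc 0) \<Omega>. has_weak_deriv \<Omega> i a g"
    using assms unfolding numeral_2_eq_2 sobolev.simps(2)[of "Suc 0"] by auto
  then obtain da where da: "\<And>i. i \<in> Basis \<Longrightarrow> da i \<in> Winf_space (Suc 0) \<Omega> \<and> has_weak_deriv \<Omega> i a (da i)" by metis
  have "\<exists>dda. W1_data (da i) dda" if "i \<in> Basis" for i
    using da[OF that] unfolding sobolev.simps W1_data_def by (auto; metis)
  then obtain dda where "\<And>i. i \<in> Basis \<Longrightarrow> W1_data (da i) (dda i)" by metis
  moreover have "W1_data a da" using u da by (auto simp: W1_data_def)
  ultimately show thesis by (intro that) (auto simp: W2_data_def)
qed

section \<open>Sums, products and compositions with explicit derivatives\<close>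

lemma H1_data_cong_AE:
  fixes u u' :: "'a \<Rightarrow> 'b::euclidean_space"
  assumes "H1_data u du" "AE x in lebesgue_on \<Omega>. u x = u' x"
    "\<And>i. i \<in> Basis \<Longrightarrow> AE x in lebesgue_on \<Omega>. du i x = du' i x"
  shows "H1_data u' du'"
  using assms unfolding H1_data_def
  by (auto intro: L2_cong_AE has_weak_deriv_cong_AE[OF opn])

lemma W1_data_cong_AE:
  assumes "W1_data u du" "AE x in lebesgue_on \<Omega>. u x = u' x"
    "\<And>i. i \<in> Basis \<Longrightarrow> AE x in lebesgue_on \<Omega>. du i x = du' i x"
  shows "W1_data u' du'"
  using assms unfolding W1_data_def
  by (auto intro: Linf_cong_AE has_weak_deriv_cong_AE[OF opn])

lemma W1_imp_H1_data: "W1_data c dc \<Longrightarrow> H1_data c dc"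
  by (auto simp: W1_data_def H1_data_def intro: Linf_imp_L2)

lemma W2_imp_H2_data: "W2_data c dc ddc \<Longrightarrow> H2_data c dc ddc"
  by (auto simp: W2_data_def H2_data_def intro: W1_imp_H1_data)

lemma H1_data_add:
  fixes u v :: "'a \<Rightarrow> 'b::euclidean_space"
  assumes "H1_data u du" "H1_data v dv"
  shows "H1_data (\<lambda>x. u x + v x) (\<lambda>i x. du i x + dv i x)"
  using assms unfolding H1_data_def by (auto intro: L2_space_add has_weak_deriv_add[OF opn])

lemma H1_data_bounded_linear:
  fixes u :: "'a \<Rightarrow> 'b::euclidean_space" and T :: "'b \<Rightarrow> 'c::euclidean_space"
  assumes "bounded_linear T" "H1_data u du"
  shows "H1_data (\<lambda>x. T (u x)) (\<lambda>i x. T (du i x))"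
  using assms unfolding H1_data_def
  by (auto intro: L2_space_bounded_linear has_weak_deriv_bounded_linear[OF opn])

lemma H2_data_bounded_linear:
  fixes u :: "'a \<Rightarrow> 'b::euclidean_space" and T :: "'b \<Rightarrow> 'c::euclidean_space"
  assumes "bounded_linear T" "H2_data u du ddu"
  shows "H2_data (\<lambda>x. T (u x)) (\<lambda>i x. T (du i x)) (\<lambda>i j x. T (ddu i j x))"
  using assms H1_data_bounded_linear[OF assms(1)] unfolding H2_data_def by auto

lemma H1_data_diff:
  fixes u v :: "'a \<Rightarrow> 'b::euclidean_space"
  assumes "H1_data u du" "H1_data v dv"
  shows "H1_data (\<lambda>x. u x - v x) (\<lambda>i x. du i x - dv i x)"
  using H1_data_add[OF assms(1) H1_data_bounded_linear[OF bounded_linear_minus[OF bounded_linear_ident] assms(2)]]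
  by simp

lemma H1_data_scaleR:
  fixes u :: "'a \<Rightarrow> 'b::euclidean_space"
  assumes "W1_data c dc" "H1_data u du"
  shows "H1_data (\<lambda>x. c x *\<^sub>R u x) (\<lambda>i x. c x *\<^sub>R du i x + dc i x *\<^sub>R u x)"
  using assms unfolding H1_data_def W1_data_def
  by (auto intro!: L2_space_add L2_space_scaleR has_weak_deriv_scaleR[OF opn])

lemma H2_data_scaleR:
  fixes u :: "'a \<Rightarrow> 'b::euclidean_space"
  assumes c: "W2_data c dc ddc" and u: "H2_data u du ddu"
  shows "H2_data (\<lambda>x. c x *\<^sub>R u x) (\<lambda>i x. c x *\<^sub>R du i x + dc i x *\<^sub>R u x)
    (\<lambda>i j x. (c x *\<^sub>R ddu i j x + dc j x *\<^sub>R du i x) + (dc i x *\<^sub>R du j x + ddc i j x *\<^sub>R u x))"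
  unfolding H2_data_def
proof (intro conjI ballI)
  show "H1_data (\<lambda>x. c x *\<^sub>R u x) (\<lambda>i x. c x *\<^sub>R du i x + dc i x *\<^sub>R u x)"
    using c u by (intro H1_data_scaleR) (auto simp: W2_data_def H2_data_def)
  fix i :: 'a assume i: "i \<in> Basis"
  have "W1_data c dc" "W1_data (dc i) (ddc i)" "H1_data u du" "H1_data (du i) (ddu i)"
    using c u i by (auto simp: W2_data_def H2_data_def)
  then show "H1_data (\<lambda>x. c x *\<^sub>R du i x + dc i x *\<^sub>R u x)
    (\<lambda>j x. c x *\<^sub>R ddu i j x + dc j x *\<^sub>R du i x + (dc i x *\<^sub>R du j x + ddc i j x *\<^sub>R u x))"
    by (intro H1_data_add H1_data_scaleR)
qed

lemma W1_data_add:
  assumes "W1_data u du" "W1_data v dv"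
  shows "W1_data (\<lambda>x. u x + v x) (\<lambda>i x. du i x + dv i x)"
  using assms unfolding W1_data_def by (auto intro: Linf_space_add has_weak_deriv_add[OF opn])

lemma W1_data_mult:
  assumes "W1_data c dc" "W1_data u du"
  shows "W1_data (\<lambda>x. c x * u x) (\<lambda>i x. c x * du i x + dc i x * u x)"
  using assms unfolding W1_data_def
  by (auto intro!: Linf_space_add Linf_space_mult has_weak_deriv_mult_real[OF opn])

lemma W1_data_cmult:
  assumes "W1_data u du"
  shows "W1_data (\<lambda>x. k * u x) (\<lambda>i x. k * du i x)"
  using assms has_weak_deriv_bounded_linear[OF opn bounded_linear_mult_right[of k]] unfolding W1_data_def
  by (auto intro!: Linf_space_mult Linf_space_const)

lemma W1_data_sum:
  assumes "finite J" "\<And>j. j \<in> J \<Longrightarrow> W1_data (f j) (df j)"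
  shows "W1_data (\<lambda>x. \<Sum>j\<in>J. f j x) (\<lambda>i x. \<Sum>j\<in>J. df j i x)"
  using assms unfolding W1_data_def
  by (auto intro!: Linf_space_sum has_weak_deriv_sum[OF opn])

lemma W1_data_chain:
  fixes F F' :: "real \<Rightarrow> real"
  assumes f: "W1_data f df" and cf: "continuous_on \<Omega> f" and range: "\<And>x. x \<in> \<Omega> \<Longrightarrow> f x \<in> {l..u}"
    and F: "\<And>t. t \<in> {l..u} \<Longrightarrow> (F has_real_derivative F' t) (at t)" and cF': "continuous_on {l..u} F'"
  shows "W1_data (\<lambda>x. F (f x)) (\<lambda>i x. F' (f x) * df i x)"
proof -
  have cF: "continuous_on {l..u} F"
    using F by (intro continuous_at_imp_continuous_on ballI) (blast intro: DERIV_isCont)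
  have *: "(\<lambda>x. G (f x)) \<in> Linf" if G: "continuous_on {l..u} G" for G :: "real \<Rightarrow> real"
  proof -
    obtain B where B: "\<And>t. t \<in> {l..u} \<Longrightarrow> \<bar>G t\<bar> \<le> B"
      using compact_imp_bounded[OF compact_continuous_image[OF G compact_Icc]]
      unfolding bounded_iff by (metis image_eqI real_norm_def)
    have "continuous_on \<Omega> (\<lambda>x. G (f x))" using range by (intro continuous_on_compose2[OF G cf]) blast
    then have "(\<lambda>x. G (f x)) \<in> borel_measurable (lebesgue_on \<Omega>)"
      using opn by (intro continuous_imp_measurable_on_sets_lebesgue) auto
    moreover have "AE x in lebesgue_on \<Omega>. norm (G (f x)) \<le> B" using B range by (intro AE_I2) auto
    ultimately show ?thesis by (rule Linf_spaceI)
  qed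
  show ?thesis
    using f *[OF cF] *[OF cF'] has_weak_deriv_chain[OF opn _ _ cf range F cF'] unfolding W1_data_def
    by (auto intro!: Linf_space_mult)
qed

text \<open>The inner weak derivative agrees with \<open>du i\<close> almost everywhere, so the
  outer choice is made from the same candidates and may be evaluated on \<open>du i\<close>
  itself.\<close>

lemma laplacian_AE:
  assumes "H2_data u du ddu"
  shows "AE x in lebesgue_on \<Omega>. laplacian \<Omega> u x = (\<Sum>i\<in>Basis. ddu i i x)"
proof -
  have "AE x in lebesgue_on \<Omega>. weak_deriv \<Omega> i (weak_deriv \<Omega> i u) x = ddu i i x" if i: "i \<in> Basis" for i
  proof -
    have "AE x in lebesgue_on \<Omega>. weak_deriv \<Omega> i u x = du i x"
      using assms i by (intro weak_deriv_AE_eq[OF opn]) (auto simp: H2_data_def H1_data_def)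
    from weak_deriv_cong_AE[OF opn this, of i]
    show ?thesis
      using assms i weak_deriv_AE_eq[OF opn _ i, of "du i" "ddu i i"] by (auto simp: H2_data_def H1_data_def)
  qed
  then have "AE x in lebesgue_on \<Omega>. \<forall>i\<in>Basis. weak_deriv \<Omega> i (weak_deriv \<Omega> i u) x = ddu i i x"
    by (intro AE_finite_allI) auto
  then show ?thesis by eventually_elim (simp add: laplacian_def)
qed

lemma div_a_grad_AE:
  assumes "H2_data u du ddu" "W1_data a da"
  shows "AE x in lebesgue_on \<Omega>. div_a_grad \<Omega> a u x = (\<Sum>i\<in>Basis. a x *\<^sub>R ddu i i x + da i x *\<^sub>R du i x)"
proof -
  have "AE x in lebesgue_on \<Omega>. weak_deriv \<Omega> i (\<lambda>y. a y *\<^sub>R weak_deriv \<Omega> i u y) x =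
      a x *\<^sub>R ddu i i x + da i x *\<^sub>R du i x" if i: "i \<in> Basis" for i
  proof -
    have "AE x in lebesgue_on \<Omega>. weak_deriv \<Omega> i u x = du i x"
      using assms i by (intro weak_deriv_AE_eq[OF opn]) (auto simp: H2_data_def H1_data_def)
    then have "AE x in lebesgue_on \<Omega>. a x *\<^sub>R weak_deriv \<Omega> i u x = a x *\<^sub>R du i x" by eventually_elim simp
    from weak_deriv_cong_AE[OF opn this, of i]
    have "weak_deriv \<Omega> i (\<lambda>y. a y *\<^sub>R weak_deriv \<Omega> i u y) = weak_deriv \<Omega> i (\<lambda>y. a y *\<^sub>R du i y)" .
    moreover have "has_weak_deriv \<Omega> i (\<lambda>y. a y *\<^sub>R du i y) (\<lambda>x. a x *\<^sub>R ddu i i x + da i x *\<^sub>R du i x)"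
      using H1_data_scaleR[OF assms(2), of "du i" "ddu i"] assms(1) i by (auto simp: H2_data_def H1_data_def)
    ultimately show ?thesis using weak_deriv_AE_eq[OF opn _ i] by metis
  qed
  then have "AE x in lebesgue_on \<Omega>. \<forall>i\<in>Basis. weak_deriv \<Omega> i (\<lambda>y. a y *\<^sub>R weak_deriv \<Omega> i u y) x =
      a x *\<^sub>R ddu i i x + da i x *\<^sub>R du i x"
    by (intro AE_finite_allI) auto
  then show ?thesis by eventually_elim (simp add: div_a_grad_def)
qed

text \<open>The squared norm with the derivatives given explicitly. Limits are computed with it and
  return to \<open>H1_norm\<close> through a single equivalence.\<close>

definition H1_sq :: "('a \<Rightarrow> 'b::euclidean_space) \<Rightarrow> ('a \<Rightarrow> 'a \<Rightarrow> 'b) \<Rightarrow> real" where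
  "H1_sq u du = (\<integral>x. (norm (u x))\<^sup>2 \<partial>lebesgue_on \<Omega>) + (\<Sum>i\<in>Basis. \<integral>x. (norm (du i x))\<^sup>2 \<partial>lebesgue_on \<Omega>)"

lemma H1_sq_nonneg: "H1_sq u du \<ge> 0"
  unfolding H1_sq_def by (intro add_nonneg_nonneg sum_nonneg integral_nonneg_AE) auto

lemma H1_norm_eq:
  fixes u :: "'a \<Rightarrow> 'b::euclidean_space"
  assumes "H1_data u du" shows "H1_norm \<Omega> u = sqrt (H1_sq u du)"
proof -
  have "(\<integral>x. (norm (weak_deriv \<Omega> i u x))\<^sup>2 \<partial>lebesgue_on \<Omega>) = (\<integral>x. (norm (du i x))\<^sup>2 \<partial>lebesgue_on \<Omega>)" if i: "i \<in> Basis" for i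
  proof (rule integral_lebesgue_on_cong_AE(1)[OF opn])
    have "AE x in lebesgue_on \<Omega>. weak_deriv \<Omega> i u x = du i x"
      using assms i by (intro weak_deriv_AE_eq[OF opn]) (auto simp: H1_data_def)
    then show "AE x in lebesgue_on \<Omega>. (norm (weak_deriv \<Omega> i u x))\<^sup>2 = (norm (du i x))\<^sup>2" by eventually_elim simp
  qed
  then show ?thesis by (simp add: H1_norm_def H1_sq_def)
qed

lemma H1_norm_tendsto_0_iff:
  fixes u :: "nat \<Rightarrow> 'a \<Rightarrow> 'b::euclidean_space"
  assumes "\<And>k. H1_data (u k) (du k)"
  shows "(\<lambda>k. H1_norm \<Omega> (u k)) \<longlonglongrightarrow> 0 \<longleftrightarrow> (\<lambda>k. H1_sq (u k) (du k)) \<longlonglongrightarrow> 0"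
proof -
  have e: "H1_norm \<Omega> (u k) = sqrt (H1_sq (u k) (du k))" for k by (rule H1_norm_eq[OF assms])
  show ?thesis
  proof
    assume "(\<lambda>k. H1_norm \<Omega> (u k)) \<longlonglongrightarrow> 0"
    from tendsto_power[OF this, of 2] show "(\<lambda>k. H1_sq (u k) (du k)) \<longlonglongrightarrow> 0"
      by (simp add: e H1_sq_nonneg)
  next
    assume "(\<lambda>k. H1_sq (u k) (du k)) \<longlonglongrightarrow> 0"
    from tendsto_real_sqrt[OF this] show "(\<lambda>k. H1_norm \<Omega> (u k)) \<longlonglongrightarrow> 0" by (simp add: e)
  qed
qed

text \<open>Multiplication by a function that is bounded with bounded weak gradient is a bounded
  operation; the constant is chosen before u, as the passage to limits of sequences
  requires.\<close>

lemma H1_sq_scaleR_le: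
  assumes "W1_data c dc"
  shows "\<exists>C\<ge>0. \<forall>(u :: 'a \<Rightarrow> 'b::euclidean_space) du. H1_data u du \<longrightarrow>
    H1_sq (\<lambda>x. c x *\<^sub>R u x) (\<lambda>i x. c x *\<^sub>R du i x + dc i x *\<^sub>R u x) \<le> C * H1_sq u du"
proof -
  obtain B0 where B0: "AE x in lebesgue_on \<Omega>. \<bar>c x\<bar> \<le> B0"
    using assms by (auto simp: W1_data_def Linf_space_def)
  have "\<forall>i\<in>Basis. \<exists>B. AE x in lebesgue_on \<Omega>. \<bar>dc i x\<bar> \<le> B"
    using assms by (auto simp: W1_data_def Linf_space_def)
  from bchoice[OF this] obtain B1 where B1: "\<And>i. i \<in> Basis \<Longrightarrow> AE x in lebesgue_on \<Omega>. \<bar>dc i x\<bar> \<le> B1 i"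
    by blast
  define M where "M = \<bar>B0\<bar> + (\<Sum>i\<in>(Basis::'a set). \<bar>B1 i\<bar>)"
  have M0: "M \<ge> 0" by (auto simp: M_def intro!: add_nonneg_nonneg sum_nonneg)
  have Mc: "AE x in lebesgue_on \<Omega>. \<bar>c x\<bar> \<le> M"
    using B0
  proof eventually_elim
    case (elim x)
    moreover have "(\<Sum>i\<in>(Basis::'a set). \<bar>B1 i\<bar>) \<ge> 0" by (intro sum_nonneg) auto
    ultimately show ?case unfolding M_def by linarith
  qed
  have Md: "AE x in lebesgue_on \<Omega>. \<bar>dc i x\<bar> \<le> M" if i: "i \<in> Basis" for i
    using B1[OF i]
  proof eventually_elim
    case (elim x)
    moreover have "\<bar>B1 i\<bar> \<le> (\<Sum>i\<in>(Basis::'a set). \<bar>B1 i\<bar>)" using i by (intro member_le_sum) auto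
    ultimately show ?case unfolding M_def by linarith
  qed
  show ?thesis
  \<comment> \<open>M bounds c and all its first derivatives. The function itself contributes M^2,
    and each direction contributes 2 M^2 for its derivative and 2 M^2 for u; summing the latter
    produces the dimension.\<close>
  proof (intro exI[of _ "M\<^sup>2 + 2 * M\<^sup>2 * real DIM('a) + 2 * M\<^sup>2"] conjI allI impI)
    fix u :: "'a \<Rightarrow> 'b" and du assume u: "H1_data u du"
    let ?I = "\<lambda>f::'a \<Rightarrow> 'b. (\<integral>x. (norm (f x))\<^sup>2 \<partial>lebesgue_on \<Omega>)"
    have L: "u \<in> L2" "\<And>i. i \<in> Basis \<Longrightarrow> du i \<in> L2" using u by (auto simp: H1_data_def)
    have cu: "H1_data (\<lambda>x. c x *\<^sub>R u x) (\<lambda>i x. c x *\<^sub>R du i x + dc i x *\<^sub>R u x)" by (rule H1_data_scaleR[OF assms u])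
    have L': "(\<lambda>x. c x *\<^sub>R u x) \<in> L2" "\<And>i. i \<in> Basis \<Longrightarrow> (\<lambda>x. c x *\<^sub>R du i x + dc i x *\<^sub>R u x) \<in> L2"
      using cu by (auto simp: H1_data_def)
    have sq: "\<bar>t\<bar> \<le> M \<Longrightarrow> (norm (t *\<^sub>R y))\<^sup>2 \<le> M\<^sup>2 * (norm y)\<^sup>2" for t and y :: 'b
      by (auto simp: power_mult_distrib intro!: mult_right_mono) (metis M0 abs_le_square_iff abs_of_nonneg)
    have 1: "?I (\<lambda>x. c x *\<^sub>R u x) \<le> M\<^sup>2 * ?I u"
    proof -
      have "?I (\<lambda>x. c x *\<^sub>R u x) \<le> (\<integral>x. M\<^sup>2 * (norm (u x))\<^sup>2 \<partial>lebesgue_on \<Omega>)"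
      proof (rule integral_mono_AE)
        show "AE x in lebesgue_on \<Omega>. (norm (c x *\<^sub>R u x))\<^sup>2 \<le> M\<^sup>2 * (norm (u x))\<^sup>2"
          using Mc by eventually_elim (rule sq)
      qed (use L2_spaceD(2)[OF L'(1)] L2_spaceD(2)[OF L(1)] in auto)
      then show ?thesis by simp
    qed
    have 2: "?I (\<lambda>x. c x *\<^sub>R du i x + dc i x *\<^sub>R u x) \<le> 2 * M\<^sup>2 * ?I (du i) + 2 * M\<^sup>2 * ?I u" if i: "i \<in> Basis" for i
    proof -
      have "?I (\<lambda>x. c x *\<^sub>R du i x + dc i x *\<^sub>R u x) \<le>
          (\<integral>x. 2 * M\<^sup>2 * (norm (du i x))\<^sup>2 + 2 * M\<^sup>2 * (norm (u x))\<^sup>2 \<partial>lebesgue_on \<Omega>)"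
      proof (rule integral_mono_AE)
        show "AE x in lebesgue_on \<Omega>. (norm (c x *\<^sub>R du i x + dc i x *\<^sub>R u x))\<^sup>2 \<le> 2 * M\<^sup>2 * (norm (du i x))\<^sup>2 + 2 * M\<^sup>2 * (norm (u x))\<^sup>2"
          using Mc Md[OF i]
        proof eventually_elim
          case (elim x)
          show ?case
            using norm_add_sq_le[of "c x *\<^sub>R du i x" "dc i x *\<^sub>R u x"] sq[OF elim(1), of "du i x"] sq[OF elim(2), of "u x"]
            by linarith
        qed
      qed (use L2_spaceD(2)[OF L'(2)[OF i]] L2_spaceD(2)[OF L(1)] L2_spaceD(2)[OF L(2)[OF i]] in auto)
      also have "\<dots> = 2 * M\<^sup>2 * ?I (du i) + 2 * M\<^sup>2 * ?I u"
        using L2_spaceD(2)[OF L(1)] L2_spaceD(2)[OF L(2)[OF i]] by simp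
      finally show ?thesis .
    qed
    have Iu: "?I u \<ge> 0" "(\<Sum>i\<in>Basis. ?I (du i)) \<ge> 0" by (auto intro!: sum_nonneg integral_nonneg_AE)
    have "H1_sq (\<lambda>x. c x *\<^sub>R u x) (\<lambda>i x. c x *\<^sub>R du i x + dc i x *\<^sub>R u x) \<le>
        M\<^sup>2 * ?I u + (\<Sum>i\<in>(Basis::'a set). 2 * M\<^sup>2 * ?I (du i) + 2 * M\<^sup>2 * ?I u)"
      unfolding H1_sq_def by (intro add_mono sum_mono 1 2)
    also have "\<dots> = M\<^sup>2 * ?I u + 2 * M\<^sup>2 * (\<Sum>i\<in>Basis. ?I (du i)) + 2 * M\<^sup>2 * real DIM('a) * ?I u"
      by (simp add: sum.distrib sum_distrib_left)
    also have "\<dots> \<le> (M\<^sup>2 + 2 * M\<^sup>2 * real DIM('a) + 2 * M\<^sup>2) * H1_sq u du"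
      using Iu M0 unfolding H1_sq_def by (simp add: distrib_left distrib_right)
    finally show "H1_sq (\<lambda>x. c x *\<^sub>R u x) (\<lambda>i x. c x *\<^sub>R du i x + dc i x *\<^sub>R u x) \<le>
        (M\<^sup>2 + 2 * M\<^sup>2 * real DIM('a) + 2 * M\<^sup>2) * H1_sq u du" .
  qed (use M0 in auto)
qed

lemma H1_sq_add_le:
  fixes u v :: "'a \<Rightarrow> 'b::euclidean_space"
  assumes "H1_data u du" "H1_data v dv"
  shows "H1_sq (\<lambda>x. u x + v x) (\<lambda>i x. du i x + dv i x) \<le> 2 * H1_sq u du + 2 * H1_sq v dv"
proof -
  have *: "(\<integral>x. (norm (f x + g x))\<^sup>2 \<partial>lebesgue_on \<Omega>) \<le>
      2 * (\<integral>x. (norm (f x))\<^sup>2 \<partial>lebesgue_on \<Omega>) + 2 * (\<integral>x. (norm (g x))\<^sup>2 \<partial>lebesgue_on \<Omega>)"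
    if "f \<in> L2" "g \<in> L2" for f g :: "'a \<Rightarrow> 'b"
  proof -
    have "(\<integral>x. (norm (f x + g x))\<^sup>2 \<partial>lebesgue_on \<Omega>) \<le> (\<integral>x. 2 * (norm (f x))\<^sup>2 + 2 * (norm (g x))\<^sup>2 \<partial>lebesgue_on \<Omega>)"
      by (rule integral_mono)
        (use L2_spaceD(2)[OF that(1)] L2_spaceD(2)[OF that(2)] L2_spaceD(2)[OF L2_space_add[OF that]] norm_add_sq_le in auto)
    then show ?thesis using L2_spaceD(2)[OF that(1)] L2_spaceD(2)[OF that(2)] by simp
  qed
  have "H1_sq (\<lambda>x. u x + v x) (\<lambda>i x. du i x + dv i x) \<le>
    (2 * (\<integral>x. (norm (u x))\<^sup>2 \<partial>lebesgue_on \<Omega>) + 2 * (\<integral>x. (norm (v x))\<^sup>2 \<partial>lebesgue_on \<Omega>)) +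
    (\<Sum>i\<in>Basis. 2 * (\<integral>x. (norm (du i x))\<^sup>2 \<partial>lebesgue_on \<Omega>) + 2 * (\<integral>x. (norm (dv i x))\<^sup>2 \<partial>lebesgue_on \<Omega>))"
    unfolding H1_sq_def using assms by (intro add_mono sum_mono *) (auto simp: H1_data_def)
  also have "\<dots> = 2 * H1_sq u du + 2 * H1_sq v dv"
    by (simp add: H1_sq_def sum.distrib sum_distrib_left)
  finally show ?thesis .
qed

end

section \<open>Traces\<close>

text \<open>\<open>measure_of\<close> determines the sigma-algebra independently of the set
  function, here the Borel sets traced on the boundary.\<close>

lemma sets_surface_measure: "sets (surface_measure \<Omega>) = sets (restrict_space borel (frontier \<Omega>))"
  unfolding surface_measure_def hausdorff_measure_def
  by (rule sets_restrict_space_cong) (simp add: sets.sigma_sets_eq[of borel, simplified])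

lemma space_surface_measure: "space (surface_measure \<Omega>) = frontier \<Omega>"
  using sets_eq_imp_space_eq[OF sets_surface_measure] by (simp add: space_restrict_space)

lemma continuous_on_frontier_measurable:
  assumes "continuous_on (closure \<Omega>) f"
  shows "f \<in> borel_measurable (surface_measure \<Omega>)"
proof -
  have "continuous_on (frontier \<Omega>) f"
    using assms continuous_on_subset[of "closure \<Omega>" f "frontier \<Omega>"] by (auto simp: frontier_def)
  from borel_measurable_continuous_on_restrict[OF this] show ?thesis
    by (subst measurable_cong_sets[OF sets_surface_measure refl])
qed

context bounded_open
begin

text \<open>The distances of the approximating sequence to u and to u' are the same numbers, since
  \<open>weak_deriv\<close> does not distinguish functions that are equal almost everywhere.\<close>

lemma has_trace_cong_AE:
  fixes u u' :: "'a \<Rightarrow> 'b::euclidean_space"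
  assumes tr: "has_trace \<Omega> u g" and ae: "AE x in lebesgue_on \<Omega>. u x = u' x"
  shows "has_trace \<Omega> u' g"
proof -
  have 1: "u \<in> H_space (Suc 0) \<Omega>" and 2: "g \<in> L2_space (surface_measure \<Omega>)" using tr by (auto simp: has_trace_def)
  obtain du where "H1_data u du" using 1 unfolding H_space_1_iff by blast
  then have "H1_data u' du" using ae by (rule H1_data_cong_AE) auto
  then have u': "u' \<in> H_space (Suc 0) \<Omega>" unfolding H_space_1_iff by blast
  have "H1_norm \<Omega> (\<lambda>x. w x - u' x) = H1_norm \<Omega> (\<lambda>x. w x - u x)" for w
  proof -
    have ae': "AE x in lebesgue_on \<Omega>. w x - u' x = w x - u x" using ae by eventually_elim simp
    then have "AE x in lebesgue_on \<Omega>. (norm (w x - u' x))\<^sup>2 = (norm (w x - u x))\<^sup>2" by eventually_elim simp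
    from integral_lebesgue_on_cong_AE(1)[OF opn this] weak_deriv_cong_AE[OF opn ae']
    show ?thesis unfolding H1_norm_def by simp
  qed
  then show ?thesis using tr u' 2 unfolding has_trace_def by simp
qed

lemma continuous_closure_bounded:
  fixes m :: "'a \<Rightarrow> real"
  assumes m: "continuous_on (closure \<Omega>) m"
  obtains B where "B \<ge> 0" "\<And>x. x \<in> closure \<Omega> \<Longrightarrow> \<bar>m x\<bar> \<le> B"
proof -
  have "compact (closure \<Omega>)" using bdd by (simp add: compact_closure)
  then have "bounded (m ` closure \<Omega>)" by (intro compact_imp_bounded compact_continuous_image m)
  then obtain B where B: "\<And>x. x \<in> closure \<Omega> \<Longrightarrow> norm (m x) \<le> B" by (auto simp: bounded_iff)
  show thesis by (rule that[of "\<bar>B\<bar>"]) (use B in force)+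
qed

lemma Linf_surface:
  fixes m :: "'a \<Rightarrow> real"
  assumes m: "continuous_on (closure \<Omega>) m"
  shows "m \<in> Linf_space (surface_measure \<Omega>)"
proof -
  obtain B where "\<And>x. x \<in> closure \<Omega> \<Longrightarrow> \<bar>m x\<bar> \<le> B" using continuous_closure_bounded[OF m] by metis
  then have "AE x in surface_measure \<Omega>. norm (m x) \<le> B"
    by (intro AE_I2) (auto simp: space_surface_measure frontier_def)
  then show ?thesis using continuous_on_frontier_measurable[OF m] by (intro Linf_spaceI)
qed

text \<open>The approximating sequence is multiplied by m. Boundedness of m and its gradient keeps
  the convergence inside \<Omega>, continuity up to the boundary keeps the approximants admissible,
  and the bound of m on the closure handles the boundary integrals.\<close>

lemma has_trace_scaleR:
  fixes u :: "'a \<Rightarrow> 'b::euclidean_space"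
  assumes W: "W1_data m dm" and m: "continuous_on (closure \<Omega>) m" and tr: "has_trace \<Omega> u g"
  shows "has_trace \<Omega> (\<lambda>x. m x *\<^sub>R u x) (\<lambda>x. m x *\<^sub>R g x)"
proof -
  obtain U where u: "u \<in> H_space (Suc 0) \<Omega>" and g: "g \<in> L2_space (surface_measure \<Omega>)"
    and U: "\<And>k. U k \<in> H_space (Suc 0) \<Omega>" "\<And>k. continuous_on (closure \<Omega>) (U k)"
      "(\<lambda>k::nat. H1_norm \<Omega> (\<lambda>x. U k x - u x)) \<longlonglongrightarrow> 0"
      "(\<lambda>k. \<integral>\<^sup>+ x. ennreal ((norm (U k x - g x))\<^sup>2) \<partial>surface_measure \<Omega>) \<longlonglongrightarrow> 0"
    using tr unfolding has_trace_def One_nat_def by blast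
  obtain du where du: "H1_data u du" using u unfolding H_space_1_iff by blast
  obtain dU where dU: "\<And>k. H1_data (U k) (dU k)" using U(1) unfolding H_space_1_iff by metis
  have diff: "H1_data (\<lambda>x. U k x - u x) (\<lambda>i x. dU k i x - du i x)" for k by (rule H1_data_diff[OF dU du])
  obtain C where C: "C \<ge> 0" "\<And>(u :: 'a \<Rightarrow> 'b) du. H1_data u du \<Longrightarrow>
    H1_sq (\<lambda>x. m x *\<^sub>R u x) (\<lambda>i x. m x *\<^sub>R du i x + dm i x *\<^sub>R u x) \<le> C * H1_sq u du"
    using H1_sq_scaleR_le[OF W, where 'b='b] by blast
  obtain B where B: "B \<ge> 0" "\<And>x. x \<in> closure \<Omega> \<Longrightarrow> \<bar>m x\<bar> \<le> B" using continuous_closure_bounded[OF m] by metis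
  have "(\<lambda>x. m x *\<^sub>R u x) \<in> H_space (Suc 0) \<Omega>" "(\<lambda>x. m x *\<^sub>R U k x) \<in> H_space (Suc 0) \<Omega>" for k
    using H1_data_scaleR[OF W du] H1_data_scaleR[OF W dU] unfolding H_space_1_iff by blast+
  moreover have "(\<lambda>x. m x *\<^sub>R g x) \<in> L2_space (surface_measure \<Omega>)"
    by (rule L2_space_scaleR[OF Linf_surface[OF m] g])
  moreover have "continuous_on (closure \<Omega>) (\<lambda>x. m x *\<^sub>R U k x)" for k by (intro continuous_intros m U(2))
  moreover have "(\<lambda>k. H1_norm \<Omega> (\<lambda>x. m x *\<^sub>R U k x - m x *\<^sub>R u x)) \<longlonglongrightarrow> 0"
  proof -
    have s: "(\<lambda>k. H1_sq (\<lambda>x. U k x - u x) (\<lambda>i x. dU k i x - du i x)) \<longlonglongrightarrow> 0"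
      by (rule H1_norm_tendsto_0_iff[THEN iffD1, OF diff U(3)])
    have "(\<lambda>k. H1_sq (\<lambda>x. m x *\<^sub>R (U k x - u x)) (\<lambda>i x. m x *\<^sub>R (dU k i x - du i x) + dm i x *\<^sub>R (U k x - u x))) \<longlonglongrightarrow> 0"
      by (rule Lim_null_comparison[OF _ tendsto_mult_right_zero[OF s, of C]])
        (use C(2)[OF diff] in \<open>auto simp: H1_sq_nonneg intro!: always_eventually\<close>)
    from H1_norm_tendsto_0_iff[THEN iffD2, OF H1_data_scaleR[OF W diff] this]
    show ?thesis by (simp add: scaleR_diff_right)
  qed
  moreover have "(\<lambda>k. \<integral>\<^sup>+ x. ennreal ((norm (m x *\<^sub>R U k x - m x *\<^sub>R g x))\<^sup>2) \<partial>surface_measure \<Omega>) \<longlonglongrightarrow> 0"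
  proof (rule tendsto_sandwich[OF always_eventually always_eventually tendsto_const])
    have [measurable]: "g \<in> borel_measurable (surface_measure \<Omega>)" "U k \<in> borel_measurable (surface_measure \<Omega>)" for k
      using L2_spaceD(1)[OF g] continuous_on_frontier_measurable[OF U(2)] by auto
    have "(\<integral>\<^sup>+ x. ennreal ((norm (m x *\<^sub>R U k x - m x *\<^sub>R g x))\<^sup>2) \<partial>surface_measure \<Omega>) \<le>
      (\<integral>\<^sup>+ x. ennreal (B\<^sup>2) * ennreal ((norm (U k x - g x))\<^sup>2) \<partial>surface_measure \<Omega>)" for k
    proof (rule nn_integral_mono)
      fix x assume "x \<in> space (surface_measure \<Omega>)"
      then have "\<bar>m x\<bar> \<le> B" using B(2) by (auto simp: space_surface_measure frontier_def)
      then have "(m x)\<^sup>2 \<le> B\<^sup>2" using B(1) abs_le_square_iff[of "m x" B] by simp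
      then have "(norm (m x *\<^sub>R U k x - m x *\<^sub>R g x))\<^sup>2 \<le> B\<^sup>2 * (norm (U k x - g x))\<^sup>2"
        by (simp add: scaleR_diff_right[symmetric] power_mult_distrib mult_right_mono)
      then show "ennreal ((norm (m x *\<^sub>R U k x - m x *\<^sub>R g x))\<^sup>2) \<le> ennreal (B\<^sup>2) * ennreal ((norm (U k x - g x))\<^sup>2)"
        by (simp flip: ennreal_mult)
    qed
    then show "\<forall>k. (\<integral>\<^sup>+ x. ennreal ((norm (m x *\<^sub>R U k x - m x *\<^sub>R g x))\<^sup>2) \<partial>surface_measure \<Omega>) \<le>
       ennreal (B\<^sup>2) * (\<integral>\<^sup>+ x. ennreal ((norm (U k x - g x))\<^sup>2) \<partial>surface_measure \<Omega>)"
      by (simp add: nn_integral_cmult)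
    show "(\<lambda>k. ennreal (B\<^sup>2) * (\<integral>\<^sup>+ x. ennreal ((norm (U k x - g x))\<^sup>2) \<partial>surface_measure \<Omega>)) \<longlonglongrightarrow> 0"
      using ennreal_tendsto_cmult[OF _ U(4), of "ennreal (B\<^sup>2)"] by simp
  qed auto
  ultimately show ?thesis
    unfolding has_trace_def One_nat_def by (intro conjI exI[of _ "\<lambda>k x. m x *\<^sub>R U k x"] allI) auto
qed

text \<open>The sum of the two approximating sequences works; squares of sums cost a factor 2 in
  both limits.\<close>

lemma has_trace_add:
  fixes u v :: "'a \<Rightarrow> 'b::euclidean_space"
  assumes "has_trace \<Omega> u g" "has_trace \<Omega> v h"
  shows "has_trace \<Omega> (\<lambda>x. u x + v x) (\<lambda>x. g x + h x)"
proof -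
  obtain U where u: "u \<in> H_space (Suc 0) \<Omega>" and g: "g \<in> L2_space (surface_measure \<Omega>)"
    and U: "\<And>k. U k \<in> H_space (Suc 0) \<Omega>" "\<And>k. continuous_on (closure \<Omega>) (U k)"
      "(\<lambda>k::nat. H1_norm \<Omega> (\<lambda>x. U k x - u x)) \<longlonglongrightarrow> 0"
      "(\<lambda>k. \<integral>\<^sup>+ x. ennreal ((norm (U k x - g x))\<^sup>2) \<partial>surface_measure \<Omega>) \<longlonglongrightarrow> 0"
    using assms(1) unfolding has_trace_def One_nat_def by blast
  obtain V where v: "v \<in> H_space (Suc 0) \<Omega>" and h: "h \<in> L2_space (surface_measure \<Omega>)"
    and V: "\<And>k. V k \<in> H_space (Suc 0) \<Omega>" "\<And>k. continuous_on (closure \<Omega>) (V k)"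
      "(\<lambda>k::nat. H1_norm \<Omega> (\<lambda>x. V k x - v x)) \<longlonglongrightarrow> 0"
      "(\<lambda>k. \<integral>\<^sup>+ x. ennreal ((norm (V k x - h x))\<^sup>2) \<partial>surface_measure \<Omega>) \<longlonglongrightarrow> 0"
    using assms(2) unfolding has_trace_def One_nat_def by blast
  obtain du dv where du: "H1_data u du" and dv: "H1_data v dv" using u v unfolding H_space_1_iff by blast
  obtain dU dV where dU: "\<And>k. H1_data (U k) (dU k)" and dV: "\<And>k. H1_data (V k) (dV k)"
    using U(1) V(1) unfolding H_space_1_iff by metis
  have diff: "H1_data (\<lambda>x. U k x - u x) (\<lambda>i x. dU k i x - du i x)"
    "H1_data (\<lambda>x. V k x - v x) (\<lambda>i x. dV k i x - dv i x)" for k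
    by (rule H1_data_diff[OF dU du], rule H1_data_diff[OF dV dv])
  have "(\<lambda>x. u x + v x) \<in> H_space (Suc 0) \<Omega>" "(\<lambda>x. U k x + V k x) \<in> H_space (Suc 0) \<Omega>" for k
    using H1_data_add[OF du dv] H1_data_add[OF dU dV] unfolding H_space_1_iff by blast+
  moreover have "(\<lambda>x. g x + h x) \<in> L2_space (surface_measure \<Omega>)" by (rule L2_space_add[OF g h])
  moreover have "continuous_on (closure \<Omega>) (\<lambda>x. U k x + V k x)" for k by (intro continuous_intros V(2) U(2))
  moreover have "(\<lambda>k. H1_norm \<Omega> (\<lambda>x. (U k x + V k x) - (u x + v x))) \<longlonglongrightarrow> 0"
  proof -
    have s: "(\<lambda>k. 2 * H1_sq (\<lambda>x. U k x - u x) (\<lambda>i x. dU k i x - du i x) + 2 * H1_sq (\<lambda>x. V k x - v x) (\<lambda>i x. dV k i x - dv i x)) \<longlonglongrightarrow> 0"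
      using tendsto_add[OF tendsto_mult_right_zero[where c=2, OF H1_norm_tendsto_0_iff[THEN iffD1, OF diff(1) U(3)]]
        tendsto_mult_right_zero[where c=2, OF H1_norm_tendsto_0_iff[THEN iffD1, OF diff(2) V(3)]]] by simp
    have "(\<lambda>k. H1_sq (\<lambda>x. (U k x - u x) + (V k x - v x)) (\<lambda>i x. (dU k i x - du i x) + (dV k i x - dv i x))) \<longlonglongrightarrow> 0"
      by (rule Lim_null_comparison[OF _ s])
        (use H1_sq_add_le[OF diff] in \<open>auto simp: H1_sq_nonneg intro!: always_eventually\<close>)
    from H1_norm_tendsto_0_iff[THEN iffD2, OF H1_data_add[OF diff] this]
    show ?thesis by (simp add: algebra_simps)
  qed
  moreover have "(\<lambda>k. \<integral>\<^sup>+ x. ennreal ((norm ((U k x + V k x) - (g x + h x)))\<^sup>2) \<partial>surface_measure \<Omega>) \<longlonglongrightarrow> 0"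
  proof (rule tendsto_sandwich[OF always_eventually always_eventually tendsto_const])
    have [measurable]: "g \<in> borel_measurable (surface_measure \<Omega>)" "h \<in> borel_measurable (surface_measure \<Omega>)"
      "U k \<in> borel_measurable (surface_measure \<Omega>)" "V k \<in> borel_measurable (surface_measure \<Omega>)" for k
      using L2_spaceD(1)[OF g] L2_spaceD(1)[OF h] continuous_on_frontier_measurable[OF U(2)] continuous_on_frontier_measurable[OF V(2)] by auto
    have "(\<integral>\<^sup>+ x. ennreal ((norm ((U k x + V k x) - (g x + h x)))\<^sup>2) \<partial>surface_measure \<Omega>) \<le>
      (\<integral>\<^sup>+ x. 2 * ennreal ((norm (U k x - g x))\<^sup>2) + 2 * ennreal ((norm (V k x - h x))\<^sup>2) \<partial>surface_measure \<Omega>)" for k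
    proof (rule nn_integral_mono)
      fix x
      have "(norm ((U k x + V k x) - (g x + h x)))\<^sup>2 \<le> 2 * (norm (U k x - g x))\<^sup>2 + 2 * (norm (V k x - h x))\<^sup>2"
        using norm_add_sq_le[of "U k x - g x" "V k x - h x"] by (simp add: algebra_simps)
      then have "ennreal ((norm ((U k x + V k x) - (g x + h x)))\<^sup>2) \<le> ennreal (2 * (norm (U k x - g x))\<^sup>2 + 2 * (norm (V k x - h x))\<^sup>2)"
        by (rule ennreal_leI)
      then show "ennreal ((norm ((U k x + V k x) - (g x + h x)))\<^sup>2) \<le> 2 * ennreal ((norm (U k x - g x))\<^sup>2) + 2 * ennreal ((norm (V k x - h x))\<^sup>2)"
        by (simp add: ennreal_plus ennreal_mult)
    qed
    then show "\<forall>k. (\<integral>\<^sup>+ x. ennreal ((norm ((U k x + V k x) - (g x + h x)))\<^sup>2) \<partial>surface_measure \<Omega>) \<le>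
      2 * (\<integral>\<^sup>+ x. ennreal ((norm (U k x - g x))\<^sup>2) \<partial>surface_measure \<Omega>) + 2 * (\<integral>\<^sup>+ x. ennreal ((norm (V k x - h x))\<^sup>2) \<partial>surface_measure \<Omega>)"
      by (simp add: nn_integral_cmult nn_integral_add)
    show "(\<lambda>k. 2 * (\<integral>\<^sup>+ x. ennreal ((norm (U k x - g x))\<^sup>2) \<partial>surface_measure \<Omega>) + 2 * (\<integral>\<^sup>+ x. ennreal ((norm (V k x - h x))\<^sup>2) \<partial>surface_measure \<Omega>)) \<longlonglongrightarrow> 0"
      using tendsto_add[OF ennreal_tendsto_cmult[OF _ U(4), of 2] ennreal_tendsto_cmult[OF _ V(4), of 2]] by simp
  qed auto
  ultimately show ?thesis
    unfolding has_trace_def One_nat_def by (intro conjI exI[of _ "\<lambda>k x. U k x + V k x"] allI) auto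
qed

text \<open>Below, \<open>b\<close> is the square root of a conductivity \<open>a\<close>.\<close>

definition good_coeff :: "('a \<Rightarrow> real) \<Rightarrow> ('a \<Rightarrow> 'a \<Rightarrow> real) \<Rightarrow> ('a \<Rightarrow> 'a \<Rightarrow> 'a \<Rightarrow> real) \<Rightarrow> bool" where
  "good_coeff b db ddb \<longleftrightarrow> W2_data b db ddb \<and> continuous_on (closure \<Omega>) b \<and>
     (\<forall>i\<in>Basis. continuous_on (closure \<Omega>) (db i)) \<and> (\<forall>x. b x > 0)"

section \<open>Coefficients that are positive and continuously differentiable up to the
  boundary\<close>

lemma good_coeff_bounds:
  assumes "good_coeff b db ddb"
  obtains l u where "l > 0" "\<And>x. x \<in> closure \<Omega> \<Longrightarrow> b x \<in> {l..u}"
proof -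
  have c: "compact (closure \<Omega>)" "closure \<Omega> \<noteq> {}" "continuous_on (closure \<Omega>) b"
    using bdd nonempty assms by (auto simp: good_coeff_def compact_closure)
  obtain x where "x \<in> closure \<Omega>" "\<And>y. y \<in> closure \<Omega> \<Longrightarrow> b x \<le> b y" using continuous_attains_inf[OF c] by blast
  moreover obtain z where "z \<in> closure \<Omega>" "\<And>y. y \<in> closure \<Omega> \<Longrightarrow> b y \<le> b z" using continuous_attains_sup[OF c] by blast
  ultimately show thesis using assms by (intro that[of "b x" "b z"]) (auto simp: good_coeff_def)
qed

text \<open>The chain rule is applied twice, to F and to F'; the second use makes F' (f x) an
  admissible factor, and the product rule then supplies the second derivatives.\<close>

lemma W2_data_chain:
  fixes F F' F'' :: "real \<Rightarrow> real"
  assumes f: "W2_data f df ddf" and cf: "continuous_on (closure \<Omega>) f"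
    and cdf: "\<And>i. i \<in> Basis \<Longrightarrow> continuous_on (closure \<Omega>) (df i)"
    and range: "\<And>x. x \<in> closure \<Omega> \<Longrightarrow> f x \<in> {l..u}"
    and F: "\<And>t. t \<in> {l..u} \<Longrightarrow> (F has_real_derivative F' t) (at t)"
    and F': "\<And>t. t \<in> {l..u} \<Longrightarrow> (F' has_real_derivative F'' t) (at t)" and cF'': "continuous_on {l..u} F''"
  shows "\<exists>ddc. W2_data (\<lambda>x. F (f x)) (\<lambda>i x. F' (f x) * df i x) ddc"
    "continuous_on (closure \<Omega>) (\<lambda>x. F (f x))"
    "\<And>i. i \<in> Basis \<Longrightarrow> continuous_on (closure \<Omega>) (\<lambda>x. F' (f x) * df i x)"
proof -
  have cF: "continuous_on {l..u} F" "continuous_on {l..u} F'"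
    by (intro continuous_at_imp_continuous_on ballI DERIV_isCont[OF F] DERIV_isCont[OF F'], assumption)+
  have cf': "continuous_on \<Omega> f" using cf closure_subset continuous_on_subset by blast
  have r: "\<And>x. x \<in> \<Omega> \<Longrightarrow> f x \<in> {l..u}" using range closure_subset by blast
  have W: "W1_data f df" "\<And>i. i \<in> Basis \<Longrightarrow> W1_data (df i) (ddf i)" using f by (auto simp: W2_data_def)
  have 1: "W1_data (\<lambda>x. F (f x)) (\<lambda>i x. F' (f x) * df i x)"
    by (rule W1_data_chain[OF W(1) cf' r F cF(2)])
  have 2: "W1_data (\<lambda>x. F' (f x)) (\<lambda>i x. F'' (f x) * df i x)"
    by (rule W1_data_chain[OF W(1) cf' r F' cF''])
  show "\<exists>ddc. W2_data (\<lambda>x. F (f x)) (\<lambda>i x. F' (f x) * df i x) ddc"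
    unfolding W2_data_def
    by (rule exI[of _ "\<lambda>i j x. F' (f x) * ddf i j x + (F'' (f x) * df j x) * df i x"])
      (use 1 W1_data_mult[OF 2 W(2)] in auto)
  show "continuous_on (closure \<Omega>) (\<lambda>x. F (f x))"
    using range by (intro continuous_on_compose2[OF cF(1) cf]) blast
  show "continuous_on (closure \<Omega>) (\<lambda>x. F' (f x) * df i x)" if "i \<in> Basis" for i
    using range by (intro continuous_on_mult continuous_on_compose2[OF cF(2) cf] cdf that) blast
qed

text \<open>The transform from the Schroedinger equation back to the conductivity equation is
  multiplication by 1 / b, so it is covered by the same lemmas as multiplication by b once 1 / b is
  a coefficient of the same kind.\<close>

lemma good_coeff_inverse:
  assumes g: "good_coeff b db ddb"
  shows "\<exists>ddc. good_coeff (\<lambda>x. inverse (b x)) (\<lambda>i x. - (inverse (b x))\<^sup>2 * db i x) ddc"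
proof -
  obtain l u where l: "l > 0" "\<And>x. x \<in> closure \<Omega> \<Longrightarrow> b x \<in> {l..u}" using good_coeff_bounds[OF g] by metis
  have g': "W2_data b db ddb" "continuous_on (closure \<Omega>) b" "\<And>i. i \<in> Basis \<Longrightarrow> continuous_on (closure \<Omega>) (db i)" "\<And>x. b x > 0"
    using g by (auto simp: good_coeff_def)
  have d1: "(inverse has_real_derivative - (inverse t)\<^sup>2) (at t)" if "t \<in> {l..u}" for t
    using that l(1) by (auto intro!: derivative_eq_intros simp: power2_eq_square)
  have d2: "((\<lambda>t. - (inverse t)\<^sup>2) has_real_derivative 2 * (inverse t) ^ 3) (at t)" if "t \<in> {l..u}" for t
    using that l(1) by (auto intro!: derivative_eq_intros simp: power2_eq_square power3_eq_cube)
  have d3: "continuous_on {l..u} (\<lambda>t. 2 * (inverse t) ^ 3)" using l(1) by (auto intro!: continuous_intros)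
  show ?thesis
    using W2_data_chain[OF g'(1,2,3) l(2) d1 d2 d3] g'(4) by (auto simp: good_coeff_def)
qed

section \<open>The Liouville transform of equations, boundary data and normal derivatives\<close>

definition liouville_potential :: "('a \<Rightarrow> real) \<Rightarrow> ('a \<Rightarrow> 'a \<Rightarrow> 'a \<Rightarrow> real) \<Rightarrow> 'a \<Rightarrow> real" where
  "liouville_potential b ddb x = (\<Sum>i\<in>Basis. ddb i i x) / b x"

lemma liouville_potential_Linf:
  assumes g: "good_coeff b db ddb"
  shows "liouville_potential b ddb \<in> Linf"
proof -
  obtain ddc where c: "good_coeff (\<lambda>x. inverse (b x)) (\<lambda>i x. - (inverse (b x))\<^sup>2 * db i x) ddc"
    using good_coeff_inverse[OF g] by blast
  have "(\<lambda>x. inverse (b x)) \<in> Linf" using c by (auto simp: good_coeff_def W2_data_def W1_data_def)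
  moreover have "(\<lambda>x. \<Sum>i\<in>Basis. ddb i i x) \<in> Linf"
    using g by (intro Linf_space_sum) (auto simp: good_coeff_def W2_data_def W1_data_def)
  ultimately have "(\<lambda>x. (\<Sum>i\<in>Basis. ddb i i x) * inverse (b x)) \<in> Linf" by (intro Linf_space_mult)
  then show ?thesis by (simp add: liouville_potential_def[abs_def] divide_inverse)
qed

text \<open>By the product rule \<Delta>(b u) = b \<Delta>u + 2 \<nabla>b \<nabla>u + u \<Delta>b,
  and q b u = u \<Delta>b removes the last term. A further factor b leaves b^2 \<Delta>u + 2 b
  \<nabla>b \<nabla>u, which is the divergence of b^2 \<nabla>u.\<close>

lemma liouville_transform:
  fixes u :: "'a \<Rightarrow> complex"
  assumes g: "good_coeff b db ddb" and a: "AE x in lebesgue_on \<Omega>. a x = (b x)\<^sup>2" and u: "H2_data u du ddu"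
  shows "AE x in lebesgue_on \<Omega>. div_a_grad \<Omega> a u x =
    b x *\<^sub>R (laplacian \<Omega> (\<lambda>x. b x *\<^sub>R u x) x - liouville_potential b ddb x *\<^sub>R (b x *\<^sub>R u x))"
proof -
  have W: "W2_data b db ddb" and pos: "\<And>x. b x > 0" using g by (auto simp: good_coeff_def)
  then have W1: "W1_data b db" by (simp add: W2_data_def)
  have a': "AE x in lebesgue_on \<Omega>. b x * b x = a x" using a by eventually_elim (simp add: power2_eq_square)
  \<comment> \<open>The gradient of a is taken in the form that the product rule yields for b * b,
    so that it matches the expansion of the Laplacian term by term.\<close>
  have Wa: "W1_data a (\<lambda>i x. b x * db i x + db i x * b x)"
    by (rule W1_data_cong_AE[OF W1_data_mult[OF W1 W1] a']) simp
  show ?thesis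
    using div_a_grad_AE[OF u Wa] laplacian_AE[OF H2_data_scaleR[OF W u]] a
  proof eventually_elim
    case (elim x)
    have "liouville_potential b ddb x *\<^sub>R (b x *\<^sub>R u x) = (\<Sum>i\<in>Basis. ddb i i x *\<^sub>R u x)"
      using pos[of x] by (simp add: liouville_potential_def scaleR_sum_left)
    then have "b x *\<^sub>R (laplacian \<Omega> (\<lambda>x. b x *\<^sub>R u x) x - liouville_potential b ddb x *\<^sub>R (b x *\<^sub>R u x)) =
       (\<Sum>i\<in>Basis. b x *\<^sub>R (b x *\<^sub>R ddu i i x + db i x *\<^sub>R du i x + (db i x *\<^sub>R du i x + ddb i i x *\<^sub>R u x) - ddb i i x *\<^sub>R u x))"
      by (simp add: elim(2) sum_subtractf[symmetric] scaleR_sum_right)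
    also have "\<dots> = (\<Sum>i\<in>Basis. a x *\<^sub>R ddu i i x + (b x * db i x + db i x * b x) *\<^sub>R du i x)"
      by (rule sum.cong) (simp_all add: elim(3) power2_eq_square scaleR_conv_of_real algebra_simps)
    finally show ?case using elim(1) by simp
  qed
qed

text \<open>Each partial derivative of b u is b times that of u plus the derivative of b times u.
  Both b and its partial derivatives are admissible multipliers of traces, and the trace of u in the
  second term is \<phi>.\<close>

lemma has_normal_deriv_scaleR:
  fixes u :: "'a \<Rightarrow> complex"
  assumes g: "good_coeff b db ddb" and u: "H2_data u du ddu" and tr: "has_trace \<Omega> u \<phi>" and nd: "has_normal_deriv \<Omega> u h"
  shows "has_normal_deriv \<Omega> (\<lambda>x. b x *\<^sub>R u x)
    (\<lambda>x. b x *\<^sub>R h x + (\<Sum>i\<in>Basis. (outer_normal \<Omega> x \<bullet> i) * db i x) *\<^sub>R \<phi> x)"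
proof -
  obtain G where G: "\<And>i. i \<in> Basis \<Longrightarrow> has_trace \<Omega> (weak_deriv \<Omega> i u) (G i)"
    and ae: "AE x in surface_measure \<Omega>. h x = (\<Sum>i\<in>Basis. (outer_normal \<Omega> x \<bullet> i) *\<^sub>R G i x)"
    using nd by (auto simp: has_normal_deriv_def)
  have W: "W1_data b db" "\<And>i. i \<in> Basis \<Longrightarrow> W1_data (db i) (ddb i)" and c: "continuous_on (closure \<Omega>) b"
    "\<And>i. i \<in> Basis \<Longrightarrow> continuous_on (closure \<Omega>) (db i)"
    using g by (auto simp: good_coeff_def W2_data_def)
  have H1u: "H1_data u du" using u by (simp add: H2_data_def)
  show ?thesis
    unfolding has_normal_deriv_def
  proof (intro exI[of _ "\<lambda>i x. b x *\<^sub>R G i x + db i x *\<^sub>R \<phi> x"] conjI ballI)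
    fix i :: 'a assume i: "i \<in> Basis"
    have t: "has_trace \<Omega> (\<lambda>x. b x *\<^sub>R weak_deriv \<Omega> i u x + db i x *\<^sub>R u x) (\<lambda>x. b x *\<^sub>R G i x + db i x *\<^sub>R \<phi> x)"
      by (intro has_trace_add has_trace_scaleR[OF W(1) c(1) G[OF i]] has_trace_scaleR[OF W(2)[OF i] c(2)[OF i] tr])
    have "AE x in lebesgue_on \<Omega>. weak_deriv \<Omega> i u x = du i x"
      using H1u i by (intro weak_deriv_AE_eq[OF opn]) (auto simp: H1_data_def)
    moreover have "AE x in lebesgue_on \<Omega>. weak_deriv \<Omega> i (\<lambda>x. b x *\<^sub>R u x) x = b x *\<^sub>R du i x + db i x *\<^sub>R u x"
      using H1_data_scaleR[OF W(1) H1u] i by (intro weak_deriv_AE_eq[OF opn]) (auto simp: H1_data_def)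
    ultimately have "AE x in lebesgue_on \<Omega>. b x *\<^sub>R weak_deriv \<Omega> i u x + db i x *\<^sub>R u x = weak_deriv \<Omega> i (\<lambda>x. b x *\<^sub>R u x) x"
      by eventually_elim simp
    then show "has_trace \<Omega> (weak_deriv \<Omega> i (\<lambda>x. b x *\<^sub>R u x)) (\<lambda>x. b x *\<^sub>R G i x + db i x *\<^sub>R \<phi> x)"
      by (rule has_trace_cong_AE[OF t])
  next
    show "AE x in surface_measure \<Omega>. b x *\<^sub>R h x + (\<Sum>i\<in>Basis. (outer_normal \<Omega> x \<bullet> i) * db i x) *\<^sub>R \<phi> x =
        (\<Sum>i\<in>Basis. (outer_normal \<Omega> x \<bullet> i) *\<^sub>R (b x *\<^sub>R G i x + db i x *\<^sub>R \<phi> x))"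
      using ae by eventually_elim (simp add: scaleR_sum_right scaleR_sum_left sum.distrib scaleR_add_right mult.commute)
  qed
qed

lemma schroedinger_of_conductivity:
  assumes g: "good_coeff b db ddb" and a: "AE x in lebesgue_on \<Omega>. a x = (b x)\<^sup>2"
    and u: "u \<in> conductivity_solution \<Omega> a \<phi>"
  shows "(\<lambda>x. b x *\<^sub>R u x) \<in> schroedinger_solution \<Omega> (liouville_potential b ddb) (\<lambda>x. b x *\<^sub>R \<phi> x)"
proof -
  obtain du ddu where d: "H2_data u du ddu" using u unfolding conductivity_solution_def H_space_2_iff by blast
  have g': "W2_data b db ddb" "W1_data b db" "continuous_on (closure \<Omega>) b" "\<And>x. b x > 0"
    using g by (auto simp: good_coeff_def W2_data_def)
  have "AE x in lebesgue_on \<Omega>. - div_a_grad \<Omega> a u x = 0" using u by (simp add: conductivity_solution_def)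
  then have "AE x in lebesgue_on \<Omega>. - laplacian \<Omega> (\<lambda>x. b x *\<^sub>R u x) x + liouville_potential b ddb x *\<^sub>R (b x *\<^sub>R u x) = 0"
    using liouville_transform[OF g a d]
  proof eventually_elim
    case (elim x)
    then show ?case using g'(4)[of x] by simp
  qed
  moreover have "(\<lambda>x. b x *\<^sub>R u x) \<in> H_space 2 \<Omega>"
    unfolding H_space_2_iff using H2_data_scaleR[OF g'(1) d] by blast
  moreover have "has_trace \<Omega> (\<lambda>x. b x *\<^sub>R u x) (\<lambda>x. b x *\<^sub>R \<phi> x)"
    using u by (intro has_trace_scaleR[OF g'(2,3)]) (simp add: conductivity_solution_def)
  ultimately show ?thesis by (simp add: schroedinger_solution_def)
qed

text \<open>The transform is applied to v / b; multiplying by b gives back v, so the Schroedinger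
  equation for v is the conductivity equation for v / b up to the positive factor b.\<close>

lemma conductivity_of_schroedinger:
  assumes g: "good_coeff b db ddb" and a: "AE x in lebesgue_on \<Omega>. a x = (b x)\<^sup>2"
    and v: "v \<in> schroedinger_solution \<Omega> (liouville_potential b ddb) \<phi>"
  shows "(\<lambda>x. inverse (b x) *\<^sub>R v x) \<in> conductivity_solution \<Omega> a (\<lambda>x. inverse (b x) *\<^sub>R \<phi> x)"
proof -
  obtain dv ddv where d: "H2_data v dv ddv" using v unfolding schroedinger_solution_def H_space_2_iff by blast
  have pos: "\<And>x. b x > 0" using g by (auto simp: good_coeff_def)
  obtain ddc where c: "good_coeff (\<lambda>x. inverse (b x)) (\<lambda>i x. - (inverse (b x))\<^sup>2 * db i x) ddc"
    using good_coeff_inverse[OF g] by blast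
  have c': "W2_data (\<lambda>x. inverse (b x)) (\<lambda>i x. - (inverse (b x))\<^sup>2 * db i x) ddc"
    "W1_data (\<lambda>x. inverse (b x)) (\<lambda>i x. - (inverse (b x))\<^sup>2 * db i x)" "continuous_on (closure \<Omega>) (\<lambda>x. inverse (b x))"
    using c by (auto simp: good_coeff_def W2_data_def)
  have eq: "(\<lambda>x. b x *\<^sub>R (inverse (b x) *\<^sub>R v x)) = v"
    using pos by (simp add: fun_eq_iff less_imp_neq[THEN not_sym])
  have "AE x in lebesgue_on \<Omega>. - laplacian \<Omega> v x + liouville_potential b ddb x *\<^sub>R v x = 0"
    using v by (simp add: schroedinger_solution_def)
  then have "AE x in lebesgue_on \<Omega>. - div_a_grad \<Omega> a (\<lambda>x. inverse (b x) *\<^sub>R v x) x = 0"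
    using liouville_transform[OF g a H2_data_scaleR[OF c'(1) d], unfolded eq]
  proof eventually_elim
    case (elim x)
    have "b x *\<^sub>R (inverse (b x) *\<^sub>R v x) = v x" using eq by metis
    then show ?case using elim by simp
  qed
  moreover have "(\<lambda>x. inverse (b x) *\<^sub>R v x) \<in> H_space 2 \<Omega>"
    unfolding H_space_2_iff using H2_data_scaleR[OF c'(1) d] by blast
  moreover have "has_trace \<Omega> (\<lambda>x. inverse (b x) *\<^sub>R v x) (\<lambda>x. inverse (b x) *\<^sub>R \<phi> x)"
    using v by (intro has_trace_scaleR[OF c'(2,3)]) (simp add: schroedinger_solution_def)
  ultimately show ?thesis by (simp add: conductivity_solution_def)
qed

end

section \<open>Injectivity of the Schroedinger operator\<close>

lemma L2_mult_integrable:
  fixes f g :: "'a \<Rightarrow> real"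
  assumes "f \<in> L2_space M" "g \<in> L2_space M"
  shows "integrable M (\<lambda>x. f x * g x)"
proof (rule Bochner_Integration.integrable_bound[where f="\<lambda>x. (norm (f x))\<^sup>2 + (norm (g x))\<^sup>2"])
  have "\<bar>f x * g x\<bar> \<le> (f x)\<^sup>2 + (g x)\<^sup>2" for x
  proof -
    have "2 * \<bar>f x\<bar> * \<bar>g x\<bar> \<le> (f x)\<^sup>2 + (g x)\<^sup>2" using sum_squares_bound[of "\<bar>f x\<bar>" "\<bar>g x\<bar>"] by simp
    moreover have "0 \<le> \<bar>f x\<bar> * \<bar>g x\<bar>" by simp
    ultimately show ?thesis unfolding abs_mult by linarith
  qed
  then show "AE x in M. norm (f x * g x) \<le> norm ((norm (f x))\<^sup>2 + (norm (g x))\<^sup>2)"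
    by (intro AE_I2) simp
qed (use L2_spaceD[OF assms(1)] L2_spaceD[OF assms(2)] in auto)

context bounded_open
begin

lemma test_function_Linf:
  fixes \<psi> :: "'a \<Rightarrow> real"
  assumes "\<psi> \<in> test_functions \<Omega>" shows "\<psi> \<in> Linf"
proof -
  have "smooth \<psi>" using assms by (simp add: test_functions_iff)
  then show ?thesis by (intro continuous_closure_Linf smooth_continuous)
qed

text \<open>The classical derivative of a test function is a weak one because the integral of the
  partial derivative of a product with another test function vanishes.\<close>

lemma test_function_W1_data:
  fixes \<psi> :: "'a \<Rightarrow> real"
  assumes \<psi>: "\<psi> \<in> test_functions \<Omega>"
  shows "W1_data \<psi> (\<lambda>i x. frechet_derivative \<psi> (at x) i)"
  unfolding W1_data_def
proof (intro conjI ballI)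
  show "\<psi> \<in> Linf" by (rule test_function_Linf[OF \<psi>])
  fix i :: 'a assume i: "i \<in> Basis"
  show "(\<lambda>x. frechet_derivative \<psi> (at x) i) \<in> Linf" by (rule test_function_Linf[OF test_functions_partial[OF \<psi> i]])
  have s\<psi>: "smooth \<psi>" "smooth (\<lambda>x. frechet_derivative \<psi> (at x) i)"
    using \<psi> smooth_partial[OF _ i] by (auto simp: test_functions_iff)
  show "has_weak_deriv \<Omega> i \<psi> (\<lambda>x. frechet_derivative \<psi> (at x) i)"
    unfolding has_weak_deriv_def
  proof (intro conjI ballI)
    show "loc_integrable \<Omega> \<psi>" "loc_integrable \<Omega> (\<lambda>x. frechet_derivative \<psi> (at x) i)"
      by (intro loc_integrable_continuous smooth_continuous s\<psi>)+
    fix \<zeta> :: "'a \<Rightarrow> real" assume \<zeta>: "\<zeta> \<in> test_functions \<Omega>"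
    obtain K where K: "smooth \<zeta>" "compact K" "K \<subseteq> \<Omega>" "\<And>x. x \<notin> K \<Longrightarrow> \<zeta> x = 0"
      "\<And>x. x \<notin> K \<Longrightarrow> frechet_derivative \<zeta> (at x) = (\<lambda>h. 0)"
      using test_functionsE[OF \<zeta>] by metis
    have s\<zeta>: "smooth (\<lambda>x. frechet_derivative \<zeta> (at x) i)" by (rule smooth_partial[OF K(1) i])
    have c: "continuous_on S \<psi>" "continuous_on S \<zeta>" "continuous_on S (\<lambda>x. frechet_derivative \<psi> (at x) i)"
      "continuous_on S (\<lambda>x. frechet_derivative \<zeta> (at x) i)" for S
      by (intro smooth_continuous s\<psi> s\<zeta> K(1))+
    have i1: "integrable lborel (\<lambda>x. frechet_derivative \<zeta> (at x) i * \<psi> x)"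
      by (rule integrable_continuous_compact_support[OF _ K(2)]) (auto intro!: continuous_intros c simp: K(5))
    have i2: "integrable lborel (\<lambda>x. \<zeta> x * frechet_derivative \<psi> (at x) i)"
      by (rule integrable_continuous_compact_support[OF _ K(2)]) (auto intro!: continuous_intros c simp: K(4))
    let ?D = "\<lambda>x h. \<zeta> x * frechet_derivative \<psi> (at x) h + frechet_derivative \<zeta> (at x) h * \<psi> x"
    have D: "((\<lambda>x. \<zeta> x * \<psi> x) has_derivative ?D x) (at x)" for x
      by (rule has_derivative_mult[OF smooth_has_derivative[OF K(1)] smooth_has_derivative[OF s\<psi>(1)]])
    have cD: "continuous_on UNIV (\<lambda>x. ?D x i)" by (intro continuous_intros c)
    have zD: "?D x i = 0" if "x \<notin> K" for x using that K(4,5) by simp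
    obtain B where "\<And>x. norm (?D x i) \<le> B"
      using bounded_continuous_compact_support[OF cD K(2) zD] by metis
    then have "(\<integral>x. ?D x i \<partial>lborel) = 0"
      by (intro integral_partial_derivative_eq_0[OF D K(2) _ _ i]) (auto simp: K(4))
    then have e: "(\<integral>x. frechet_derivative \<zeta> (at x) i * \<psi> x \<partial>lborel) = - (\<integral>x. \<zeta> x * frechet_derivative \<psi> (at x) i \<partial>lborel)"
      using i1 i2 by simp
    have z: "\<And>x. x \<notin> \<Omega> \<Longrightarrow> \<zeta> x = 0" "\<And>x. x \<notin> \<Omega> \<Longrightarrow> frechet_derivative \<zeta> (at x) = (\<lambda>h. 0)"
      using K(3,4,5) by blast+
    have "(\<integral>x. frechet_derivative \<zeta> (at x) i * \<psi> x \<partial>lebesgue_on \<Omega>) = (\<integral>x. frechet_derivative \<zeta> (at x) i * \<psi> x \<partial>lborel)"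
      by (rule integral_lebesgue_on_transfer[OF opn]) (use i1 z in auto)
    moreover have "(\<integral>x. \<zeta> x * frechet_derivative \<psi> (at x) i \<partial>lebesgue_on \<Omega>) = (\<integral>x. \<zeta> x * frechet_derivative \<psi> (at x) i \<partial>lborel)"
      by (rule integral_lebesgue_on_transfer[OF opn]) (use i2 z in auto)
    ultimately show "(\<integral>x. frechet_derivative \<zeta> (at x) i *\<^sub>R \<psi> x \<partial>lebesgue_on \<Omega>) =
       - (\<integral>x. \<zeta> x *\<^sub>R frechet_derivative \<psi> (at x) i \<partial>lebesgue_on \<Omega>)"
      using e by simp
  qed
qed

lemma test_function_H1_data:
  fixes \<psi> :: "'a \<Rightarrow> 'b::euclidean_space"
  assumes \<psi>: "\<psi> \<in> test_functions \<Omega>"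
  shows "H1_data \<psi> (\<lambda>i x. frechet_derivative \<psi> (at x) i)"
proof -
  have sm: "smooth \<psi>" using \<psi> by (simp add: test_functions_iff)
  have c: "H1_data (\<lambda>x. \<psi> x \<bullet> j) (\<lambda>i x. frechet_derivative \<psi> (at x) i \<bullet> j)" for j
    using W1_imp_H1_data[OF test_function_W1_data[OF test_functions_bounded_linear[OF bounded_linear_inner_left \<psi>]]]
    by (simp add: frechet_derivative_bounded_linear[OF bounded_linear_inner_left sm])
  have L2: "f \<in> L2" if c: "\<And>j. j \<in> Basis \<Longrightarrow> (\<lambda>x. f x \<bullet> j) \<in> L2" for f :: "'a \<Rightarrow> 'b"
  proof -
    have "(\<lambda>x. \<Sum>j\<in>J. (f x \<bullet> j) *\<^sub>R j) \<in> L2" if "finite J" "J \<subseteq> Basis" for J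
      using that
    proof (induction J rule: finite_induct)
      case empty
      then show ?case by (simp add: L2_space_def)
    next
      case (insert j J)
      then show ?case
        using L2_space_add[OF L2_space_bounded_linear[OF bounded_linear_scaleR_left c[of j]] insert.IH]
        by (simp add: insert.hyps)
    qed
    from this[of Basis] show ?thesis by (simp add: euclidean_representation)
  qed
  show ?thesis
    unfolding H1_data_def
  proof (intro conjI ballI)
    show "\<psi> \<in> L2" by (rule L2) (use c in \<open>auto simp: H1_data_def\<close>)
    fix i :: 'a assume i: "i \<in> Basis"
    show "(\<lambda>x. frechet_derivative \<psi> (at x) i) \<in> L2" by (rule L2) (use c i in \<open>auto simp: H1_data_def\<close>)
    show "has_weak_deriv \<Omega> i \<psi> (\<lambda>x. frechet_derivative \<psi> (at x) i)"
      by (rule has_weak_deriv_componentwise[OF opn i]) (use c i in \<open>auto simp: H1_data_def\<close>)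
  qed
qed

text \<open>Integrating \<open>\<partial>\<^sub>i(x\<^sub>i \<psi>\<^sup>2 / b\<^sup>2)\<close> gives the Poincare inequality for \<open>\<psi> / b\<close>; here
  \<open>\<partial>\<^sub>i \<psi> - \<psi> \<partial>\<^sub>i b / b = b \<partial>\<^sub>i (\<psi> / b)\<close>.\<close>

lemma weighted_poincare:
  assumes g: "good_coeff b db ddb" and i: "i \<in> Basis"
  shows "\<exists>C\<ge>0. \<forall>\<psi>::'a \<Rightarrow> real. \<psi> \<in> test_functions \<Omega> \<longrightarrow>
    (\<integral>x. (\<psi> x)\<^sup>2 \<partial>lebesgue_on \<Omega>) \<le>
    C * (\<integral>x. (frechet_derivative \<psi> (at x) i - \<psi> x * db i x / b x)\<^sup>2 \<partial>lebesgue_on \<Omega>)"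
proof -
  obtain l u where lu: "l > 0" "\<And>x. x \<in> closure \<Omega> \<Longrightarrow> b x \<in> {l..u}" using good_coeff_bounds[OF g] by metis
  obtain R where R: "R > 0" "\<And>x. x \<in> \<Omega> \<Longrightarrow> norm x \<le> R" using bdd bounded_pos by metis
  have pos: "\<And>x. b x > 0" using g by (auto simp: good_coeff_def)
  have inl: "l \<le> b x \<and> b x \<le> u" if "x \<in> \<Omega>" for x using lu(2)[of x] that closure_subset by auto
  obtain ddc where c: "good_coeff (\<lambda>x. inverse (b x)) (\<lambda>i x. - (inverse (b x))\<^sup>2 * db i x) ddc"
    using good_coeff_inverse[OF g] by blast
  then have c1: "W1_data (\<lambda>x. inverse (b x)) (\<lambda>i x. - (inverse (b x))\<^sup>2 * db i x)"
    by (simp add: good_coeff_def W2_data_def)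
  have Lb: "(\<lambda>x. inverse (b x)) \<in> Linf" "db i \<in> Linf" using c1 g i by (auto simp: W1_data_def good_coeff_def W2_data_def)
  have c2: "has_weak_deriv \<Omega> i (\<lambda>x. inverse (b x) * inverse (b x))
    (\<lambda>x. inverse (b x) * (- (inverse (b x))\<^sup>2 * db i x) + (- (inverse (b x))\<^sup>2 * db i x) * inverse (b x))"
    using W1_data_mult[OF c1 c1] i by (simp add: W1_data_def)
  show ?thesis
  \<comment> \<open>With P = \<psi> / b and y = x_i / b, where |y| \<le> R / l, the cross term is
    split as 2 |y P h| \<le> P^2 / 2 + 2 y^2 h^2. Absorbing half of the integral of P^2 gives 4 (R /
    l)^2, and u^2 returns from P to \<psi>.\<close>
  proof (intro exI[of _ "u\<^sup>2 * (4 * (R / l)\<^sup>2)"] conjI allI impI)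
    fix \<psi> :: "'a \<Rightarrow> real" assume \<psi>: "\<psi> \<in> test_functions \<Omega>"
    define D where "D = (\<lambda>x. frechet_derivative \<psi> (at x) i)"
    define h where "h x = D x - \<psi> x * db i x / b x" for x
    have s\<psi>: "smooth \<psi>" using \<psi> by (simp add: test_functions_iff)
    have L: "\<psi> \<in> Linf" "D \<in> Linf"
      using test_function_W1_data[OF \<psi>] i by (auto simp: W1_data_def D_def)
    have Lh: "h \<in> Linf"
    proof -
      have "(\<lambda>x. D x + (-1) * (\<psi> x * (db i x * inverse (b x)))) \<in> Linf"
        by (intro Linf_space_add Linf_space_mult Linf_space_const L Lb)
      then show ?thesis by (simp add: h_def[abs_def] divide_inverse mult.assoc)
    qed
    have lin: "bounded_linear (\<lambda>x::'a. x \<bullet> i)" by (rule bounded_linear_inner_left)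
    have sx: "smooth (\<lambda>x::'a. x \<bullet> i)"
    proof
      fix k show "Ck_on k UNIV (\<lambda>x::'a. x \<bullet> i)"
        by (cases k) (auto intro!: continuous_intros Ck_on_const exI[of _ "\<lambda>x h. h \<bullet> i"] derivative_eq_intros)
    qed
    have fx: "frechet_derivative (\<lambda>x::'a. x \<bullet> i) (at x) h = h \<bullet> i" for x h
      using frechet_derivative_at[OF bounded_linear_imp_has_derivative[OF lin]] by metis
    have s2: "smooth (\<lambda>x. (x \<bullet> i) * \<psi> x)" using Ck_on_mult sx s\<psi> by blast
    \<comment> \<open>The weak derivative of 1 / b^2 is tested with x_i \<psi>^2; the derivative
      that falls on x_i produces the term to be estimated.\<close>
    let ?\<zeta> = "\<lambda>x. ((x \<bullet> i) * \<psi> x) * \<psi> x"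
    have \<zeta>: "?\<zeta> \<in> test_functions \<Omega>" by (rule test_functions_mult[OF \<psi> s2])
    have d\<zeta>: "frechet_derivative ?\<zeta> (at x) i = (\<psi> x)\<^sup>2 + 2 * (x \<bullet> i) * \<psi> x * D x" for x
      unfolding frechet_derivative_mult[OF s\<psi> s2] frechet_derivative_mult[OF s\<psi> sx] fx
      using i by (simp add: D_def power2_eq_square algebra_simps inner_same_Basis)
    let ?P = "\<lambda>x. \<psi> x * inverse (b x)"
    have LP: "?P \<in> Linf" by (intro Linf_space_mult L Lb)
    have Lx: "(\<lambda>x. x \<bullet> i) \<in> Linf" by (intro continuous_closure_Linf continuous_intros)
    have int1: "integrable (lebesgue_on \<Omega>) (\<lambda>x. (?P x)\<^sup>2)" using L2_spaceD(2)[OF Linf_imp_L2[OF LP]] by simp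
    have int2: "integrable (lebesgue_on \<Omega>) (\<lambda>x. (h x)\<^sup>2)" using L2_spaceD(2)[OF Linf_imp_L2[OF Lh]] by simp
    have int3: "integrable (lebesgue_on \<Omega>) (\<lambda>x. (x \<bullet> i) * inverse (b x) * ?P x * h x)"
      using L2_mult_integrable[OF Linf_imp_L2 Linf_imp_L2] Linf_space_mult[OF Linf_space_mult[OF Lx Lb(1)] LP] Lh by blast
    have int4: "integrable (lebesgue_on \<Omega>) (\<lambda>x. frechet_derivative ?\<zeta> (at x) i * (inverse (b x) * inverse (b x)))"
      using c2 integrable_test_mult[OF opn _ test_functions_partial[OF \<zeta> i]] by (fastforce simp: has_weak_deriv_def)
    have int5: "integrable (lebesgue_on \<Omega>) (\<lambda>x. ?\<zeta> x * (inverse (b x) * (- (inverse (b x))\<^sup>2 * db i x) + (- (inverse (b x))\<^sup>2 * db i x) * inverse (b x)))"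
      using c2 integrable_test_mult[OF opn _ \<zeta>] by (fastforce simp: has_weak_deriv_def)
    have "0 = (\<integral>x. frechet_derivative ?\<zeta> (at x) i * (inverse (b x) * inverse (b x)) \<partial>lebesgue_on \<Omega>) +
       (\<integral>x. ?\<zeta> x * (inverse (b x) * (- (inverse (b x))\<^sup>2 * db i x) + (- (inverse (b x))\<^sup>2 * db i x) * inverse (b x)) \<partial>lebesgue_on \<Omega>)"
      using has_weak_derivD[OF c2 \<zeta>] by simp
    also have "\<dots> = (\<integral>x. frechet_derivative ?\<zeta> (at x) i * (inverse (b x) * inverse (b x)) +
        ?\<zeta> x * (inverse (b x) * (- (inverse (b x))\<^sup>2 * db i x) + (- (inverse (b x))\<^sup>2 * db i x) * inverse (b x)) \<partial>lebesgue_on \<Omega>)"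
      by (rule Bochner_Integration.integral_add[OF int4 int5, symmetric])
    \<comment> \<open>The term with the derivative of 1 / b^2 and the one with the derivative of
      \<psi> combine into 2 x_i \<psi> h / b^2, so that only h survives.\<close>
    also have "\<dots> = (\<integral>x. (?P x)\<^sup>2 + 2 * ((x \<bullet> i) * inverse (b x) * ?P x * h x) \<partial>lebesgue_on \<Omega>)"
      unfolding d\<zeta> by (rule Bochner_Integration.integral_cong)
        (auto simp: h_def power2_eq_square divide_inverse algebra_simps)
    also have "\<dots> = (\<integral>x. (?P x)\<^sup>2 \<partial>lebesgue_on \<Omega>) + 2 * (\<integral>x. (x \<bullet> i) * inverse (b x) * ?P x * h x \<partial>lebesgue_on \<Omega>)"
      using int1 int3 by simp
    finally have e: "(\<integral>x. (?P x)\<^sup>2 \<partial>lebesgue_on \<Omega>) = - (2 * (\<integral>x. (x \<bullet> i) * inverse (b x) * ?P x * h x \<partial>lebesgue_on \<Omega>))"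
      by linarith
    also have "\<dots> = (\<integral>x. - 2 * ((x \<bullet> i) * inverse (b x) * ?P x * h x) \<partial>lebesgue_on \<Omega>)" by simp
    also have "\<dots> \<le> (\<integral>x. (?P x)\<^sup>2 / 2 + 2 * (R / l)\<^sup>2 * (h x)\<^sup>2 \<partial>lebesgue_on \<Omega>)"
    proof (rule integral_mono)
      fix x assume "x \<in> space (lebesgue_on \<Omega>)"
      then have x: "x \<in> \<Omega>" by simp
      define y where "y = (x \<bullet> i) * inverse (b x)"
      have "\<bar>x \<bullet> i\<bar> \<le> R" using Basis_le_norm[OF i, of x] R(2)[OF x] by linarith
      moreover have "inverse (b x) \<le> inverse l" using inl[OF x] lu(1) by (simp add: le_imp_inverse_le)
      moreover have "inverse (b x) \<ge> 0" using pos[of x] by simp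
      ultimately have "\<bar>y\<bar> \<le> R * inverse l" unfolding y_def abs_mult using R(1) by (intro mult_mono) auto
      then have y: "y\<^sup>2 \<le> (R / l)\<^sup>2" using abs_le_square_iff[of y "R / l"] lu(1) R(1) by (simp add: divide_inverse)
      have "- 2 * (y * ?P x * h x) \<le> (?P x)\<^sup>2 / 2 + 2 * y\<^sup>2 * (h x)\<^sup>2"
        using zero_le_power2[of "?P x / 2 + y * h x"] by (simp add: power2_sum power_mult_distrib power_divide algebra_simps)
      also have "\<dots> \<le> (?P x)\<^sup>2 / 2 + 2 * (R / l)\<^sup>2 * (h x)\<^sup>2"
        using y by (intro add_left_mono mult_right_mono mult_left_mono) auto
      finally show "- 2 * ((x \<bullet> i) * inverse (b x) * ?P x * h x) \<le> (?P x)\<^sup>2 / 2 + 2 * (R / l)\<^sup>2 * (h x)\<^sup>2"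
        by (simp add: y_def)
    qed (use int1 int2 int3 in auto)
    also have "\<dots> = (\<integral>x. (?P x)\<^sup>2 \<partial>lebesgue_on \<Omega>) / 2 + 2 * (R / l)\<^sup>2 * (\<integral>x. (h x)\<^sup>2 \<partial>lebesgue_on \<Omega>)"
      using int1 int2 by simp
    finally have P: "(\<integral>x. (?P x)\<^sup>2 \<partial>lebesgue_on \<Omega>) \<le> 4 * (R / l)\<^sup>2 * (\<integral>x. (h x)\<^sup>2 \<partial>lebesgue_on \<Omega>)" by simp
    have "(\<integral>x. (\<psi> x)\<^sup>2 \<partial>lebesgue_on \<Omega>) \<le> (\<integral>x. u\<^sup>2 * (?P x)\<^sup>2 \<partial>lebesgue_on \<Omega>)"
    proof (rule integral_mono)
      fix x assume "x \<in> space (lebesgue_on \<Omega>)"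
      then have x: "x \<in> \<Omega>" by simp
      have "(\<psi> x)\<^sup>2 = (b x)\<^sup>2 * (?P x)\<^sup>2" using pos[of x] by (simp add: power_mult_distrib field_simps)
      also have "\<dots> \<le> u\<^sup>2 * (?P x)\<^sup>2" using inl[OF x] pos[of x] by (intro mult_right_mono power_mono) auto
      finally show "(\<psi> x)\<^sup>2 \<le> u\<^sup>2 * (?P x)\<^sup>2" .
    qed (use L2_spaceD(2)[OF Linf_imp_L2[OF L(1)]] int1 in auto)
    also have "\<dots> \<le> u\<^sup>2 * (4 * (R / l)\<^sup>2 * (\<integral>x. (h x)\<^sup>2 \<partial>lebesgue_on \<Omega>))"
      using P by (simp add: mult_left_mono)
    finally show "(\<integral>x. (\<psi> x)\<^sup>2 \<partial>lebesgue_on \<Omega>) \<le>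
      u\<^sup>2 * (4 * (R / l)\<^sup>2) * (\<integral>x. (frechet_derivative \<psi> (at x) i - \<psi> x * db i x / b x)\<^sup>2 \<partial>lebesgue_on \<Omega>)"
      by (simp add: h_def D_def mult.assoc)
  qed auto
qed

text \<open>In each direction the weak derivative of db / b, which is ddb / b - (db / b)^2, is
  tested with \<psi>^2. This turns the cross term of the expanded square into the integral of
  \<psi>^2 (ddb / b - (db / b)^2); the quadratic terms in db cancel and the potential
  remains.\<close>

lemma schroedinger_energy:
  fixes \<psi> :: "'a \<Rightarrow> real"
  assumes g: "good_coeff b db ddb" and \<psi>: "\<psi> \<in> test_functions \<Omega>"
  shows "(\<Sum>i\<in>Basis. \<integral>x. (frechet_derivative \<psi> (at x) i)\<^sup>2 \<partial>lebesgue_on \<Omega>) +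
      (\<integral>x. liouville_potential b ddb x * (\<psi> x)\<^sup>2 \<partial>lebesgue_on \<Omega>) =
    (\<Sum>i\<in>Basis. \<integral>x. (frechet_derivative \<psi> (at x) i - \<psi> x * db i x / b x)\<^sup>2 \<partial>lebesgue_on \<Omega>)"
proof -
  define D where "D i x = frechet_derivative \<psi> (at x) i" for i x
  have pos: "\<And>x. b x > 0" using g by (auto simp: good_coeff_def)
  obtain ddc where c: "good_coeff (\<lambda>x. inverse (b x)) (\<lambda>i x. - (inverse (b x))\<^sup>2 * db i x) ddc"
    using good_coeff_inverse[OF g] by blast
  then have c1: "W1_data (\<lambda>x. inverse (b x)) (\<lambda>i x. - (inverse (b x))\<^sup>2 * db i x)"
    by (simp add: good_coeff_def W2_data_def)
  have W: "W1_data (db i) (ddb i)" if "i \<in> Basis" for i using g that by (auto simp: good_coeff_def W2_data_def)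
  have Lb: "(\<lambda>x. inverse (b x)) \<in> Linf" "\<And>i. i \<in> Basis \<Longrightarrow> db i \<in> Linf" "\<And>i. i \<in> Basis \<Longrightarrow> ddb i i \<in> Linf"
    using c1 W by (auto simp: W1_data_def)
  have s\<psi>: "smooth \<psi>" using \<psi> by (simp add: test_functions_iff)
  have L\<psi>: "\<psi> \<in> Linf" "\<And>i. i \<in> Basis \<Longrightarrow> D i \<in> Linf"
    using test_function_W1_data[OF \<psi>] by (auto simp: W1_data_def D_def[abs_def])
  have Lint: "integrable (lebesgue_on \<Omega>) f" if "f \<in> Linf" for f
    using L2_mult_integrable[OF Linf_imp_L2[OF that] Linf_imp_L2[OF Linf_space_const[of 1]]] by simp
  have key: "(\<integral>x. (D i x)\<^sup>2 \<partial>lebesgue_on \<Omega>) + (\<integral>x. (ddb i i x * inverse (b x)) * (\<psi> x)\<^sup>2 \<partial>lebesgue_on \<Omega>) =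
     (\<integral>x. (D i x - \<psi> x * db i x / b x)\<^sup>2 \<partial>lebesgue_on \<Omega>)" if i: "i \<in> Basis" for i
  proof -
    let ?dd = "\<lambda>x. db i x * (- (inverse (b x))\<^sup>2 * db i x) + ddb i i x * inverse (b x)"
    have wd: "has_weak_deriv \<Omega> i (\<lambda>x. db i x * inverse (b x)) ?dd"
      using W1_data_mult[OF W[OF i] c1] i by (simp add: W1_data_def)
    let ?\<zeta> = "\<lambda>x. \<psi> x * \<psi> x"
    have \<zeta>: "?\<zeta> \<in> test_functions \<Omega>" by (rule test_functions_mult[OF \<psi> s\<psi>])
    have d\<zeta>: "frechet_derivative ?\<zeta> (at x) i = 2 * \<psi> x * D i x" for x
      unfolding frechet_derivative_mult[OF s\<psi> s\<psi>] by (simp add: D_def)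
    have e: "(\<integral>x. (2 * \<psi> x * D i x) * (db i x * inverse (b x)) \<partial>lebesgue_on \<Omega>) = - (\<integral>x. (\<psi> x * \<psi> x) * ?dd x \<partial>lebesgue_on \<Omega>)"
      using has_weak_derivD[OF wd \<zeta>] unfolding d\<zeta> .
    have m1: "(\<lambda>x. D i x * D i x) \<in> Linf" "(\<lambda>x. (ddb i i x * inverse (b x)) * (\<psi> x * \<psi> x)) \<in> Linf"
      "(\<lambda>x. (2 * \<psi> x * D i x) * (db i x * inverse (b x))) \<in> Linf"
      "(\<lambda>x. (\<psi> x * \<psi> x) * (db i x * ((-1) * (inverse (b x) * inverse (b x)) * db i x) + ddb i i x * inverse (b x))) \<in> Linf"
      by (intro Linf_space_mult Linf_space_add Linf_space_const L\<psi> Lb i)+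
    then have m2: "(\<lambda>x. (\<psi> x * \<psi> x) * ?dd x) \<in> Linf" by (simp add: power2_eq_square)
    have "(\<integral>x. (D i x - \<psi> x * db i x / b x)\<^sup>2 \<partial>lebesgue_on \<Omega>) =
      (\<integral>x. ((D i x * D i x + (ddb i i x * inverse (b x)) * (\<psi> x * \<psi> x)) - (2 * \<psi> x * D i x) * (db i x * inverse (b x)))
        - (\<psi> x * \<psi> x) * ?dd x \<partial>lebesgue_on \<Omega>)"
      by (rule Bochner_Integration.integral_cong) (auto simp: power2_eq_square divide_inverse algebra_simps)
    also have "\<dots> = ((\<integral>x. D i x * D i x \<partial>lebesgue_on \<Omega>) + (\<integral>x. (ddb i i x * inverse (b x)) * (\<psi> x * \<psi> x) \<partial>lebesgue_on \<Omega>)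
       - (\<integral>x. (2 * \<psi> x * D i x) * (db i x * inverse (b x)) \<partial>lebesgue_on \<Omega>)) - (\<integral>x. (\<psi> x * \<psi> x) * ?dd x \<partial>lebesgue_on \<Omega>)"
      using Lint[OF m1(1)] Lint[OF m1(2)] Lint[OF m1(3)] Lint[OF m2]
      by (simp only: Bochner_Integration.integral_diff Bochner_Integration.integral_add Bochner_Integration.integrable_diff Bochner_Integration.integrable_add)
    finally show ?thesis using e by (simp add: power2_eq_square)
  qed
  have m: "(\<lambda>x. (ddb i i x * inverse (b x)) * (\<psi> x * \<psi> x)) \<in> Linf" if "i \<in> Basis" for i
    by (intro Linf_space_mult L\<psi> Lb that)
  have "(\<integral>x. liouville_potential b ddb x * (\<psi> x)\<^sup>2 \<partial>lebesgue_on \<Omega>) =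
      (\<integral>x. (\<Sum>i\<in>Basis. (ddb i i x * inverse (b x)) * (\<psi> x * \<psi> x)) \<partial>lebesgue_on \<Omega>)"
    by (simp add: liouville_potential_def divide_inverse sum_distrib_right power2_eq_square)
  also have "\<dots> = (\<Sum>i\<in>Basis. \<integral>x. (ddb i i x * inverse (b x)) * (\<psi> x)\<^sup>2 \<partial>lebesgue_on \<Omega>)"
    using Lint[OF m] by (subst Bochner_Integration.integral_sum) (auto simp: power2_eq_square)
  finally have "(\<Sum>i\<in>Basis. \<integral>x. (D i x)\<^sup>2 \<partial>lebesgue_on \<Omega>) + (\<integral>x. liouville_potential b ddb x * (\<psi> x)\<^sup>2 \<partial>lebesgue_on \<Omega>) =
     (\<Sum>i\<in>Basis. (\<integral>x. (D i x)\<^sup>2 \<partial>lebesgue_on \<Omega>) + (\<integral>x. (ddb i i x * inverse (b x)) * (\<psi> x)\<^sup>2 \<partial>lebesgue_on \<Omega>))"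
    by (simp add: sum.distrib)
  also have "\<dots> = (\<Sum>i\<in>Basis. \<integral>x. (D i x - \<psi> x * db i x / b x)\<^sup>2 \<partial>lebesgue_on \<Omega>)"
    by (rule sum.cong) (simp_all add: key)
  finally show ?thesis by (simp add: D_def)
qed

text \<open>Young's inequality with a free weight: the factor of g can be made small at the expense
  of f, which will be an error that tends to zero.\<close>

lemma integral_mult_le:
  fixes f g :: "'a \<Rightarrow> real"
  assumes f: "f \<in> L2" and g: "g \<in> L2" and t: "t > 0"
  shows "(\<integral>x. f x * g x \<partial>lebesgue_on \<Omega>) \<le>
    (\<integral>x. (f x)\<^sup>2 \<partial>lebesgue_on \<Omega>) / (2 * t) + t / 2 * (\<integral>x. (g x)\<^sup>2 \<partial>lebesgue_on \<Omega>)"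
proof -
  have i: "integrable (lebesgue_on \<Omega>) (\<lambda>x. (f x)\<^sup>2)" "integrable (lebesgue_on \<Omega>) (\<lambda>x. (g x)\<^sup>2)"
    using L2_spaceD(2)[OF f] L2_spaceD(2)[OF g] by auto
  have "(\<integral>x. f x * g x \<partial>lebesgue_on \<Omega>) \<le> (\<integral>x. (f x)\<^sup>2 / (2 * t) + t / 2 * (g x)\<^sup>2 \<partial>lebesgue_on \<Omega>)"
  proof (rule integral_mono)
    fix x
    have "0 \<le> (f x - t * g x)\<^sup>2" by simp
    then have "2 * t * (f x * g x) \<le> (f x)\<^sup>2 + t\<^sup>2 * (g x)\<^sup>2"
      by (simp add: power2_diff power_mult_distrib algebra_simps)
    then show "f x * g x \<le> (f x)\<^sup>2 / (2 * t) + t / 2 * (g x)\<^sup>2"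
      using t by (simp add: field_simps power2_eq_square)
  qed (use L2_mult_integrable[OF f g] i in auto)
  then show ?thesis using i by simp
qed

text \<open>By the weak equation for w, the energy of \<psi> k is the energy form applied to the
  error \<psi> k - w and \<psi> k. The weighted inequality of Young leaves an error term that
  vanishes as k grows plus t times a constant, and the Poincare inequality carries this bound over
  to the square integral of w. Then t tends to zero.\<close>

lemma schroedinger_unique_real:
  fixes w :: "'a \<Rightarrow> real"
  assumes g: "good_coeff b db ddb" and w: "H2_data w dw ddw"
    and eq: "AE x in lebesgue_on \<Omega>. (\<Sum>i\<in>Basis. ddw i i x) = liouville_potential b ddb x * w x"
    and \<psi>: "\<And>k::nat. \<psi> k \<in> test_functions \<Omega>"
    and lim: "(\<lambda>k. H1_sq (\<lambda>x. \<psi> k x - w x) (\<lambda>i x. frechet_derivative (\<psi> k) (at x) i - dw i x)) \<longlonglongrightarrow> 0"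
  shows "AE x in lebesgue_on \<Omega>. w x = 0"
proof -
  let ?q = "liouville_potential b ddb"
  let ?I = "\<lambda>f. \<integral>x. f x \<partial>lebesgue_on \<Omega>"
  have q: "?q \<in> Linf" by (rule liouville_potential_Linf[OF g])
  obtain Q where Q: "AE x in lebesgue_on \<Omega>. \<bar>?q x\<bar> \<le> Q" using q by (auto simp: Linf_space_def)
  have Lw: "w \<in> L2" "\<And>i. i \<in> Basis \<Longrightarrow> dw i \<in> L2" "\<And>i. i \<in> Basis \<Longrightarrow> ddw i i \<in> L2"
    and wdw: "\<And>i. i \<in> Basis \<Longrightarrow> has_weak_deriv \<Omega> i (dw i) (ddw i i)"
    using w by (auto simp: H2_data_def H1_data_def)
  obtain i0 :: 'a where i0: "i0 \<in> Basis" using nonempty_Basis by blast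
  obtain C where C: "C \<ge> 0" "\<And>\<psi>::'a \<Rightarrow> real. \<psi> \<in> test_functions \<Omega> \<Longrightarrow>
    ?I (\<lambda>x. (\<psi> x)\<^sup>2) \<le> C * ?I (\<lambda>x. (frechet_derivative \<psi> (at x) i0 - \<psi> x * db i0 x / b x)\<^sup>2)"
    using weighted_poincare[OF g i0] by blast
  define N where "N k = H1_sq (\<lambda>x. \<psi> k x - w x) (\<lambda>i x. frechet_derivative (\<psi> k) (at x) i - dw i x)" for k
  define Nw where "Nw = H1_sq w dw"
  have Nw: "Nw \<ge> 0" by (simp add: Nw_def H1_sq_nonneg)
  have bound: "?I (\<lambda>x. (w x)\<^sup>2) \<le> 2 * C * ((1 + Q\<^sup>2) / (2 * t) * N k + t * N k + t * Nw) + 2 * N k" if t: "t > 0" for t k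
  proof -
    define D where "D i x = frechet_derivative (\<psi> k) (at x) i" for i x
    define r where "r x = \<psi> k x - w x" for x
    define dr where "dr i x = D i x - dw i x" for i x
    have H\<psi>: "H1_data (\<psi> k) D" using test_function_H1_data[OF \<psi>] by (simp add: D_def[abs_def])
    then have L\<psi>: "\<psi> k \<in> L2" "\<And>i. i \<in> Basis \<Longrightarrow> D i \<in> L2" by (auto simp: H1_data_def)
    have Hw: "H1_data w dw" using w by (simp add: H2_data_def)
    have Hr: "H1_data r dr" using H1_data_diff[OF H\<psi> Hw] by (simp add: r_def[abs_def] dr_def[abs_def])
    then have Lr: "r \<in> L2" "\<And>i. i \<in> Basis \<Longrightarrow> dr i \<in> L2" by (auto simp: H1_data_def)
    have Nk: "N k = ?I (\<lambda>x. (r x)\<^sup>2) + (\<Sum>i\<in>Basis. ?I (\<lambda>x. (dr i x)\<^sup>2))"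
      by (simp add: N_def H1_sq_def r_def dr_def D_def)
    have pos: "?I (\<lambda>x. (f x)\<^sup>2) \<ge> 0" for f :: "'a \<Rightarrow> real" by (intro integral_nonneg_AE) auto
    have N0: "N k \<ge> ?I (\<lambda>x. (r x)\<^sup>2)" "N k \<ge> 0" using pos by (auto simp: Nk intro!: sum_nonneg add_nonneg_nonneg)
    have q\<psi>: "(\<lambda>x. ?q x * \<psi> k x) \<in> L2" "(\<lambda>x. ?q x * w x) \<in> L2" "(\<lambda>x. ?q x * r x) \<in> L2"
      using L2_space_scaleR[OF q L\<psi>(1)] L2_space_scaleR[OF q Lw(1)] L2_space_scaleR[OF q Lr(1)] by auto
    \<comment> \<open>The equation for w, tested with \<psi> k: each weak derivative of
      \<open>dw i\<close> is paired with the same test function, and the sum of the second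
      derivatives is replaced by the potential times w.\<close>
    have weak: "(\<Sum>i\<in>Basis. ?I (\<lambda>x. D i x * dw i x)) + ?I (\<lambda>x. \<psi> k x * (?q x * w x)) = 0"
    proof -
      have "(\<Sum>i\<in>Basis. ?I (\<lambda>x. D i x * dw i x)) = (\<Sum>i\<in>Basis. - ?I (\<lambda>x. \<psi> k x * ddw i i x))"
        using has_weak_derivD[OF wdw \<psi>] by (intro sum.cong) (auto simp: D_def)
      also have "\<dots> = - ?I (\<lambda>x. \<Sum>i\<in>Basis. \<psi> k x * ddw i i x)"
        using L2_mult_integrable[OF L\<psi>(1) Lw(3)] by (subst Bochner_Integration.integral_sum) (auto simp: sum_negf)
      also have "?I (\<lambda>x. \<Sum>i\<in>Basis. \<psi> k x * ddw i i x) = ?I (\<lambda>x. \<psi> k x * (?q x * w x))"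
        by (rule integral_lebesgue_on_cong_AE(1)[OF opn])
          (use eq in \<open>auto simp: sum_distrib_left[symmetric] elim!: eventually_mono\<close>)
      finally show ?thesis by simp
    qed
    define E where "E = (\<Sum>i\<in>Basis. ?I (\<lambda>x. (D i x)\<^sup>2)) + ?I (\<lambda>x. ?q x * (\<psi> k x)\<^sup>2)"
    \<comment> \<open>Subtracting the weak equation replaces one of the two factors \<psi> k in the
      energy by the error r.\<close>
    have "E = (\<Sum>i\<in>Basis. ?I (\<lambda>x. dr i x * D i x)) + ?I (\<lambda>x. (?q x * r x) * \<psi> k x)"
    proof -
      have 1: "?I (\<lambda>x. dr i x * D i x) = ?I (\<lambda>x. (D i x)\<^sup>2) - ?I (\<lambda>x. D i x * dw i x)" if i: "i \<in> Basis" for i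
      proof -
        have "?I (\<lambda>x. dr i x * D i x) = ?I (\<lambda>x. D i x * D i x - D i x * dw i x)"
          by (simp add: dr_def algebra_simps)
        also have "\<dots> = ?I (\<lambda>x. D i x * D i x) - ?I (\<lambda>x. D i x * dw i x)"
          by (intro Bochner_Integration.integral_diff L2_mult_integrable L\<psi> Lw i)
        finally show ?thesis by (simp add: power2_eq_square)
      qed
      have 2: "?I (\<lambda>x. (?q x * r x) * \<psi> k x) = ?I (\<lambda>x. ?q x * (\<psi> k x)\<^sup>2) - ?I (\<lambda>x. \<psi> k x * (?q x * w x))"
      proof -
        have "?I (\<lambda>x. (?q x * r x) * \<psi> k x) = ?I (\<lambda>x. (?q x * \<psi> k x) * \<psi> k x - \<psi> k x * (?q x * w x))"
          by (simp add: r_def algebra_simps)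
        also have "\<dots> = ?I (\<lambda>x. (?q x * \<psi> k x) * \<psi> k x) - ?I (\<lambda>x. \<psi> k x * (?q x * w x))"
          by (intro Bochner_Integration.integral_diff L2_mult_integrable L\<psi> q\<psi>)
        finally show ?thesis by (simp add: power2_eq_square mult.assoc)
      qed
      have "(\<Sum>i\<in>Basis. ?I (\<lambda>x. dr i x * D i x)) = (\<Sum>i\<in>Basis. ?I (\<lambda>x. (D i x)\<^sup>2) - ?I (\<lambda>x. D i x * dw i x))"
        by (rule sum.cong) (simp_all add: 1)
      also have "\<dots> = (\<Sum>i\<in>Basis. ?I (\<lambda>x. (D i x)\<^sup>2)) - (\<Sum>i\<in>Basis. ?I (\<lambda>x. D i x * dw i x))" by (rule sum_subtractf)
      finally show ?thesis using 2 weak unfolding E_def by linarith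
    qed
    also have "\<dots> \<le> (\<Sum>i\<in>Basis. ?I (\<lambda>x. (dr i x)\<^sup>2) / (2 * t) + t / 2 * ?I (\<lambda>x. (D i x)\<^sup>2)) +
        (?I (\<lambda>x. (?q x * r x)\<^sup>2) / (2 * t) + t / 2 * ?I (\<lambda>x. (\<psi> k x)\<^sup>2))"
      by (intro add_mono sum_mono integral_mult_le Lr L\<psi> q\<psi> t)
    also have "\<dots> = ((\<Sum>i\<in>Basis. ?I (\<lambda>x. (dr i x)\<^sup>2)) + ?I (\<lambda>x. (?q x * r x)\<^sup>2)) / (2 * t) +
        t / 2 * (?I (\<lambda>x. (\<psi> k x)\<^sup>2) + (\<Sum>i\<in>Basis. ?I (\<lambda>x. (D i x)\<^sup>2)))"
      by (simp add: sum.distrib sum_divide_distrib sum_distrib_left add_divide_distrib distrib_left)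
    also have "\<dots> \<le> ((1 + Q\<^sup>2) * N k) / (2 * t) + t / 2 * (2 * N k + 2 * Nw)"
    proof (rule add_mono[OF divide_right_mono mult_left_mono])
      have "?I (\<lambda>x. (?q x * r x)\<^sup>2) \<le> ?I (\<lambda>x. Q\<^sup>2 * (r x)\<^sup>2)"
      proof (rule integral_mono_AE)
        show "AE x in lebesgue_on \<Omega>. (?q x * r x)\<^sup>2 \<le> Q\<^sup>2 * (r x)\<^sup>2"
          using Q
        proof eventually_elim
          case (elim x)
          then have "(?q x)\<^sup>2 \<le> Q\<^sup>2" using abs_le_square_iff[of "?q x" Q] by simp
          then show ?case by (simp add: power_mult_distrib mult_right_mono)
        qed
      qed (use L2_spaceD(2)[OF q\<psi>(3)] L2_spaceD(2)[OF Lr(1)] in auto)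
      also have "\<dots> = Q\<^sup>2 * ?I (\<lambda>x. (r x)\<^sup>2)" by simp
      also have "\<dots> \<le> Q\<^sup>2 * N k" using N0 by (intro mult_left_mono) auto
      finally have "?I (\<lambda>x. (?q x * r x)\<^sup>2) \<le> Q\<^sup>2 * N k" .
      moreover have "(\<Sum>i\<in>Basis. ?I (\<lambda>x. (dr i x)\<^sup>2)) \<le> N k" using pos by (simp add: Nk)
      ultimately show "(\<Sum>i\<in>Basis. ?I (\<lambda>x. (dr i x)\<^sup>2)) + ?I (\<lambda>x. (?q x * r x)\<^sup>2) \<le> (1 + Q\<^sup>2) * N k"
        by (simp add: distrib_right)
      have "H1_sq (\<lambda>x. r x + w x) (\<lambda>i x. dr i x + dw i x) \<le> 2 * H1_sq r dr + 2 * H1_sq w dw"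
        by (rule H1_sq_add_le[OF Hr Hw])
      then show "?I (\<lambda>x. (\<psi> k x)\<^sup>2) + (\<Sum>i\<in>Basis. ?I (\<lambda>x. (D i x)\<^sup>2)) \<le> 2 * N k + 2 * Nw"
        by (simp add: H1_sq_def r_def dr_def Nw_def N_def D_def)
    qed (use t in auto)
    finally have E: "E \<le> (1 + Q\<^sup>2) / (2 * t) * N k + t * N k + t * Nw" using t by (simp add: algebra_simps)
    have "?I (\<lambda>x. (\<psi> k x)\<^sup>2) \<le> C * ?I (\<lambda>x. (D i0 x - \<psi> k x * db i0 x / b x)\<^sup>2)"
      using C(2)[OF \<psi>] by (simp add: D_def)
    \<comment> \<open>The Poincare inequality uses the direction i0; the squares in the other
      directions are nonnegative and complete the sum to the energy.\<close>
    also have "\<dots> \<le> C * (\<Sum>i\<in>Basis. ?I (\<lambda>x. (D i x - \<psi> k x * db i x / b x)\<^sup>2))"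
      using i0 pos by (intro mult_left_mono C(1) member_le_sum) auto
    also have "(\<Sum>i\<in>Basis. ?I (\<lambda>x. (D i x - \<psi> k x * db i x / b x)\<^sup>2)) = E"
      using schroedinger_energy[OF g \<psi>] by (simp add: E_def D_def)
    also have "C * E \<le> C * ((1 + Q\<^sup>2) / (2 * t) * N k + t * N k + t * Nw)" by (rule mult_left_mono[OF E C(1)])
    finally have P: "?I (\<lambda>x. (\<psi> k x)\<^sup>2) \<le> C * ((1 + Q\<^sup>2) / (2 * t) * N k + t * N k + t * Nw)" .
    have "?I (\<lambda>x. (w x)\<^sup>2) \<le> ?I (\<lambda>x. 2 * (\<psi> k x)\<^sup>2 + 2 * (r x)\<^sup>2)"
    proof (rule integral_mono)
      fix x show "(w x)\<^sup>2 \<le> 2 * (\<psi> k x)\<^sup>2 + 2 * (r x)\<^sup>2"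
        using norm_add_sq_le[of "\<psi> k x" "- r x"] by (simp add: r_def power2_commute[of "w x"])
    qed (use L2_spaceD(2)[OF Lw(1)] L2_spaceD(2)[OF L\<psi>(1)] L2_spaceD(2)[OF Lr(1)] in auto)
    also have "\<dots> = 2 * ?I (\<lambda>x. (\<psi> k x)\<^sup>2) + 2 * ?I (\<lambda>x. (r x)\<^sup>2)"
      using L2_spaceD(2)[OF L\<psi>(1)] L2_spaceD(2)[OF Lr(1)] by simp
    finally show ?thesis using P N0 by linarith
  qed
  have lim': "N \<longlonglongrightarrow> 0" using lim by (simp add: N_def[abs_def])
  have le_t: "?I (\<lambda>x. (w x)\<^sup>2) \<le> 2 * C * (t * Nw)" if t: "t > 0" for t
  proof -
    have "(\<lambda>k. 2 * C * ((1 + Q\<^sup>2) / (2 * t) * N k + t * N k + t * Nw) + 2 * N k) \<longlonglongrightarrow>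
       2 * C * ((1 + Q\<^sup>2) / (2 * t) * 0 + t * 0 + t * Nw) + 2 * 0"
      by (intro tendsto_intros lim')
    then show ?thesis
      using LIMSEQ_le_const[of _ _ "?I (\<lambda>x. (w x)\<^sup>2)"] bound[OF t] by fastforce
  qed
  have "?I (\<lambda>x. (w x)\<^sup>2) \<le> 0"
  proof (rule field_le_epsilon)
    fix e :: real assume e: "e > 0"
    define M where "M = 2 * C * Nw"
    have M: "M \<ge> 0" using C(1) Nw by (simp add: M_def)
    \<comment> \<open>The choice t = e / (M + 1) makes the right-hand side at most e; M itself may
      be zero.\<close>
    have "?I (\<lambda>x. (w x)\<^sup>2) \<le> 2 * C * ((e / (M + 1)) * Nw)" by (rule le_t) (use e M in auto)
    also have "\<dots> = e * (M / (M + 1))" by (simp add: M_def)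
    also have "\<dots> \<le> e * 1" using e M by (intro mult_left_mono) auto
    finally show "?I (\<lambda>x. (w x)\<^sup>2) \<le> 0 + e" by simp
  qed
  moreover have "?I (\<lambda>x. (w x)\<^sup>2) \<ge> 0" by (intro integral_nonneg_AE) auto
  ultimately have z: "?I (\<lambda>x. (w x)\<^sup>2) = 0" by linarith
  have "integrable (lebesgue_on \<Omega>) (\<lambda>x. (w x)\<^sup>2)" using L2_spaceD(2)[OF Lw(1)] by simp
  from integral_nonneg_eq_0_iff_AE[OF this] z show ?thesis by simp
qed

text \<open>This serves to pass from complex approximation to the approximation of real and
  imaginary parts.\<close>

lemma H1_sq_contraction:
  fixes r :: "'a \<Rightarrow> 'b::euclidean_space" and T :: "'b \<Rightarrow> real"
  assumes T: "bounded_linear T" "\<And>x. \<bar>T x\<bar> \<le> norm x" and r: "H1_data r dr"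
  shows "H1_sq (\<lambda>x. T (r x)) (\<lambda>i x. T (dr i x)) \<le> H1_sq r dr"
proof -
  have *: "(\<integral>x. (norm (T (f x)))\<^sup>2 \<partial>lebesgue_on \<Omega>) \<le> (\<integral>x. (norm (f x))\<^sup>2 \<partial>lebesgue_on \<Omega>)" if "f \<in> L2" for f :: "'a \<Rightarrow> 'b"
  proof (rule integral_mono)
    show "integrable (lebesgue_on \<Omega>) (\<lambda>x. (norm (T (f x)))\<^sup>2)"
      by (rule L2_spaceD(2)[OF L2_space_bounded_linear[OF T(1) that]])
    show "integrable (lebesgue_on \<Omega>) (\<lambda>x. (norm (f x))\<^sup>2)" by (rule L2_spaceD(2)[OF that])
    show "(norm (T (f x)))\<^sup>2 \<le> (norm (f x))\<^sup>2" for x using T(2)[of "f x"] by (intro power_mono) auto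
  qed
  show ?thesis
    unfolding H1_sq_def using r by (intro add_mono sum_mono *) (auto simp: H1_data_def)
qed

text \<open>The potential is real, so the real and the imaginary part of w solve the equation
  separately, and the images of the approximating test functions approximate them.\<close>

lemma liouville_potential_Q_class:
  assumes g: "good_coeff b db ddb"
  shows "liouville_potential b ddb \<in> Q_class \<Omega>"
  unfolding Q_class_def
proof (intro CollectI conjI ballI impI)
  show "liouville_potential b ddb \<in> Linf" by (rule liouville_potential_Linf[OF g])
  fix w :: "'a \<Rightarrow> complex" assume w: "w \<in> H10_space \<Omega> \<inter> H_space 2 \<Omega>"
    and eq: "AE x in lebesgue_on \<Omega>. - laplacian \<Omega> w x + liouville_potential b ddb x *\<^sub>R w x = 0"
  obtain dw ddw where d: "H2_data w dw ddw" using w unfolding Int_iff H_space_2_iff by blast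
  obtain \<psi> where \<psi>: "\<And>k::nat. \<psi> k \<in> test_functions \<Omega>" and lim: "(\<lambda>k. H1_norm \<Omega> (\<lambda>x. \<psi> k x - w x)) \<longlonglongrightarrow> 0"
    using w by (auto simp: H10_space_def)
  have sm: "smooth (\<psi> k)" for k using \<psi> by (simp add: test_functions_iff)
  have diff: "H1_data (\<lambda>x. \<psi> k x - w x) (\<lambda>i x. frechet_derivative (\<psi> k) (at x) i - dw i x)" for k
    using H1_data_diff[OF test_function_H1_data[OF \<psi>]] d by (simp add: H2_data_def)
  have lim': "(\<lambda>k. H1_sq (\<lambda>x. \<psi> k x - w x) (\<lambda>i x. frechet_derivative (\<psi> k) (at x) i - dw i x)) \<longlonglongrightarrow> 0"
    by (rule H1_norm_tendsto_0_iff[THEN iffD1, OF diff lim])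
  have *: "AE x in lebesgue_on \<Omega>. T (w x) = 0" if T: "bounded_linear T" "\<And>x. \<bar>T x\<bar> \<le> norm x" for T :: "complex \<Rightarrow> real"
  proof (rule schroedinger_unique_real[OF g H2_data_bounded_linear[OF T(1) d]])
    show "AE x in lebesgue_on \<Omega>. (\<Sum>i\<in>Basis. T (ddw i i x)) = liouville_potential b ddb x * T (w x)"
      using eq laplacian_AE[OF d]
    proof eventually_elim
      case (elim x)
      have l: "linear T" by (rule bounded_linear.linear[OF T(1)])
      have "(\<Sum>i\<in>Basis. ddw i i x) = liouville_potential b ddb x *\<^sub>R w x" using elim by simp
      then have "T (\<Sum>i\<in>Basis. ddw i i x) = T (liouville_potential b ddb x *\<^sub>R w x)" by simp
      then show ?case by (simp add: linear_sum[OF l] linear_scale[OF l])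
    qed
    show "(\<lambda>x. T (\<psi> k x)) \<in> test_functions \<Omega>" for k by (rule test_functions_bounded_linear[OF T(1) \<psi>])
    have l: "linear T" by (rule bounded_linear.linear[OF T(1)])
    have "(\<lambda>k. H1_sq (\<lambda>x. T (\<psi> k x - w x)) (\<lambda>i x. T (frechet_derivative (\<psi> k) (at x) i - dw i x))) \<longlonglongrightarrow> 0"
      by (rule Lim_null_comparison[OF _ lim'])
        (use H1_sq_contraction[OF T diff] in \<open>auto simp: H1_sq_nonneg intro!: always_eventually\<close>)
    then show "(\<lambda>k. H1_sq (\<lambda>x. T (\<psi> k x) - T (w x)) (\<lambda>i x. frechet_derivative (\<lambda>x. T (\<psi> k x)) (at x) i - T (dw i x))) \<longlonglongrightarrow> 0"
      by (simp add: linear_diff[OF l] frechet_derivative_bounded_linear[OF T(1) sm])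
  qed
  from *[OF bounded_linear_Re abs_Re_le_cmod] *[OF bounded_linear_Im abs_Im_le_cmod]
  show "AE x in lebesgue_on \<Omega>. w x = 0"
    by eventually_elim (simp add: complex_eq_iff)
qed

end

section \<open>Approximation by test functions\<close>

text \<open>For bounded f the mollification error is at most 2 B, so its square is at most 2 B times
  its modulus and L1 convergence suffices.\<close>

lemma conv_mol_L2:
  fixes f :: "'a::euclidean_space \<Rightarrow> real"
  assumes f: "integrable lborel f" and B: "\<And>x. \<bar>f x\<bar> \<le> B"
  shows "(\<lambda>n. \<integral>x. (conv (mol n) f x - f x)\<^sup>2 \<partial>lborel) \<longlonglongrightarrow> 0"
    "integrable lborel (\<lambda>x. (conv (mol n) f x - f x)\<^sup>2)"
proof -
  have i: "integrable lborel (\<lambda>x. conv (mol n) f x - f x)" for n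
    using integrable_conv[OF _ f, of "1 / (real n + 1)"] f by simp
  have b: "\<bar>conv (mol n) f x - f x\<bar> \<le> 2 * B" for n x
  proof -
    have bb: "- B \<le> f y \<and> f y \<le> B" for y using B[of y] by (simp add: abs_le_iff)
    have "- B \<le> conv (mol n) f x" "conv (mol n) f x \<le> B"
      using conv_mollifier_between[OF _ f, of "1 / (real n + 1)" x "- B" B] bb by auto
    then show ?thesis using bb[of x] by auto
  qed
  have ii: "integrable lborel (\<lambda>x. (conv (mol n) f x - f x) * (conv (mol n) f x - f x))" for n
    by (rule integrable_bounded_mult[OF i _ b]) (use i in auto)
  then show "integrable lborel (\<lambda>x. (conv (mol n) f x - f x)\<^sup>2)" by (simp add: power2_eq_square)
  show "(\<lambda>n. \<integral>x. (conv (mol n) f x - f x)\<^sup>2 \<partial>lborel) \<longlonglongrightarrow> 0"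
  proof (rule Lim_null_comparison)
    show "(\<lambda>n. 2 * B * (\<integral>x. \<bar>conv (mol n) f x - f x\<bar> \<partial>lborel)) \<longlonglongrightarrow> 0"
      using tendsto_mult_right_zero[OF conv_mol_L1[OF f], of "2 * B"] by simp
    show "eventually (\<lambda>n. norm (\<integral>x. (conv (mol n) f x - f x)\<^sup>2 \<partial>lborel) \<le>
        2 * B * (\<integral>x. \<bar>conv (mol n) f x - f x\<bar> \<partial>lborel)) sequentially"
    proof (rule always_eventually, rule allI)
      fix n
      have "norm (\<integral>x. (conv (mol n) f x - f x)\<^sup>2 \<partial>lborel) = (\<integral>x. (conv (mol n) f x - f x)\<^sup>2 \<partial>lborel)"
        by (simp add: integral_nonneg_AE)
      also have "\<dots> \<le> (\<integral>x. 2 * B * \<bar>conv (mol n) f x - f x\<bar> \<partial>lborel)"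
      proof (rule integral_mono)
        fix x show "(conv (mol n) f x - f x)\<^sup>2 \<le> 2 * B * \<bar>conv (mol n) f x - f x\<bar>"
          using mult_right_mono[OF b, of "\<bar>conv (mol n) f x - f x\<bar>" n x] by (simp add: power2_eq_square)
      qed (use ii i in \<open>auto simp: power2_eq_square\<close>)
      finally show "norm (\<integral>x. (conv (mol n) f x - f x)\<^sup>2 \<partial>lborel) \<le>
        2 * B * (\<integral>x. \<bar>conv (mol n) f x - f x\<bar> \<partial>lborel)" by simp
    qed
  qed
qed

lemma conv_mollifier_eq_0:
  fixes f :: "'a::euclidean_space \<Rightarrow> real"
  assumes r: "r > 0" and z: "\<And>y. dist x y < r \<Longrightarrow> f y = 0"
  shows "conv (mollifier r) f x = 0"
proof -
  have "mollifier r (x - y) * f y = 0" for y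
    using z[of y] mollifier_eq_0[of r "x - y"] r by (cases "dist x y < r") (auto simp: dist_norm)
  then show ?thesis by (simp only: conv_def) simp
qed

text \<open>Truncation at the essential bound turns a bound almost everywhere into one at every
  point, which the L2 convergence of mollifications asks for.\<close>

lemma borel_rep_bounded:
  assumes \<Omega>: "open \<Omega>" and K: "K \<subseteq> \<Omega>" and c: "c \<in> Linf_space (lebesgue_on \<Omega>)" and rep: "borel_rep K c c0"
  obtains c1 B where "borel_rep K c c1" "\<And>x. \<bar>c1 x\<bar> \<le> B"
proof -
  obtain B where B: "B \<ge> 0" "AE x in lborel. \<bar>c0 x\<bar> \<le> B" by (rule borel_rep_Linf_bounded[OF \<Omega> K c rep])
  have i: "integrable lborel c0" and m[measurable]: "c0 \<in> borel_measurable borel"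
    and z: "\<And>x. x \<notin> K \<Longrightarrow> c0 x = 0" and ae: "AE x in lborel. x \<in> K \<longrightarrow> c x = c0 x"
    using rep by (auto simp: borel_rep_def)
  let ?c1 = "\<lambda>x. max (- B) (min B (c0 x))"
  show thesis
  proof (rule that)
    show "borel_rep K c ?c1"
      unfolding borel_rep_def
    proof (intro conjI allI impI)
      show "integrable lborel ?c1"
        by (rule Bochner_Integration.integrable_bound[OF i]) (use B(1) in \<open>auto intro!: AE_I2\<close>)
      show "?c1 x = 0" if "x \<notin> K" for x using z[OF that] B(1) by simp
      show "AE x in lborel. x \<in> K \<longrightarrow> c x = ?c1 x"
        using ae B(2) by eventually_elim auto
    qed
    show "\<bar>?c1 x\<bar> \<le> B" for x using B(1) by auto
  qed
qed

context bounded_open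
begin

text \<open>The zero extension of z is mollified. As z and its derivatives vanish off K, no jump
  arises at the edge of K, and mollification commutes with differentiation at every point.\<close>

lemma compact_support_approx:
  fixes z :: "'a \<Rightarrow> real"
  assumes W: "W1_data z dz" and K: "compact K" "K \<subseteq> \<Omega>"
    and zero: "\<And>x. x \<in> \<Omega> - K \<Longrightarrow> z x = 0" "\<And>i x. i \<in> Basis \<Longrightarrow> x \<in> \<Omega> - K \<Longrightarrow> dz i x = 0"
    and e: "e > 0"
  shows "\<exists>\<psi>::'a \<Rightarrow> real. \<psi> \<in> test_functions \<Omega> \<and>
    H1_sq (\<lambda>x. \<psi> x - z x) (\<lambda>i x. frechet_derivative \<psi> (at x) i - dz i x) < e"
proof -
  have wd: "has_weak_deriv \<Omega> i z (dz i)" and L: "z \<in> Linf" "dz i \<in> Linf" if "i \<in> Basis" for i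
    using W that by (auto simp: W1_data_def)
  obtain i0 :: 'a where i0: "i0 \<in> Basis" using nonempty_Basis by blast
  have ex: "\<exists>f1 B. borel_rep K f f1 \<and> (\<forall>x. \<bar>f1 x\<bar> \<le> B)" if "f \<in> Linf" "loc_integrable \<Omega> f" for f
    using loc_integrable_borel_rep[OF that(2) K] borel_rep_bounded[OF opn K(2) that(1)] by metis
  have loc: "loc_integrable \<Omega> z" "\<And>i. i \<in> Basis \<Longrightarrow> loc_integrable \<Omega> (dz i)"
    using wd i0 by (auto simp: has_weak_deriv_def)
  obtain z0 B where z0: "borel_rep K z z0" "\<And>x. \<bar>z0 x\<bar> \<le> B" using ex[OF L(1)[OF i0] loc(1)] by blast
  have "\<forall>i\<in>Basis. \<exists>f1 B. borel_rep K (dz i) f1 \<and> (\<forall>x. \<bar>f1 x\<bar> \<le> B)" using ex[OF L(2) loc(2)] by blast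
  then obtain dz0 B' where dz0: "\<And>i. i \<in> Basis \<Longrightarrow> borel_rep K (dz i) (dz0 i)"
      "\<And>i x. i \<in> Basis \<Longrightarrow> \<bar>dz0 i x\<bar> \<le> B' i" by metis
  \<comment> \<open>Two nested neighbourhoods: the mollified functions vanish off K', and at points
    of K' the commutation with the derivative needs balls that stay in the yet larger K2.\<close>
  obtain \<delta> K' where K': "\<delta> > 0" "compact K'" "K \<subseteq> K'" "K' \<subseteq> \<Omega>" "\<And>x. x \<in> K \<Longrightarrow> cball x \<delta> \<subseteq> K'"
    using compact_neighbourhood[OF K opn] by metis
  obtain \<delta>2 K2 where K2: "\<delta>2 > 0" "compact K2" "K' \<subseteq> K2" "K2 \<subseteq> \<Omega>" "\<And>x. x \<in> K' \<Longrightarrow> cball x \<delta>2 \<subseteq> K2"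
    using compact_neighbourhood[OF K'(2,4) opn] by metis
  \<comment> \<open>Since f is zero on \<Omega> - K, the representative on K, being zero off K, also
    represents f on K2.\<close>
  have up: "borel_rep K2 f f0" if "borel_rep K f f0" "\<And>x. x \<in> \<Omega> - K \<Longrightarrow> f x = 0" for f f0
  proof -
    have "AE x in lborel. x \<in> K \<longrightarrow> f x = f0 x" using that(1) by (simp add: borel_rep_def)
    then have "AE x in lborel. x \<in> K2 \<longrightarrow> f x = f0 x"
    proof eventually_elim
      case (elim x)
      then show ?case using that K2(4) by (cases "x \<in> K") (auto simp: borel_rep_def)
    qed
    then show ?thesis using that(1) K2(3) K'(3) by (auto simp: borel_rep_def)
  qed
  have int: "integrable lborel z0" "\<And>i. i \<in> Basis \<Longrightarrow> integrable lborel (dz0 i)"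
    using z0(1) dz0(1) by (auto simp: borel_rep_def)
  define S where "S n = (\<integral>x. (conv (mol n) z0 x - z0 x)\<^sup>2 \<partial>lborel) +
     (\<Sum>i\<in>Basis. \<integral>x. (conv (mol n) (dz0 i) x - dz0 i x)\<^sup>2 \<partial>lborel)" for n
  have "S \<longlonglongrightarrow> 0 + (\<Sum>i\<in>(Basis::'a set). 0)"
    unfolding S_def
    by (intro tendsto_add tendsto_sum conv_mol_L2(1)[OF int(1) z0(2)] conv_mol_L2(1)[OF int(2) dz0(2)])
  then have "S \<longlonglongrightarrow> 0" by simp
  then have "eventually (\<lambda>n. S n < e) sequentially" using e by (rule order_tendstoD)
  moreover have "eventually (\<lambda>n. 1 / (real n + 1) < min \<delta> \<delta>2) sequentially"
    by (rule eventually_mol_radius) (use K'(1) K2(1) in auto)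
  ultimately have "eventually (\<lambda>n. S n < e \<and> 1 / (real n + 1) < min \<delta> \<delta>2) sequentially" by eventually_elim simp
  then obtain n where n: "S n < e" "1 / (real n + 1) < \<delta>" "1 / (real n + 1) < \<delta>2"
    by (auto simp: eventually_sequentially)
  let ?\<psi> = "conv (mol n) z0"
  have out: "conv (mol n) f0 x = 0" if "borel_rep K f f0" "x \<notin> K'" for f f0 x
  proof (rule conv_mollifier_eq_0)
    fix y assume y: "dist x y < 1 / (real n + 1)"
    have "x \<in> cball y \<delta>" using y n(2) by (simp add: dist_commute)
    then have "y \<notin> K" using K'(5)[of y] that(2) by blast
    then show "f0 y = 0" using that(1) by (simp add: borel_rep_def)
  qed simp
  have sm: "smooth ?\<psi>" by (rule smooth_conv_mol[OF int(1)])
  have test: "?\<psi> \<in> test_functions \<Omega>"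
    unfolding test_functions_iff using sm out[OF z0(1)] K' by blast
  have d: "frechet_derivative ?\<psi> (at x) i = conv (mol n) (dz0 i) x" if i: "i \<in> Basis" for i x
  proof (cases "x \<in> K'")
    case True
    have "cball x (1 / (real n + 1)) \<subseteq> K2" using K2(5)[OF True] n(3) subset_cball[of "1 / (real n + 1)" \<delta>2 x] by auto
    then show ?thesis
      by (intro frechet_derivative_conv_weak[OF opn wd[OF i] i K2(2,4) up[OF z0(1)] up[OF dz0(1)[OF i]]])
        (use zero i in auto)
  next
    case False
    then show ?thesis
      using frechet_derivative_zero_outside_closed[OF compact_imp_closed[OF K'(2)] out[OF z0(1)] False] out[OF dz0(1)[OF i] False] by simp
  qed
  have tr: "(\<integral>x. (norm (conv (mol n) f0 x - f x))\<^sup>2 \<partial>lebesgue_on \<Omega>) = (\<integral>x. (conv (mol n) f0 x - f0 x)\<^sup>2 \<partial>lborel)"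
    if rep: "borel_rep K f f0" and zf: "\<And>x. x \<in> \<Omega> - K \<Longrightarrow> f x = 0" for f f0
  proof (rule integral_lebesgue_on_transfer[OF opn])
    have i: "integrable lborel f0" using rep by (simp add: borel_rep_def)
    have [measurable]: "f0 \<in> borel_measurable borel" "conv (mol n) f0 \<in> borel_measurable borel"
      using i smooth_borel_measurable[OF smooth_conv_mol[OF i]] by auto
    show "(\<lambda>x. (conv (mol n) f0 x - f0 x)\<^sup>2) \<in> borel_measurable borel" by measurable
    show "(conv (mol n) f0 x - f0 x)\<^sup>2 = 0" if "x \<notin> \<Omega>" for x
    proof -
      have "x \<notin> K'" "x \<notin> K" using that K'(4) K(2) by auto
      then show ?thesis using out[OF rep, of x] rep by (simp add: borel_rep_def)
    qed
    have "AE x in lborel. x \<in> K \<longrightarrow> f x = f0 x" using rep by (simp add: borel_rep_def)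
    then show "AE x in lborel. x \<in> \<Omega> \<longrightarrow> (norm (conv (mol n) f0 x - f x))\<^sup>2 = (conv (mol n) f0 x - f0 x)\<^sup>2"
    proof eventually_elim
      case (elim x)
      then show ?case using zf[of x] rep by (cases "x \<in> K") (auto simp: borel_rep_def)
    qed
  qed
  have "H1_sq (\<lambda>x. ?\<psi> x - z x) (\<lambda>i x. frechet_derivative ?\<psi> (at x) i - dz i x) = S n"
    unfolding H1_sq_def S_def
    using tr[OF z0(1) zero(1)] tr[OF dz0(1) zero(2)] by (auto simp: d intro!: arg_cong2[where f="(+)"] sum.cong)
  then show ?thesis using test n(1) by auto
qed

end

text \<open>A function of t / d alone: zero for t \<le> d, rising to 1, with a continuous derivative
  as the chain rule asks. By this scaling t times the derivative is bounded uniformly in d.\<close>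

definition cutoff :: "real \<Rightarrow> real \<Rightarrow> real" where
  "cutoff d t = (max 0 (t - d))\<^sup>2 / ((max 0 (t - d))\<^sup>2 + d\<^sup>2)"

definition cutoff_deriv :: "real \<Rightarrow> real \<Rightarrow> real" where
  "cutoff_deriv d t = 2 * max 0 (t - d) * d\<^sup>2 / ((max 0 (t - d))\<^sup>2 + d\<^sup>2)\<^sup>2"

lemma has_real_derivative_pos_part_sq:
  "((\<lambda>s::real. (max 0 s)\<^sup>2) has_real_derivative 2 * max 0 s) (at s)"
proof -
  consider "s > 0" | "s = 0" | "s < 0" by linarith
  then show ?thesis
  proof cases
    case 1
    have "((\<lambda>s. s\<^sup>2) has_real_derivative 2 * max 0 s) (at s)" using 1 by (auto intro!: derivative_eq_intros)
    then show ?thesis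
      by (rule DERIV_cong_ev[THEN iffD1, rotated 3])
        (use 1 eventually_nhds_in_open[of "{0<..}" s] in \<open>auto elim!: eventually_mono\<close>)
  next
    case 2
    have "((\<lambda>h::real. (max 0 h)\<^sup>2 / h) \<longlongrightarrow> 0) (at 0)"
    proof (rule Lim_null_comparison)
      show "eventually (\<lambda>h::real. norm ((max 0 h)\<^sup>2 / h) \<le> \<bar>h\<bar>) (at 0)"
        by (rule always_eventually) (auto simp: max_def power2_eq_square)
      show "((\<lambda>h::real. \<bar>h\<bar>) \<longlongrightarrow> 0) (at 0)" by (rule tendsto_rabs_zero[OF tendsto_ident_at])
    qed
    then show ?thesis using 2 by (simp add: DERIV_def)
  next
    case 3
    have "((\<lambda>s. 0) has_real_derivative 2 * max 0 s) (at s)" using 3 by simp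
    then show ?thesis
      by (rule DERIV_cong_ev[THEN iffD1, rotated 3])
        (use 3 eventually_nhds_in_open[of "{..<0}" s] in \<open>auto elim!: eventually_mono\<close>)
  qed
qed

lemma cutoff_has_derivative:
  assumes "d > 0" shows "(cutoff d has_real_derivative cutoff_deriv d t) (at t)"
proof -
  let ?s = "\<lambda>t. (max 0 (t - d))\<^sup>2"
  have s: "(?s has_real_derivative 2 * max 0 (t - d)) (at t)"
  proof -
    have "((\<lambda>t. t - d) has_real_derivative 1) (at t)" by (auto intro!: derivative_eq_intros)
    from DERIV_chain2[OF has_real_derivative_pos_part_sq this] show ?thesis by simp
  qed
  have pos: "?s t + d\<^sup>2 > 0" using assms by (intro add_nonneg_pos) auto
  have "((\<lambda>t. ?s t / (?s t + d\<^sup>2)) has_real_derivative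
      (2 * max 0 (t - d) * (?s t + d\<^sup>2) - ?s t * (2 * max 0 (t - d))) / ((?s t + d\<^sup>2) * (?s t + d\<^sup>2))) (at t)"
    by (rule DERIV_divide[OF s DERIV_cong[OF DERIV_add[OF s DERIV_const]]]) (use pos in auto)
  then show ?thesis
    unfolding cutoff_def[abs_def] cutoff_deriv_def by (simp add: power2_eq_square algebra_simps)
qed

lemma continuous_on_cutoff_deriv:
  assumes "d > 0" shows "continuous_on A (cutoff_deriv d)"
proof -
  have "(max 0 (t - d))\<^sup>2 + d\<^sup>2 \<noteq> 0" for t using assms by (metis add_nonneg_pos less_numeral_extra(3) zero_le_power2 zero_less_power)
  then show ?thesis unfolding cutoff_deriv_def[abs_def] by (auto intro!: continuous_intros)
qed

lemma cutoff_eq_0: "t \<le> d \<Longrightarrow> cutoff d t = 0" "t \<le> d \<Longrightarrow> cutoff_deriv d t = 0"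
  by (simp_all add: cutoff_def cutoff_deriv_def)

lemma cutoff_bounds:
  assumes "d > 0" shows "0 \<le> cutoff d t" "cutoff d t \<le> 1"
proof -
  have "(max 0 (t - d))\<^sup>2 + d\<^sup>2 > 0" using assms by (intro add_nonneg_pos) auto
  then show "0 \<le> cutoff d t" "cutoff d t \<le> 1" by (simp_all add: cutoff_def)
qed

text \<open>With s = t - d and A = s^2 + d^2 one has s (s + d) \<le> 2 A and d^2 \<le> A; the
  derivative carries a factor 2 over A^2, hence 4. The point is that d does not occur in the
  bound.\<close>

lemma cutoff_deriv_bound:
  assumes d: "d > 0" and t: "t \<ge> 0" shows "\<bar>cutoff_deriv d t\<bar> * t \<le> 4"
proof (cases "t \<le> d")
  case True
  then show ?thesis by (simp add: cutoff_eq_0)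
next
  case False
  define s where "s = t - d"
  have s: "s > 0" "t = s + d" using False by (auto simp: s_def)
  define A where "A = s\<^sup>2 + d\<^sup>2"
  have A: "A > 0" using d by (auto simp: A_def intro!: add_nonneg_pos)
  have "2 * s * d \<le> A" using sum_squares_bound[of s d] by (simp add: A_def)
  moreover have "0 \<le> s * d" using s d by simp
  moreover have "s * s \<le> A" by (simp add: A_def power2_eq_square)
  ultimately have "s * (s + d) \<le> 2 * A" by (simp add: distrib_left)
  moreover have "d\<^sup>2 \<le> A" by (simp add: A_def)
  ultimately have "(s * (s + d)) * d\<^sup>2 \<le> (2 * A) * A" by (rule mult_mono) (use s d A in auto)
  then have "2 * s * d\<^sup>2 * (s + d) \<le> 4 * A\<^sup>2" by (simp add: power2_eq_square algebra_simps)
  then have "2 * s * d\<^sup>2 * (s + d) / A\<^sup>2 \<le> 4" using A by (simp add: pos_divide_le_eq)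
  moreover have "\<bar>cutoff_deriv d t\<bar> * t = 2 * s * d\<^sup>2 * (s + d) / A\<^sup>2"
    using s d A by (simp add: cutoff_deriv_def A_def)
  ultimately show ?thesis by simp
qed

lemma cutoff_tendsto:
  assumes t: "t > 0" and d: "d \<longlonglongrightarrow> (0::real)"
  shows "(\<lambda>n. cutoff (d n) t) \<longlonglongrightarrow> 1" "(\<lambda>n. cutoff_deriv (d n) t) \<longlonglongrightarrow> 0"
proof -
  have "(\<lambda>n. (max 0 (t - d n))\<^sup>2 / ((max 0 (t - d n))\<^sup>2 + (d n)\<^sup>2)) \<longlonglongrightarrow> (max 0 (t - 0))\<^sup>2 / ((max 0 (t - 0))\<^sup>2 + 0\<^sup>2)"
    by (intro tendsto_intros d) (use t in auto)
  then show "(\<lambda>n. cutoff (d n) t) \<longlonglongrightarrow> 1" using t by (simp add: cutoff_def[abs_def])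
  have "(\<lambda>n. 2 * max 0 (t - d n) * (d n)\<^sup>2 / ((max 0 (t - d n))\<^sup>2 + (d n)\<^sup>2)\<^sup>2) \<longlonglongrightarrow>
      2 * max 0 (t - 0) * 0\<^sup>2 / ((max 0 (t - 0))\<^sup>2 + 0\<^sup>2)\<^sup>2"
    by (intro tendsto_intros d) (use t in auto)
  then show "(\<lambda>n. cutoff_deriv (d n) t) \<longlonglongrightarrow> 0" using t by (simp add: cutoff_deriv_def[abs_def])
qed

context bounded_open
begin

lemma Linf_finite_bound:
  assumes "finite S" "S \<subseteq> Linf"
  shows "\<exists>M\<ge>0. AE x in lebesgue_on \<Omega>. \<forall>f\<in>S. \<bar>f x\<bar> \<le> M"
  using assms
proof (induction S rule: finite_induct)
  case empty
  then show ?case by (auto intro!: exI[of _ 0])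
next
  case (insert f S)
  then obtain M where M: "M \<ge> 0" "AE x in lebesgue_on \<Omega>. \<forall>f\<in>S. \<bar>f x\<bar> \<le> M" by auto
  obtain B where B: "AE x in lebesgue_on \<Omega>. \<bar>f x\<bar> \<le> B" using insert.prems by (auto simp: Linf_space_def)
  have "AE x in lebesgue_on \<Omega>. \<forall>g\<in>insert f S. \<bar>g x\<bar> \<le> max M B"
    using M(2) B by eventually_elim (auto simp: le_max_iff_disj)
  then show ?case using M(1) by (intro exI[of _ "max M B"]) auto
qed

text \<open>Dominated convergence; constants are integrable since \<Omega> has finite
  measure.\<close>

lemma L2_tendsto_0_bounded:
  fixes h :: "nat \<Rightarrow> 'a \<Rightarrow> real"
  assumes h: "\<And>n. h n \<in> Linf" and B: "\<And>n. AE x in lebesgue_on \<Omega>. \<bar>h n x\<bar> \<le> B"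
    and lim: "\<And>x. x \<in> \<Omega> \<Longrightarrow> (\<lambda>n. h n x) \<longlonglongrightarrow> 0"
  shows "(\<lambda>n. \<integral>x. (norm (h n x))\<^sup>2 \<partial>lebesgue_on \<Omega>) \<longlonglongrightarrow> 0"
proof -
  interpret finite_measure "lebesgue_on \<Omega>" by (rule finite_measure_Omega)
  have "(\<lambda>n. \<integral>x. (norm (h n x))\<^sup>2 \<partial>lebesgue_on \<Omega>) \<longlonglongrightarrow> (\<integral>x. 0 \<partial>lebesgue_on \<Omega>)"
  proof (rule integral_dominated_convergence[where w="\<lambda>x. B\<^sup>2"])
    show "(\<lambda>x. (norm (h n x))\<^sup>2) \<in> borel_measurable (lebesgue_on \<Omega>)" for n
      using h[of n] by (auto simp: Linf_space_def)
    show "AE x in lebesgue_on \<Omega>. (\<lambda>n. (norm (h n x))\<^sup>2) \<longlonglongrightarrow> 0"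
    proof (rule AE_I2)
      fix x assume "x \<in> space (lebesgue_on \<Omega>)"
      then have "(\<lambda>n. h n x) \<longlonglongrightarrow> 0" using lim by simp
      from tendsto_power[OF tendsto_norm[OF this], of 2] show "(\<lambda>n. (norm (h n x))\<^sup>2) \<longlonglongrightarrow> 0" by simp
    qed
    show "AE x in lebesgue_on \<Omega>. norm ((norm (h n x))\<^sup>2) \<le> B\<^sup>2" for n
      using B[of n] by eventually_elim (auto simp: abs_le_square_iff[symmetric])
  qed auto
  then show ?thesis by simp
qed

text \<open>With \<open>p = w\<^sup>2 + |\<nabla>w|\<^sup>2\<close> one has \<open>|w| \<le> \<surd>p\<close> and \<open>|\<nabla>p| \<le> C \<surd>p\<close>, so cutting \<open>w\<close> off where \<open>p \<le> d\<close>
  costs a gradient error \<open>w F'(p) \<nabla>p\<close> that is bounded uniformly in \<open>d\<close> and tends to \<open>0\<close> pointwise.\<close>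

lemma zero_boundary_approx:
  fixes w :: "'a \<Rightarrow> real"
  assumes W: "W2_data w dw ddw" and cw: "continuous_on (closure \<Omega>) w"
    and cdw: "\<And>i. i \<in> Basis \<Longrightarrow> continuous_on (closure \<Omega>) (dw i)"
    and zero: "\<And>x. x \<in> frontier \<Omega> \<Longrightarrow> w x = 0" "\<And>i x. i \<in> Basis \<Longrightarrow> x \<in> frontier \<Omega> \<Longrightarrow> dw i x = 0"
    and e: "e > 0"
  shows "\<exists>\<psi>::'a \<Rightarrow> real. \<psi> \<in> test_functions \<Omega> \<and>
    H1_sq (\<lambda>x. \<psi> x - w x) (\<lambda>i x. frechet_derivative \<psi> (at x) i - dw i x) < e"
proof -
  define p where "p x = w x * w x + (\<Sum>i\<in>Basis. dw i x * dw i x)" for x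
  define dp where "dp j x = (w x * dw j x + dw j x * w x) + (\<Sum>i\<in>Basis. dw i x * ddw i j x + ddw i j x * dw i x)" for j x
  have W1: "W1_data w dw" "\<And>i. i \<in> Basis \<Longrightarrow> W1_data (dw i) (ddw i)" using W by (auto simp: W2_data_def)
  have Wp: "W1_data p dp"
    unfolding p_def[abs_def] dp_def[abs_def]
    by (intro W1_data_add W1_data_mult W1_data_sum W1) auto
  have cp: "continuous_on (closure \<Omega>) p" unfolding p_def[abs_def] by (intro continuous_intros cw cdw)
  have cp': "continuous_on \<Omega> p" by (rule continuous_on_subset[OF cp closure_subset])
  have pw: "w x * w x \<le> p x" "0 \<le> p x" for x
    by (auto simp: p_def intro!: sum_nonneg add_nonneg_nonneg)
  have pdw: "dw i x * dw i x \<le> p x" if "i \<in> Basis" for i x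
  proof -
    have "dw i x * dw i x \<le> (\<Sum>i\<in>Basis. dw i x * dw i x)" using that by (intro member_le_sum) auto
    then show ?thesis by (simp add: p_def add_increasing)
  qed
  have sw: "\<bar>w x\<bar> \<le> sqrt (p x)" for x using pw(1)[of x] by (intro real_le_rsqrt) (simp add: power2_eq_square)
  have sdw: "\<bar>dw i x\<bar> \<le> sqrt (p x)" if "i \<in> Basis" for i x
    using pdw[OF that, of x] by (intro real_le_rsqrt) (simp add: power2_eq_square)
  obtain P where P: "\<And>x. x \<in> closure \<Omega> \<Longrightarrow> \<bar>p x\<bar> \<le> P" using continuous_closure_bounded[OF cp] by metis
  have range: "p x \<in> {0..P}" if "x \<in> \<Omega>" for x using P[of x] pw(2)[of x] that closure_subset by auto
  \<comment> \<open>Collecting w and all derivatives up to second order in a finite set gives one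
    null set and one bound M for all of them.\<close>
  define S where "S = insert w (dw ` Basis \<union> (\<lambda>(i, j). ddw i j) ` (Basis \<times> Basis))"
  have "finite S" "S \<subseteq> Linf" using W1 by (auto simp: S_def W1_data_def)
  then obtain M where M: "M \<ge> 0" "AE x in lebesgue_on \<Omega>. \<forall>f\<in>S. \<bar>f x\<bar> \<le> M" using Linf_finite_bound by blast
  \<comment> \<open>The derivative of p consists of 2 w \<open>dw j\<close> and, for every basis
    vector i, of 2 \<open>dw i\<close> \<open>ddw i j\<close>; in each product one factor is at most
    sqrt p and the other at most M.\<close>
  define C where "C = 2 * M + real DIM('a) * (2 * M)"
  have C0: "C \<ge> 0" using M(1) by (simp add: C_def)
  have dpb: "AE x in lebesgue_on \<Omega>. \<bar>dp j x\<bar> \<le> C * sqrt (p x)" if j: "j \<in> Basis" for j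
    using M(2)
  proof eventually_elim
    case (elim x)
    have m: "\<bar>dw j x\<bar> \<le> M" "\<And>i. i \<in> Basis \<Longrightarrow> \<bar>ddw i j x\<bar> \<le> M" using elim j by (auto simp: S_def)
    have 1: "\<bar>w x * dw j x\<bar> \<le> sqrt (p x) * M" unfolding abs_mult using sw m pw(2) M(1) by (intro mult_mono) auto
    have 2: "\<bar>dw i x * ddw i j x\<bar> \<le> sqrt (p x) * M" if "i \<in> Basis" for i
      unfolding abs_mult using sdw[OF that] m(2)[OF that] pw(2) M(1) by (intro mult_mono) auto
    have "\<bar>\<Sum>i\<in>Basis. dw i x * ddw i j x + ddw i j x * dw i x\<bar> \<le> (\<Sum>i\<in>(Basis::'a set). 2 * (sqrt (p x) * M))"
    proof (rule order_trans[OF sum_abs sum_mono])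
      fix i :: 'a assume "i \<in> Basis"
      then show "\<bar>dw i x * ddw i j x + ddw i j x * dw i x\<bar> \<le> 2 * (sqrt (p x) * M)"
        using 2[of i] by (simp add: mult.commute[of "ddw i j x"] abs_mult)
    qed
    also have "\<dots> = real DIM('a) * (2 * M) * sqrt (p x)" by simp
    finally have "\<bar>dp j x\<bar> \<le> \<bar>w x * dw j x + dw j x * w x\<bar> + real DIM('a) * (2 * M) * sqrt (p x)"
      unfolding dp_def by linarith
    also have "\<bar>w x * dw j x + dw j x * w x\<bar> \<le> 2 * M * sqrt (p x)"
      using 1 by (simp add: mult.commute[of "dw j x"] mult_ac abs_mult)
    finally show "\<bar>dp j x\<bar> \<le> C * sqrt (p x)" by (simp add: C_def distrib_right)
  qed
  define d where "d n = 1 / (real n + 1)" for n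
  have d0: "d n > 0" for n by (simp add: d_def)
  have dlim: "d \<longlonglongrightarrow> 0" using LIMSEQ_inverse_real_of_nat by (simp add: d_def[abs_def] inverse_eq_divide add.commute)
  define z where "z n x = cutoff (d n) (p x) * w x" for n x
  define dz where "dz n i x = cutoff (d n) (p x) * dw i x + (cutoff_deriv (d n) (p x) * dp i x) * w x" for n i x
  have Wz: "W1_data (z n) (dz n)" for n
    unfolding z_def[abs_def] dz_def[abs_def]
    by (rule W1_data_mult[OF W1_data_chain[OF Wp cp' range cutoff_has_derivative[OF d0] continuous_on_cutoff_deriv[OF d0]] W1(1)])
  have diff: "W1_data (\<lambda>x. z n x + (-1) * w x) (\<lambda>i x. dz n i x + (-1) * dw i x)" for n
    by (rule W1_data_add[OF Wz W1_data_cmult[OF W1(1)]])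
  have Ld: "(\<lambda>x. z n x - w x) \<in> Linf" "\<And>i. i \<in> Basis \<Longrightarrow> (\<lambda>x. dz n i x - dw i x) \<in> Linf" for n
    using diff[of n] by (auto simp: W1_data_def)
  have cb: "\<bar>cutoff (d n) t - 1\<bar> \<le> 1" for n t using cutoff_bounds[OF d0, of n t] by auto
  have lim1: "(\<lambda>n. \<integral>x. (norm (z n x - w x))\<^sup>2 \<partial>lebesgue_on \<Omega>) \<longlonglongrightarrow> 0"
  proof (rule L2_tendsto_0_bounded[OF Ld(1)])
    show "AE x in lebesgue_on \<Omega>. \<bar>z n x - w x\<bar> \<le> M" for n
      using M(2)
    proof eventually_elim
      case (elim x)
      have "\<bar>z n x - w x\<bar> = \<bar>cutoff (d n) (p x) - 1\<bar> * \<bar>w x\<bar>"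
        by (simp add: z_def abs_mult[symmetric] left_diff_distrib)
      also have "\<dots> \<le> 1 * M" using elim cb by (intro mult_mono) (auto simp: S_def)
      finally show ?case by simp
    qed
    show "(\<lambda>n. z n x - w x) \<longlonglongrightarrow> 0" for x
    proof (cases "p x > 0")
      case True
      have "(\<lambda>n. cutoff (d n) (p x) * w x - w x) \<longlonglongrightarrow> 1 * w x - w x"
        by (intro tendsto_intros cutoff_tendsto[OF True dlim])
      then show ?thesis by (simp add: z_def)
    next
      case False
      then have "w x = 0" using sw[of x] pw(2)[of x] by simp
      then show ?thesis by (simp add: z_def)
    qed
  qed
  have lim2: "(\<lambda>n. \<integral>x. (norm (dz n i x - dw i x))\<^sup>2 \<partial>lebesgue_on \<Omega>) \<longlonglongrightarrow> 0" if i: "i \<in> Basis" for i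
  proof (rule L2_tendsto_0_bounded[OF Ld(2)[OF i]])
    show "AE x in lebesgue_on \<Omega>. \<bar>dz n i x - dw i x\<bar> \<le> M + C * 4" for n
      using M(2) dpb[OF i]
    proof eventually_elim
      case (elim x)
      have "\<bar>dz n i x - dw i x\<bar> \<le> \<bar>(cutoff (d n) (p x) - 1) * dw i x\<bar> + \<bar>(cutoff_deriv (d n) (p x) * dp i x) * w x\<bar>"
        by (simp add: dz_def algebra_simps)
      also have "\<bar>(cutoff (d n) (p x) - 1) * dw i x\<bar> \<le> 1 * M"
        unfolding abs_mult using elim cb i by (intro mult_mono) (auto simp: S_def)
      \<comment> \<open>One square root of p comes from the gradient of p and one from w. Their
        product is the factor p that compensates the growth of the derivative of the
        cut-off.\<close>
      also have "\<bar>(cutoff_deriv (d n) (p x) * dp i x) * w x\<bar> \<le> (\<bar>cutoff_deriv (d n) (p x)\<bar> * (C * sqrt (p x))) * sqrt (p x)"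
        unfolding abs_mult using elim(2) sw[of x] pw(2)[of x] C0 by (intro mult_mono) auto
      also have "\<dots> = C * (\<bar>cutoff_deriv (d n) (p x)\<bar> * p x)" using pw(2)[of x] by simp
      also have "\<dots> \<le> C * 4" by (intro mult_left_mono cutoff_deriv_bound d0 pw C0)
      finally show ?case by simp
    qed
    show "(\<lambda>n. dz n i x - dw i x) \<longlonglongrightarrow> 0" for x
    proof (cases "p x > 0")
      case True
      have "(\<lambda>n. cutoff (d n) (p x) * dw i x + (cutoff_deriv (d n) (p x) * dp i x) * w x - dw i x) \<longlonglongrightarrow>
          1 * dw i x + (0 * dp i x) * w x - dw i x"
        by (intro tendsto_intros cutoff_tendsto[OF True dlim])
      then show ?thesis by (simp add: dz_def)
    next
      case False
      \<comment> \<open>At a zero of p both w and its gradient vanish, so the error is zero for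
        every n, whatever value \<open>dp i x\<close> has.\<close>
      then have "w x = 0" "dw i x = 0" using sw[of x] sdw[OF i, of x] pw(2)[of x] by auto
      then show ?thesis by (simp add: dz_def)
    qed
  qed
  have "(\<lambda>n. H1_sq (\<lambda>x. z n x - w x) (\<lambda>i x. dz n i x - dw i x)) \<longlonglongrightarrow> 0 + (\<Sum>i\<in>(Basis::'a set). 0)"
    unfolding H1_sq_def by (intro tendsto_add tendsto_sum lim1 lim2)
  \<comment> \<open>The sum of two errors costs a factor 2 for each in the squared norm, so both are
    kept below e / 4.\<close>
  then have "eventually (\<lambda>n. H1_sq (\<lambda>x. z n x - w x) (\<lambda>i x. dz n i x - dw i x) < e / 4) sequentially"
    by (intro order_tendstoD) (use e in auto)
  then obtain n where n: "H1_sq (\<lambda>x. z n x - w x) (\<lambda>i x. dz n i x - dw i x) < e / 4"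
    by (auto simp: eventually_sequentially)
  \<comment> \<open>Closed in the compact closure and away from the boundary, where p is zero while
    \<open>d n\<close> is positive; hence a compact subset of \<Omega>. Off K the cut-off and its
    derivative are zero.\<close>
  define K where "K = closure \<Omega> \<inter> p -` {d n..}"
  have K: "compact K"
  proof -
    have "closed K" unfolding K_def by (rule continuous_closed_preimage[OF cp]) auto
    moreover have "bounded K" using bdd by (auto simp: K_def intro: bounded_subset[OF bounded_closure])
    ultimately show ?thesis by (simp add: compact_eq_bounded_closed)
  qed
  have K\<Omega>: "K \<subseteq> \<Omega>"
  proof
    fix x assume x: "x \<in> K"
    show "x \<in> \<Omega>"
    proof (rule ccontr)
      assume "x \<notin> \<Omega>"
      then have fr: "x \<in> frontier \<Omega>" using x opn by (simp add: K_def frontier_def interior_open)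
      then have "p x = 0" using zero by (simp add: p_def)
      then show False using x d0[of n] by (simp add: K_def)
    qed
  qed
  have out: "p x \<le> d n" if "x \<in> \<Omega> - K" for x
    using that closure_subset by (auto simp: K_def not_le intro: less_imp_le)
  obtain \<psi> :: "'a \<Rightarrow> real" where \<psi>: "\<psi> \<in> test_functions \<Omega>"
    "H1_sq (\<lambda>x. \<psi> x - z n x) (\<lambda>i x. frechet_derivative \<psi> (at x) i - dz n i x) < e / 4"
    using compact_support_approx[OF Wz[of n] K K\<Omega>, of "e / 4"] out e
    by (force simp: z_def dz_def cutoff_eq_0)
  have "H1_sq (\<lambda>x. (\<psi> x - z n x) + (z n x - w x)) (\<lambda>i x. (frechet_derivative \<psi> (at x) i - dz n i x) + (dz n i x - dw i x)) \<le>
    2 * H1_sq (\<lambda>x. \<psi> x - z n x) (\<lambda>i x. frechet_derivative \<psi> (at x) i - dz n i x) +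
    2 * H1_sq (\<lambda>x. z n x - w x) (\<lambda>i x. dz n i x - dw i x)"
    by (intro H1_sq_add_le H1_data_diff test_function_H1_data[OF \<psi>(1)] W1_imp_H1_data[OF Wz] W1_imp_H1_data[OF W1(1)])
  also have "\<dots> < e" using \<psi>(2) n by linarith
  finally have "H1_sq (\<lambda>x. \<psi> x - w x) (\<lambda>i x. frechet_derivative \<psi> (at x) i - dw i x) < e" by simp
  then show ?thesis using \<psi>(1) by blast
qed

text \<open>The approximants are taken with squared error below 1 / (k + 1) and regarded as complex
  valued, which leaves the norms unchanged.\<close>

lemma zero_boundary_H10:
  fixes w :: "'a \<Rightarrow> real"
  assumes W: "W2_data w dw ddw" and cw: "continuous_on (closure \<Omega>) w"
    and cdw: "\<And>i. i \<in> Basis \<Longrightarrow> continuous_on (closure \<Omega>) (dw i)"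
    and zero: "\<And>x. x \<in> frontier \<Omega> \<Longrightarrow> w x = 0" "\<And>i x. i \<in> Basis \<Longrightarrow> x \<in> frontier \<Omega> \<Longrightarrow> dw i x = 0"
  shows "(\<lambda>x. complex_of_real (w x)) \<in> H10_space \<Omega>"
proof -
  have "\<forall>k::nat. \<exists>\<psi>::'a \<Rightarrow> real. \<psi> \<in> test_functions \<Omega> \<and>
    H1_sq (\<lambda>x. \<psi> x - w x) (\<lambda>i x. frechet_derivative \<psi> (at x) i - dw i x) < inverse (real (Suc k))"
    using zero_boundary_approx[OF W cw cdw zero] by simp
  from choice[OF this] obtain \<psi> :: "nat \<Rightarrow> 'a \<Rightarrow> real" where \<psi>: "\<And>k::nat. \<psi> k \<in> test_functions \<Omega>"
    "\<And>k. H1_sq (\<lambda>x. \<psi> k x - w x) (\<lambda>i x. frechet_derivative (\<psi> k) (at x) i - dw i x) < inverse (real (Suc k))"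
    by blast
  have Hw: "H1_data w dw" using W W1_imp_H1_data by (auto simp: W2_data_def)
  have Hc: "H1_data (\<lambda>x. complex_of_real (\<psi> k x - w x)) (\<lambda>i x. complex_of_real (frechet_derivative (\<psi> k) (at x) i - dw i x))" for k
    by (rule H1_data_bounded_linear[OF bounded_linear_of_real H1_data_diff[OF test_function_H1_data[OF \<psi>(1)] Hw]])
  have sq: "H1_sq (\<lambda>x. complex_of_real (f x)) (\<lambda>i x. complex_of_real (df i x)) = H1_sq f df" for f df
    by (simp add: H1_sq_def)
  have "(\<lambda>k. H1_sq (\<lambda>x. \<psi> k x - w x) (\<lambda>i x. frechet_derivative (\<psi> k) (at x) i - dw i x)) \<longlonglongrightarrow> 0"
    by (rule Lim_null_comparison[OF _ LIMSEQ_inverse_real_of_nat])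
      (use \<psi>(2) in \<open>auto simp: H1_sq_nonneg intro!: always_eventually less_imp_le\<close>)
  then have "(\<lambda>k. H1_norm \<Omega> (\<lambda>x. complex_of_real (\<psi> k x - w x))) \<longlonglongrightarrow> 0"
    by (intro H1_norm_tendsto_0_iff[THEN iffD2, OF Hc]) (simp only: sq)
  moreover have "(\<lambda>x. complex_of_real (w x)) \<in> H_space 1 \<Omega>"
    unfolding One_nat_def H_space_1_iff using H1_data_bounded_linear[OF bounded_linear_of_real Hw] by blast
  moreover have "(\<lambda>x. complex_of_real (\<psi> k x)) \<in> test_functions \<Omega>" for k
    by (rule test_functions_bounded_linear[OF bounded_linear_of_real \<psi>(1)])
  ultimately show ?thesis
    unfolding H10_space_def by (intro CollectI conjI exI[of _ "\<lambda>k x. complex_of_real (\<psi> k x)"]) auto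
qed

end

section \<open>The coefficients of the theorem\<close>

text \<open>The space of \<open>surface_measure\<close> is the boundary alone, so boundary data that
  agree there are interchangeable, whatever their values elsewhere.\<close>

lemma has_trace_cong_frontier:
  fixes u :: "'a::euclidean_space \<Rightarrow> 'b::euclidean_space"
  assumes tr: "has_trace \<Omega> u g" and eq: "\<And>x. x \<in> frontier \<Omega> \<Longrightarrow> g x = g' x"
  shows "has_trace \<Omega> u g'"
proof -
  have m: "g \<in> borel_measurable (surface_measure \<Omega>) \<longleftrightarrow> g' \<in> borel_measurable (surface_measure \<Omega>)"
    by (rule measurable_cong) (simp add: eq space_surface_measure)
  have i: "integrable (surface_measure \<Omega>) (\<lambda>x. (norm (g x))\<^sup>2) \<longleftrightarrow> integrable (surface_measure \<Omega>) (\<lambda>x. (norm (g' x))\<^sup>2)"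
    by (rule Bochner_Integration.integrable_cong[OF refl]) (simp add: eq space_surface_measure)
  have n: "(\<integral>\<^sup>+ x. ennreal ((norm (w x - g x))\<^sup>2) \<partial>surface_measure \<Omega>) =
      (\<integral>\<^sup>+ x. ennreal ((norm (w x - g' x))\<^sup>2) \<partial>surface_measure \<Omega>)" for w
    by (rule nn_integral_cong) (simp add: eq space_surface_measure)
  show ?thesis using tr unfolding has_trace_def L2_space_def by (simp add: m i n)
qed

context bounded_open
begin

text \<open>The set of points of \<Omega> where f is negative is open and null, hence empty;
  continuity extends the inequality to the closure.\<close>

lemma AE_nonneg_imp_closure_nonneg:
  fixes f :: "'a \<Rightarrow> real"
  assumes f: "continuous_on (closure \<Omega>) f" and ae: "AE x in lebesgue_on \<Omega>. f x \<ge> 0" and x: "x \<in> closure \<Omega>"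
  shows "f x \<ge> 0"
proof -
  have c: "continuous_on \<Omega> f" by (rule continuous_on_subset[OF f closure_subset])
  define U where "U = {x \<in> \<Omega>. f x < 0}"
  have "U = \<Omega> \<inter> f -` {..<0}" by (auto simp: U_def)
  then have oU: "open U" using continuous_open_preimage[OF c opn open_lessThan] by simp
  have "AE x in lborel. x \<notin> U"
    using ae unfolding AE_lebesgue_on_iff[OF opn] by eventually_elim (auto simp: U_def)
  then have "U \<in> null_sets lborel" using oU by (subst AE_iff_null_sets) auto
  then have "negligible U" by (simp add: negligible_iff_null_sets null_sets_completionI)
  then have "U = {}" using open_not_negligible[OF oU] by blast
  then have "\<And>y. y \<in> \<Omega> \<Longrightarrow> f y \<ge> 0" by (force simp: U_def)
  then show ?thesis using continuous_ge_on_closure[OF f x] by blast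
qed

lemma AE_eq_imp_closure_eq:
  fixes f g :: "'a \<Rightarrow> real"
  assumes "continuous_on (closure \<Omega>) f" "continuous_on (closure \<Omega>) g"
    and ae: "AE x in lebesgue_on \<Omega>. f x = g x" and x: "x \<in> closure \<Omega>"
  shows "f x = g x"
proof -
  have "f x - g x \<ge> 0" "g x - f x \<ge> 0"
    using ae by (intro AE_nonneg_imp_closure_nonneg[OF _ _ x] continuous_intros assms; (elim eventually_mono)?; simp)+
  then show ?thesis by simp
qed

lemma has_bdry_value_unique:
  assumes "has_bdry_value \<Omega> f x l" "continuous_on (closure \<Omega>) g" "AE y in lebesgue_on \<Omega>. g y = f y" "x \<in> closure \<Omega>"
  shows "l = g x"
proof -
  obtain h where h: "continuous_on (closure \<Omega>) h" "AE y in lebesgue_on \<Omega>. h y = f y" "h x = l"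
    using assms(1) by (auto simp: has_bdry_value_def)
  have "AE y in lebesgue_on \<Omega>. h y = g y" using h(2) assms(3) by eventually_elim simp
  from AE_eq_imp_closure_eq[OF h(1) assms(2) this assms(4)] show ?thesis using h(3) by simp
qed

text \<open>The square root is taken of a continuous representative of a; the essential lower bound
  then holds on all of the closure and keeps the argument of the root away from zero. The last two
  conclusions express any boundary value of a and its gradient by b^2 and 2 b \<nabla>b.\<close>

lemma good_coeff_sqrt:
  assumes a: "a \<in> Winf_space 2 \<Omega>" and a0: "a0 > 0" "AE x in lebesgue_on \<Omega>. a x \<ge> a0"
    and bv: "has_bdry_value \<Omega> a x0 l0" "\<And>i. i \<in> Basis \<Longrightarrow> \<exists>l. has_bdry_value \<Omega> (weak_deriv \<Omega> i a) x0 l"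
  obtains b db ddb where "good_coeff b db ddb" "AE x in lebesgue_on \<Omega>. a x = (b x)\<^sup>2"
    "\<forall>x\<in>closure \<Omega>. \<forall>l. has_bdry_value \<Omega> a x l \<longrightarrow> l = (b x)\<^sup>2"
    "\<forall>x\<in>closure \<Omega>. \<forall>i\<in>Basis. \<forall>l. has_bdry_value \<Omega> (weak_deriv \<Omega> i a) x l \<longrightarrow> l = 2 * b x * db i x"
proof -
  obtain da dda where d: "W2_data a da dda" using Winf_space_2E[OF a] by blast
  \<comment> \<open>A boundary value at the single point x0 already supplies a representative that
    is continuous on the whole closure.\<close>
  obtain g where g: "continuous_on (closure \<Omega>) g" "AE y in lebesgue_on \<Omega>. g y = a y"
    using bv(1) by (auto simp: has_bdry_value_def)
  have "\<forall>i\<in>Basis. \<exists>h. continuous_on (closure \<Omega>) h \<and> (AE y in lebesgue_on \<Omega>. h y = weak_deriv \<Omega> i a y)"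
    using bv(2) unfolding has_bdry_value_def by blast
  from bchoice[OF this] obtain dg where dg: "\<And>i. i \<in> Basis \<Longrightarrow> continuous_on (closure \<Omega>) (dg i)"
    "\<And>i. i \<in> Basis \<Longrightarrow> AE y in lebesgue_on \<Omega>. dg i y = weak_deriv \<Omega> i a y" by blast
  have da_dg: "AE x in lebesgue_on \<Omega>. da i x = dg i x" if i: "i \<in> Basis" for i
  proof -
    have "AE x in lebesgue_on \<Omega>. weak_deriv \<Omega> i a x = da i x"
      using d i by (intro weak_deriv_AE_eq[OF opn]) (auto simp: W2_data_def W1_data_def)
    then show ?thesis using dg(2)[OF i] by eventually_elim simp
  qed
  have ge: "g x \<ge> a0" if x: "x \<in> closure \<Omega>" for x
  proof -
    have "AE x in lebesgue_on \<Omega>. g x - a0 \<ge> 0" using g(2) a0(2) by eventually_elim simp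
    from AE_nonneg_imp_closure_nonneg[OF _ this x] show ?thesis using g(1) by (simp add: continuous_intros)
  qed
  \<comment> \<open>On the closure f is g. The maximum makes f positive on the entire space, since b
    has to be positive at every point.\<close>
  define f where "f x = max (g x) a0" for x
  have fg: "f x = g x" if "x \<in> closure \<Omega>" for x using ge[OF that] by (simp add: f_def)
  have cf: "continuous_on (closure \<Omega>) f" unfolding f_def[abs_def] by (intro continuous_intros g(1))
  have aef: "AE x in lebesgue_on \<Omega>. a x = f x"
  proof -
    have "AE x in lebesgue_on \<Omega>. x \<in> closure \<Omega>" using closure_subset by (intro AE_I2) auto
    then show ?thesis using g(2) by eventually_elim (simp add: fg)
  qed
  have Wf: "W2_data f dg dda"
    unfolding W2_data_def
  proof (intro conjI ballI)
    show "W1_data f dg"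
      by (rule W1_data_cong_AE[OF _ aef da_dg]) (use d in \<open>auto simp: W2_data_def\<close>)
    show "W1_data (dg i) (dda i)" if "i \<in> Basis" for i
      by (rule W1_data_cong_AE[OF _ da_dg[OF that]]) (use d that in \<open>auto simp: W2_data_def\<close>)
  qed
  obtain U where "\<And>x. x \<in> closure \<Omega> \<Longrightarrow> \<bar>f x\<bar> \<le> U" using continuous_closure_bounded[OF cf] by metis
  then have range: "\<And>x. x \<in> closure \<Omega> \<Longrightarrow> f x \<in> {a0..U}" by (force simp: f_def)
  have d1: "(sqrt has_real_derivative inverse (sqrt t) / 2) (at t)" if "t \<in> {a0..U}" for t
    using that a0(1) by (intro DERIV_real_sqrt) auto
  have d2: "((\<lambda>t. inverse (sqrt t) / 2) has_real_derivative - (inverse (sqrt t) * (inverse (sqrt t) / 2) * inverse (sqrt t)) / 2) (at t)" if "t \<in> {a0..U}" for t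
  proof -
    have "sqrt t \<noteq> 0" using that a0(1) by simp
    from DERIV_cdivide[OF DERIV_inverse'[OF d1[OF that] this]] show ?thesis .
  qed
  have d3: "continuous_on {a0..U} (\<lambda>t. - (inverse (sqrt t) * (inverse (sqrt t) / 2) * inverse (sqrt t)) / 2)"
    using a0(1) by (auto intro!: continuous_intros)
  note ch = W2_data_chain[OF Wf cf dg(1) range d1 d2 d3]
  obtain ddb where ddb: "W2_data (\<lambda>x. sqrt (f x)) (\<lambda>i x. inverse (sqrt (f x)) / 2 * dg i x) ddb"
    using ch(1) by blast
  have fpos: "f x > 0" for x using a0(1) by (simp add: f_def max_def)
  have gc: "good_coeff (\<lambda>x. sqrt (f x)) (\<lambda>i x. inverse (sqrt (f x)) / 2 * dg i x) ddb"
    using ddb ch(2,3) fpos by (auto simp: good_coeff_def)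
  show thesis
  proof (rule that[OF gc])
    show "AE x in lebesgue_on \<Omega>. a x = (sqrt (f x))\<^sup>2"
      using aef by eventually_elim (use fpos in \<open>simp add: less_imp_le\<close>)
    show "\<forall>x\<in>closure \<Omega>. \<forall>l. has_bdry_value \<Omega> a x l \<longrightarrow> l = (sqrt (f x))\<^sup>2"
    proof (intro ballI allI impI)
      fix x l assume x: "x \<in> closure \<Omega>" and l: "has_bdry_value \<Omega> a x l"
      show "l = (sqrt (f x))\<^sup>2"
        using has_bdry_value_unique[OF l g x] fg[OF x] fpos[of x] by simp
    qed
    show "\<forall>x\<in>closure \<Omega>. \<forall>i\<in>Basis. \<forall>l. has_bdry_value \<Omega> (weak_deriv \<Omega> i a) x l \<longrightarrow>
        l = 2 * sqrt (f x) * (inverse (sqrt (f x)) / 2 * dg i x)"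
    proof (intro ballI allI impI)
      fix x i l assume x: "x \<in> closure \<Omega>" and i: "i \<in> Basis" and l: "has_bdry_value \<Omega> (weak_deriv \<Omega> i a) x l"
      show "l = 2 * sqrt (f x) * (inverse (sqrt (f x)) / 2 * dg i x)"
        using has_bdry_value_unique[OF l dg(1)[OF i] dg(2)[OF i] x] fpos[of x] by simp
    qed
  qed
qed

lemma bdry_value_eq:
  assumes "x \<in> closure \<Omega>" "has_bdry_value \<Omega> a x l"
  shows "bdry_value \<Omega> a x = l"
  unfolding bdry_value_def
proof (rule the_equality)
  obtain g where g: "continuous_on (closure \<Omega>) g" "AE y in lebesgue_on \<Omega>. g y = a y" "g x = l"
    using assms(2) by (auto simp: has_bdry_value_def)
  show "l' = l" if "has_bdry_value \<Omega> a x l'" for l'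
    using has_bdry_value_unique[OF that g(1,2) assms(1)] g(3) by simp
qed (rule assms(2))

lemma W1_data_diff:
  assumes "W1_data u du" "W1_data v dv"
  shows "W1_data (\<lambda>x. u x - v x) (\<lambda>i x. du i x - dv i x)"
  using W1_data_add[OF assms(1) W1_data_cmult[OF assms(2), of "-1"]] by simp

text \<open>A solution v with datum \<phi> becomes v / b1 with datum \<phi> / b1; the inclusion of
  the N maps at this datum gives a solution for a2 with the same flux, and b2 times it has datum
  \<phi> again because b1 = b2 on the boundary. The extra normal derivative terms cancel as the
  gradients agree there.\<close>

lemma Lambda_star_subset:
  assumes g1: "good_coeff b1 db1 ddb1" and g2: "good_coeff b2 db2 ddb2"
    and a1: "AE x in lebesgue_on \<Omega>. a1 x = (b1 x)\<^sup>2" and a2: "AE x in lebesgue_on \<Omega>. a2 x = (b2 x)\<^sup>2"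
    and bv: "\<And>x. x \<in> frontier \<Omega> \<Longrightarrow> bdry_value \<Omega> a1 x = (b1 x)\<^sup>2" "\<And>x. x \<in> frontier \<Omega> \<Longrightarrow> bdry_value \<Omega> a2 x = (b2 x)\<^sup>2"
    and eq: "\<And>x. x \<in> frontier \<Omega> \<Longrightarrow> b1 x = b2 x" "\<And>i x. i \<in> Basis \<Longrightarrow> x \<in> frontier \<Omega> \<Longrightarrow> db1 i x = db2 i x"
    and N: "\<And>\<phi>. \<phi> \<in> H32_bdry \<Omega> \<Longrightarrow> N_star \<Omega> V a1 \<phi> \<subseteq> N_star \<Omega> V a2 \<phi>"
  shows "Lambda_star \<Omega> V (liouville_potential b1 ddb1) \<phi> \<subseteq> Lambda_star \<Omega> V (liouville_potential b2 ddb2) \<phi>"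
proof
  fix \<theta> assume "\<theta> \<in> Lambda_star \<Omega> V (liouville_potential b1 ddb1) \<phi>"
  then obtain v h where v: "v \<in> schroedinger_solution \<Omega> (liouville_potential b1 ddb1) \<phi>"
    and h: "has_normal_deriv \<Omega> v h" and \<theta>: "AE x in surface_measure \<Omega>. x \<in> V \<longrightarrow> \<theta> x = h x"
    by (auto simp: Lambda_star_def)
  obtain dv ddv where dv: "H2_data v dv ddv" using v unfolding schroedinger_solution_def H_space_2_iff by blast
  obtain ddc where c: "good_coeff (\<lambda>x. inverse (b1 x)) (\<lambda>i x. - (inverse (b1 x))\<^sup>2 * db1 i x) ddc"
    using good_coeff_inverse[OF g1] by blast
  have pos: "b1 x > 0" "b2 x > 0" for x using g1 g2 by (auto simp: good_coeff_def)
  define u where "u x = inverse (b1 x) *\<^sub>R v x" for x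
  define \<phi>' where "\<phi>' x = inverse (b1 x) *\<^sub>R \<phi> x" for x
  define h' where "h' x = inverse (b1 x) *\<^sub>R h x +
     (\<Sum>i\<in>Basis. (outer_normal \<Omega> x \<bullet> i) * (- (inverse (b1 x))\<^sup>2 * db1 i x)) *\<^sub>R \<phi> x" for x
  have u: "u \<in> conductivity_solution \<Omega> a1 \<phi>'"
    using conductivity_of_schroedinger[OF g1 a1 v] by (simp add: u_def[abs_def] \<phi>'_def[abs_def])
  have nu: "has_normal_deriv \<Omega> u h'"
    using has_normal_deriv_scaleR[OF c dv _ h, of \<phi>] v
    by (simp add: u_def[abs_def] h'_def[abs_def] schroedinger_solution_def)
  have "\<phi>' \<in> H32_bdry \<Omega>" using u by (auto simp: H32_bdry_def conductivity_solution_def)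
  moreover have "(\<lambda>x. bdry_value \<Omega> a1 x *\<^sub>R h' x) \<in> N_star \<Omega> V a1 \<phi>'"
    unfolding N_star_def using u nu by auto
  ultimately have "(\<lambda>x. bdry_value \<Omega> a1 x *\<^sub>R h' x) \<in> N_star \<Omega> V a2 \<phi>'" using N by blast
  then obtain u2 g where u2: "u2 \<in> conductivity_solution \<Omega> a2 \<phi>'" and g: "has_normal_deriv \<Omega> u2 g"
    and ae: "AE x in surface_measure \<Omega>. x \<in> V \<longrightarrow> bdry_value \<Omega> a1 x *\<^sub>R h' x = bdry_value \<Omega> a2 x *\<^sub>R g x"
    by (auto simp: N_star_def)
  obtain du2 ddu2 where du2: "H2_data u2 du2 ddu2" using u2 unfolding conductivity_solution_def H_space_2_iff by blast
  have "(\<lambda>x. b2 x *\<^sub>R u2 x) \<in> schroedinger_solution \<Omega> (liouville_potential b2 ddb2) (\<lambda>x. b2 x *\<^sub>R \<phi>' x)"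
    by (rule schroedinger_of_conductivity[OF g2 a2 u2])
  moreover have "b2 x *\<^sub>R \<phi>' x = \<phi> x" if "x \<in> frontier \<Omega>" for x
    using eq(1)[OF that] pos(2)[of x] by (simp add: \<phi>'_def)
  ultimately have v2: "(\<lambda>x. b2 x *\<^sub>R u2 x) \<in> schroedinger_solution \<Omega> (liouville_potential b2 ddb2) \<phi>"
    unfolding schroedinger_solution_def by (auto intro: has_trace_cong_frontier)
  let ?h2 = "\<lambda>x. b2 x *\<^sub>R g x + (\<Sum>i\<in>Basis. (outer_normal \<Omega> x \<bullet> i) * db2 i x) *\<^sub>R \<phi>' x"
  have n2: "has_normal_deriv \<Omega> (\<lambda>x. b2 x *\<^sub>R u2 x) ?h2"
    using u2 by (intro has_normal_deriv_scaleR[OF g2 du2 _ g]) (simp add: conductivity_solution_def)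
  \<comment> \<open>Here c is b, s its normal derivative, y the normal derivative of v and z its
    trace: dividing by b and multiplying by b again returns the normal derivative.\<close>
  have alg: "c *\<^sub>R (inverse c *\<^sub>R y + (- (inverse c)\<^sup>2 * s) *\<^sub>R z) + s *\<^sub>R (inverse c *\<^sub>R z) = y"
    if "c > 0" for c s :: real and y z :: complex
    using that by (simp add: scaleR_conv_of_real power2_eq_square field_simps)
  have "AE x in surface_measure \<Omega>. x \<in> frontier \<Omega>" by (intro AE_I2) (simp add: space_surface_measure)
  then have "AE x in surface_measure \<Omega>. x \<in> V \<longrightarrow> \<theta> x = ?h2 x"
    using \<theta> ae
  proof eventually_elim
    case (elim x)
    show ?case
    proof
      assume V: "x \<in> V"
      have fr: "x \<in> frontier \<Omega>" using elim(1) .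
      have b: "b2 x = b1 x" "(\<Sum>i\<in>Basis. (outer_normal \<Omega> x \<bullet> i) * db2 i x) = (\<Sum>i\<in>Basis. (outer_normal \<Omega> x \<bullet> i) * db1 i x)"
        using eq(1)[OF fr] eq(2)[OF _ fr] by simp_all
      \<comment> \<open>The fluxes agree on V, and the boundary values of a1 and a2 are the same
        positive number, by which one may divide.\<close>
      have "g x = h' x" using elim(3) V bv[OF fr] b(1) pos(1)[of x] by simp
      moreover have "(\<Sum>i\<in>Basis. (outer_normal \<Omega> x \<bullet> i) * (- (inverse (b1 x))\<^sup>2 * db1 i x)) =
          - (inverse (b1 x))\<^sup>2 * (\<Sum>i\<in>Basis. (outer_normal \<Omega> x \<bullet> i) * db1 i x)"
        unfolding sum_distrib_left by (rule sum.cong) auto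
      ultimately have "?h2 x = b1 x *\<^sub>R (inverse (b1 x) *\<^sub>R h x +
          (- (inverse (b1 x))\<^sup>2 * (\<Sum>i\<in>Basis. (outer_normal \<Omega> x \<bullet> i) * db1 i x)) *\<^sub>R \<phi> x) +
          (\<Sum>i\<in>Basis. (outer_normal \<Omega> x \<bullet> i) * db1 i x) *\<^sub>R (inverse (b1 x) *\<^sub>R \<phi> x)"
        by (simp add: b h'_def \<phi>'_def)
      also have "\<dots> = h x"
        by (rule alg[OF pos(1)])
      finally show "\<theta> x = ?h2 x" using elim(2) V by simp
    qed
  qed
  then show "\<theta> \<in> Lambda_star \<Omega> V (liouville_potential b2 ddb2) \<phi>"
    unfolding Lambda_star_def using v2 n2 by blast
qed

lemma coefficients_eq:
  assumes g1: "good_coeff b1 db1 ddb1" and g2: "good_coeff b2 db2 ddb2"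
    and eq: "\<And>x. x \<in> frontier \<Omega> \<Longrightarrow> b1 x = b2 x" "\<And>i x. i \<in> Basis \<Longrightarrow> x \<in> frontier \<Omega> \<Longrightarrow> db1 i x = db2 i x"
    and q: "AE x in lebesgue_on \<Omega>. liouville_potential b1 ddb1 x = liouville_potential b2 ddb2 x"
  shows "AE x in lebesgue_on \<Omega>. b1 x = b2 x"
proof -
  define w where "w x = b1 x - b2 x" for x
  have pos: "b1 x > 0" "b2 x > 0" for x using g1 g2 by (auto simp: good_coeff_def)
  have W: "W2_data w (\<lambda>i x. db1 i x - db2 i x) (\<lambda>i j x. ddb1 i j x - ddb2 i j x)"
    using g1 g2 unfolding good_coeff_def W2_data_def w_def[abs_def]
    by (auto intro!: W1_data_diff)
  have H: "H2_data (\<lambda>x. complex_of_real (w x)) (\<lambda>i x. complex_of_real (db1 i x - db2 i x))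
    (\<lambda>i j x. complex_of_real (ddb1 i j x - ddb2 i j x))"
    by (rule H2_data_bounded_linear[OF bounded_linear_of_real W2_imp_H2_data[OF W]])
  have "(\<lambda>x. complex_of_real (w x)) \<in> H10_space \<Omega>"
  proof (rule zero_boundary_H10[OF W])
    show "continuous_on (closure \<Omega>) w" "\<And>i. i \<in> Basis \<Longrightarrow> continuous_on (closure \<Omega>) (\<lambda>x. db1 i x - db2 i x)"
      using g1 g2 unfolding good_coeff_def w_def[abs_def] by (auto intro!: continuous_intros)
  qed (simp_all add: w_def eq)
  moreover have "(\<lambda>x. complex_of_real (w x)) \<in> H_space 2 \<Omega>" unfolding H_space_2_iff using H by blast
  moreover have "AE x in lebesgue_on \<Omega>. - laplacian \<Omega> (\<lambda>x. complex_of_real (w x)) x +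
      liouville_potential b1 ddb1 x *\<^sub>R complex_of_real (w x) = 0"
    using laplacian_AE[OF H] q
  proof eventually_elim
    case (elim x)
    \<comment> \<open>By the definition of the potential each b solves \<Delta>b = q b; with equal
      potentials the difference solves the same linear equation.\<close>
    have "(\<Sum>i\<in>Basis. ddb1 i i x) = liouville_potential b1 ddb1 x * b1 x" "(\<Sum>i\<in>Basis. ddb2 i i x) = liouville_potential b2 ddb2 x * b2 x"
      using pos[of x] by (simp_all add: liouville_potential_def)
    then have "(\<Sum>i\<in>Basis. ddb1 i i x - ddb2 i i x) = liouville_potential b1 ddb1 x * w x"
      using elim(2) by (simp add: sum_subtractf w_def algebra_simps)
    then show ?case unfolding elim(1) of_real_sum[symmetric] by (simp add: scaleR_conv_of_real)
  qed
  ultimately have "AE x in lebesgue_on \<Omega>. complex_of_real (w x) = 0"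
    using liouville_potential_Q_class[OF g1] unfolding Q_class_def by blast
  then show ?thesis by eventually_elim (simp add: w_def)
qed

end

theorem corollary3p1:
  fixes \<Omega> V :: "'a::euclidean_space set" and \<eta> :: 'a and \<epsilon> :: real
    and a\<^sub>1 a\<^sub>2 :: "'a \<Rightarrow> real"
  assumes dim: "DIM('a) \<ge> 3"
    and domain: "open \<Omega>" "connected \<Omega>" "\<Omega> \<noteq> {}" "bounded \<Omega>" "C2_boundary \<Omega>"
    and eta: "norm \<eta> = 1" and eps: "\<epsilon> > 0"
    and V: "V = bdry_part \<Omega> \<eta> \<epsilon>"
    and W2inf: "a\<^sub>1 \<in> Winf_space 2 \<Omega>" "a\<^sub>2 \<in> Winf_space 2 \<Omega>"
    and lower: "\<exists>a\<^sub>0>0. AE x in lebesgue_on \<Omega>. a\<^sub>1 x \<ge> a\<^sub>0 \<and> a\<^sub>2 x \<ge> a\<^sub>0"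
    and bdry_eq: "\<forall>x\<in>frontier \<Omega>. \<exists>l. has_bdry_value \<Omega> a\<^sub>1 x l \<and> has_bdry_value \<Omega> a\<^sub>2 x l"
    and bdry_grad_eq: "\<forall>x\<in>frontier \<Omega>. \<forall>i\<in>Basis. \<exists>l.
      has_bdry_value \<Omega> (weak_deriv \<Omega> i a\<^sub>1) x l \<and> has_bdry_value \<Omega> (weak_deriv \<Omega> i a\<^sub>2) x l"
    and uniqueness: "\<forall>q\<^sub>1\<in>Q_class \<Omega>. \<forall>q\<^sub>2\<in>Q_class \<Omega>.
      (\<forall>\<phi>\<in>H32_bdry \<Omega>. Lambda_star \<Omega> V q\<^sub>1 \<phi> = Lambda_star \<Omega> V q\<^sub>2 \<phi>) \<longrightarrow>
      (AE x in lebesgue_on \<Omega>. q\<^sub>1 x = q\<^sub>2 x)"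
    and N_eq: "\<forall>\<phi>\<in>H32_bdry \<Omega>. N_star \<Omega> V a\<^sub>1 \<phi> = N_star \<Omega> V a\<^sub>2 \<phi>"
  shows "AE x in lebesgue_on \<Omega>. a\<^sub>1 x = a\<^sub>2 x"
proof -
  interpret bounded_open \<Omega> by (rule bounded_open.intro) (use domain in auto)
  \<comment> \<open>A boundary point is required: the continuous representatives of the coefficients
    and their gradients are extracted from the boundary hypotheses at x0.\<close>
  have "\<Omega> \<noteq> UNIV" using domain(4) not_bounded_UNIV by metis
  then have "frontier \<Omega> \<noteq> {}" using domain(3) frontier_eq_empty by blast
  then obtain x0 where x0: "x0 \<in> frontier \<Omega>" by blast
  have fr_cl: "x \<in> closure \<Omega>" if "x \<in> frontier \<Omega>" for x using that by (simp add: frontier_def)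
  obtain a0 where a0: "a0 > 0" "AE x in lebesgue_on \<Omega>. a\<^sub>1 x \<ge> a0" "AE x in lebesgue_on \<Omega>. a\<^sub>2 x \<ge> a0"
    using lower by (auto simp: eventually_conj_iff)
  obtain l0 where l0: "has_bdry_value \<Omega> a\<^sub>1 x0 l0" "has_bdry_value \<Omega> a\<^sub>2 x0 l0" using bdry_eq x0 by blast
  have l1: "\<exists>l. has_bdry_value \<Omega> (weak_deriv \<Omega> i a\<^sub>1) x0 l" "\<exists>l. has_bdry_value \<Omega> (weak_deriv \<Omega> i a\<^sub>2) x0 l"
    if "i \<in> Basis" for i
    using bdry_grad_eq x0 that by blast+
  obtain b1 db1 ddb1 where b1: "good_coeff b1 db1 ddb1" "AE x in lebesgue_on \<Omega>. a\<^sub>1 x = (b1 x)\<^sup>2"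
    "\<forall>x\<in>closure \<Omega>. \<forall>l. has_bdry_value \<Omega> a\<^sub>1 x l \<longrightarrow> l = (b1 x)\<^sup>2"
    "\<forall>x\<in>closure \<Omega>. \<forall>i\<in>Basis. \<forall>l. has_bdry_value \<Omega> (weak_deriv \<Omega> i a\<^sub>1) x l \<longrightarrow> l = 2 * b1 x * db1 i x"
    by (rule good_coeff_sqrt[OF W2inf(1) a0(1,2) l0(1) l1(1)])
  obtain b2 db2 ddb2 where b2: "good_coeff b2 db2 ddb2" "AE x in lebesgue_on \<Omega>. a\<^sub>2 x = (b2 x)\<^sup>2"
    "\<forall>x\<in>closure \<Omega>. \<forall>l. has_bdry_value \<Omega> a\<^sub>2 x l \<longrightarrow> l = (b2 x)\<^sup>2"
    "\<forall>x\<in>closure \<Omega>. \<forall>i\<in>Basis. \<forall>l. has_bdry_value \<Omega> (weak_deriv \<Omega> i a\<^sub>2) x l \<longrightarrow> l = 2 * b2 x * db2 i x"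
    by (rule good_coeff_sqrt[OF W2inf(2) a0(1,3) l0(2) l1(2)])
  have pos: "b1 x > 0" "b2 x > 0" for x using b1(1) b2(1) by (auto simp: good_coeff_def)
  have bv: "bdry_value \<Omega> a\<^sub>1 x = (b1 x)\<^sup>2" "bdry_value \<Omega> a\<^sub>2 x = (b2 x)\<^sup>2" "b1 x = b2 x" if x: "x \<in> frontier \<Omega>" for x
  proof -
    obtain l where l: "has_bdry_value \<Omega> a\<^sub>1 x l" "has_bdry_value \<Omega> a\<^sub>2 x l" using bdry_eq x by blast
    have e: "l = (b1 x)\<^sup>2" "l = (b2 x)\<^sup>2" using b1(3) b2(3) fr_cl[OF x] l by blast+
    show "bdry_value \<Omega> a\<^sub>1 x = (b1 x)\<^sup>2" using bdry_value_eq[OF fr_cl[OF x] l(1)] e(1) by simp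
    show "bdry_value \<Omega> a\<^sub>2 x = (b2 x)\<^sup>2" using bdry_value_eq[OF fr_cl[OF x] l(2)] e(2) by simp
    show "b1 x = b2 x" using e pos[of x] power2_eq_imp_eq[of "b1 x" "b2 x"] by simp
  qed
  have db: "db1 i x = db2 i x" if i: "i \<in> Basis" and x: "x \<in> frontier \<Omega>" for i x
  proof -
    obtain l where l: "has_bdry_value \<Omega> (weak_deriv \<Omega> i a\<^sub>1) x l" "has_bdry_value \<Omega> (weak_deriv \<Omega> i a\<^sub>2) x l"
      using bdry_grad_eq x i by blast
    then have "l = 2 * b1 x * db1 i x" "l = 2 * b2 x * db2 i x" using b1(4) b2(4) fr_cl[OF x] i by blast+
    then show ?thesis using bv(3)[OF x] pos[of x] by simp
  qed
  let ?q1 = "liouville_potential b1 ddb1" and ?q2 = "liouville_potential b2 ddb2"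
  have "Lambda_star \<Omega> V ?q1 \<phi> = Lambda_star \<Omega> V ?q2 \<phi>" for \<phi>
  proof
    show "Lambda_star \<Omega> V ?q1 \<phi> \<subseteq> Lambda_star \<Omega> V ?q2 \<phi>"
      by (rule Lambda_star_subset[OF b1(1) b2(1) b1(2) b2(2)]) (use bv db N_eq in auto)
    show "Lambda_star \<Omega> V ?q2 \<phi> \<subseteq> Lambda_star \<Omega> V ?q1 \<phi>"
      by (rule Lambda_star_subset[OF b2(1) b1(1) b2(2) b1(2)]) (use bv db N_eq in auto)
  qed
  then have "AE x in lebesgue_on \<Omega>. ?q1 x = ?q2 x"
    using uniqueness liouville_potential_Q_class[OF b1(1)] liouville_potential_Q_class[OF b2(1)] by blast
  then have "AE x in lebesgue_on \<Omega>. b1 x = b2 x" by (intro coefficients_eq[OF b1(1) b2(1)] bv(3) db)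
  then show ?thesis using b1(2) b2(2) by eventually_elim simp
qed

end
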